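(* Let $N>1$ be an odd square-free integer and $m$ a (positive) divisor of $N$. Then for all $n\ge 0$, $$\frac{2^{\omega(N/m)}\,m}{N}\,H_{m,N}(n)=\sum_{g\mid N/m}u(g)\,H^{(mg,\,N/(mg))}(n),\qquad u(g)=\Big(\prod_{p\mid g}\frac{1}{p-1}\Big)\Big(\prod_{p\mid \frac{N}{mg}}\frac{1}{p+1}\Big).$$ In particular $H_{N,N}(n)=H^{(N,1)}(n)$ for all $n\ge 0$.
   Context: $\omega(N)$ is the number of distinct prime divisors of $N$, $\mu$ the Möbius function. For an integer $n>0$, $H(n)$ is the Hurwitz class number (number of $\mathrm{SL}_2(\mathbb{Z})$-classes of positive definite binary quadratic forms of discriminant $-n$, classes of multiples of $x^2+y^2$, resp. $x^2+xy+y^2$, weighted $1/2$, resp. $1/3$), $H(n)=0$ for $n\equiv1,2\pmod 4$, $H(0)=-1/12$. A discriminant is an integer $\equiv 0,1\pmod4$; a fundamental discriminant is one not of the form $Df^2$ with $f>1$, $D$ a discriminant. For $n>0$, $n\equiv 0,3\pmod4$, write $-n=D_nf_n^2$ with $D_n$ fundamental. $\chi_D=(\frac D\cdot)$ Kronecker symbol; $L_m(s,\chi)=L(s,\chi)\prod_{p\mid m}(1-\chi(p)p^{-s})$; $\sigma_{m,N,1}(r)=\sum_{d\mid r,\gcd(d,m)=1,\gcd(r/d,N/m)=1}d$. Pei–Wang class numbers ($N$ odd square-free, $m\mid N$): $H_{m,N}(0)=-\frac1{12}\prod_{p\mid N}(1-p)$ if $m=N$ and $0$ otherwise; $H_{m,N}(n)=0$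 for $n\equiv1,2\pmod 4$; for $n>0$, $n\equiv 0,3\pmod4$, $H_{m,N}(n)=L_m(0,\chi_{D_n})\prod_{p\mid N/m}\frac{1-\chi_{D_n}(p)p^{-1}}{1-p^{-2}}\sum_{a\mid f_n,\gcd(a,N)=1}\mu(a)\chi_{D_n}(a)\sigma_{m,N,1}(f_n/a)$. Li–Skoruppa–Zhou modified class numbers (for coprime square-free positive integers $N_1,N_2$ and integer $D\ge 0$): $H^{(N_1,N_2)}(0)=-\frac1{12}\prod_{p\mid N_1}(1-p)\prod_{p\mid N_2}(p+1)$; $H^{(N_1,N_2)}(D)=0$ if $D\equiv1,2\pmod4$; for $D>0$, $D\equiv 0,3\pmod 4$, let $f=f_{N_1,N_2}$ be the largest positive integer all of whose prime factors divide $N_1N_2$ such that $\Delta:=-D/f^2$ is a discriminant, $f_p$ the $p$-part of $f$, and set $$H^{(N_1,N_2)}(D)=H(D/f^2)\prod_{p\mid N_1}\Big(1-\big(\tfrac{\Delta}{p}\big)\Big)\prod_{p\mid N_2}\frac{2pf_p-p-1-(\frac{\Delta}{p})(2f_p-p-1)}{p-1}.$$ *)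

theory Defs
  imports "HOL-Complex_Analysis.Complex_Analysis" "HOL-Number_Theory.Number_Theory"
    "HOL-Computational_Algebra.Squarefree"
begin

definition omega :: "nat \<Rightarrow> nat" where
  "omega N = card (prime_factors N)"

definition moebius :: "nat \<Rightarrow> int" where
  "moebius a = (if squarefree a then (-1) ^ card (prime_factors a) else 0)"

definition is_disc :: "int \<Rightarrow> bool" where
  "is_disc D \<longleftrightarrow> D mod 4 = 0 \<or> D mod 4 = 1"

definition fundamental_disc :: "int \<Rightarrow> bool" where
  "fundamental_disc D \<longleftrightarrow> is_disc D \<and>
     \<not> (\<exists>D' f. is_disc D' \<and> f > (1::int) \<and> D = D' * f^2)"

definition kron_prime :: "int \<Rightarrow> nat \<Rightarrow> int" where
  "kron_prime D p = (if p = 2 then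
       (if even D then 0 else if D mod 8 = 1 \<or> D mod 8 = 7 then 1 else -1)
     else Legendre D (int p))"

definition kronecker :: "int \<Rightarrow> nat \<Rightarrow> int" where
  "kronecker D k = (if k = 0 then (if D = 1 \<or> D = -1 then 1 else 0)
     else (\<Prod>p\<in>prime_factors k. kron_prime D p ^ multiplicity p k))"

text \<open>For n > 0, n = 0,3 mod 4: -n = D_n f_n^2 with D_n fundamental.\<close>
definition cond_f :: "nat \<Rightarrow> nat" where
  "cond_f n = (THE f. f > 0 \<and> f^2 dvd n \<and> fundamental_disc (- int (n div f^2)))"

definition fund_D :: "nat \<Rightarrow> int" where
  "fund_D n = - int (n div (cond_f n)^2)"

text \<open>L(0,chi_D): the value at s = 0 of the (entire) analytic continuation of the
  Dirichlet series sum_{k>=1} chi_D(k) k^{-s}, Re s > 1 (D a negative fundamental discriminant,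
  so chi_D is non-principal and the continuation is entire).\<close>
definition L_at_0 :: "int \<Rightarrow> real" where
  "L_at_0 D = Re ((THE F. F holomorphic_on UNIV \<and>
      (\<forall>s. 1 < Re s \<longrightarrow>
         (\<lambda>k. of_int (kronecker D (Suc k)) / (of_nat (Suc k)) powr s) sums F s)) 0)"

definition Lm_at_0 :: "nat \<Rightarrow> int \<Rightarrow> real" where
  "Lm_at_0 m D = L_at_0 D * (\<Prod>p\<in>prime_factors m. 1 - of_int (kronecker D p))"

type_synonym bqf = "int \<times> int \<times> int"

definition bqf_disc :: "bqf \<Rightarrow> int" where
  "bqf_disc f = (case f of (a, b, c) \<Rightarrow> b^2 - 4*a*c)"

definition pos_def :: "bqf \<Rightarrow> bool" where
  "pos_def f = (case f of (a, b, c) \<Rightarrow> a > 0 \<and> b^2 - 4*a*c < 0)"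

text \<open>f(alpha x + beta y, gamma x + delta y).\<close>
definition bqf_act :: "int \<Rightarrow> int \<Rightarrow> int \<Rightarrow> int \<Rightarrow> bqf \<Rightarrow> bqf" where
  "bqf_act \<alpha> \<beta> \<gamma> \<delta> f = (case f of (a, b, c) \<Rightarrow>
     (a*\<alpha>^2 + b*\<alpha>*\<gamma> + c*\<gamma>^2,
      2*a*\<alpha>*\<beta> + b*(\<alpha>*\<delta> + \<beta>*\<gamma>) + 2*c*\<gamma>*\<delta>,
      a*\<beta>^2 + b*\<beta>*\<delta> + c*\<delta>^2))"

definition sl2_equiv :: "bqf \<Rightarrow> bqf \<Rightarrow> bool" where
  "sl2_equiv f g \<longleftrightarrow> (\<exists>\<alpha> \<beta> \<gamma> \<delta>. \<alpha>*\<delta> - \<beta>*\<gamma> = 1 \<and> g = bqf_act \<alpha> \<beta> \<gamma> \<delta> f)"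

definition forms_of :: "nat \<Rightarrow> bqf set" where
  "forms_of n = {f. pos_def f \<and> bqf_disc f = - int n}"

definition form_classes :: "nat \<Rightarrow> bqf set set" where
  "form_classes n = forms_of n // {(f, g). f \<in> forms_of n \<and> g \<in> forms_of n \<and> sl2_equiv f g}"

definition class_weight :: "bqf set \<Rightarrow> real" where
  "class_weight C = (if \<exists>k. (k, 0, k) \<in> C then 1/2
     else if \<exists>k. (k, k, k) \<in> C then 1/3 else 1)"

definition hurwitz :: "nat \<Rightarrow> real" where
  "hurwitz n = (if n = 0 then -1/12 else (\<Sum>C\<in>form_classes n. class_weight C))"

definition sigma_mN1 :: "nat \<Rightarrow> nat \<Rightarrow> nat \<Rightarrow> nat" where
  "sigma_mN1 m N r = (\<Sum>d | d dvd r \<and> coprime d m \<and> coprime (r div d) (N div m). d)"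

definition H_PW :: "nat \<Rightarrow> nat \<Rightarrow> nat \<Rightarrow> real" where
  "H_PW m N n =
    (if n = 0 then (if m = N then -1/12 * (\<Prod>p\<in>prime_factors N. 1 - real p) else 0)
     else if n mod 4 = 1 \<or> n mod 4 = 2 then 0
     else (let D = fund_D n; f = cond_f n in
       Lm_at_0 m D
       * (\<Prod>p\<in>prime_factors (N div m).
            (1 - of_int (kronecker D p) / real p) / (1 - 1 / (real p)^2))
       * (\<Sum>a | a dvd f \<and> coprime a N.
            of_int (moebius a) * of_int (kronecker D a) * real (sigma_mN1 m N (f div a)))))"

definition f_LSZ :: "nat \<Rightarrow> nat \<Rightarrow> nat \<Rightarrow> nat" where
  "f_LSZ N1 N2 D = (GREATEST f. f > 0 \<and> prime_factors f \<subseteq> prime_factors (N1 * N2)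
      \<and> f^2 dvd D \<and> is_disc (- int (D div f^2)))"

definition H_LSZ :: "nat \<Rightarrow> nat \<Rightarrow> nat \<Rightarrow> real" where
  "H_LSZ N1 N2 D =
    (if D = 0 then -1/12 * (\<Prod>p\<in>prime_factors N1. 1 - real p) * (\<Prod>p\<in>prime_factors N2. real p + 1)
     else if D mod 4 = 1 \<or> D mod 4 = 2 then 0
     else (let f = f_LSZ N1 N2 D; \<Delta> = - int (D div f^2) in
       hurwitz (D div f^2)
       * (\<Prod>p\<in>prime_factors N1. 1 - of_int (kronecker \<Delta> p))
       * (\<Prod>p\<in>prime_factors N2.
           (2 * real p * real (p ^ multiplicity p f) - real p - 1
            - of_int (kronecker \<Delta> p) * (2 * real (p ^ multiplicity p f) - real p - 1))
           / (real p - 1))))"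

end

theory Submission
  imports Defs "HOL-Real_Asymp.Real_Asymp"
begin

text \<open>Everything reduces to the class number formula
  H(|D| f^2) = L(0, chi_D) * sum over b | f of mu(b) chi_D(b) sigma_1(f/b) for fundamental D < 0; given that,
  the p-parts of the conductor for p | N separate and the claim becomes the identity
  (1 - chi)/(p - 1) + E_p/(p + 1) = 2 f_p (p - chi)/(p^2 - 1) for each p | N/m, where E_p is the factor at p
  in the product over N_2.

  The class number formula is proved directly at s = 0, without the functional equation or Gauss sums. Let
  R(k) be the number of representations of k by the forms of discriminant D f^2 modulo SL_2(Z), each form
  weighted by the inverse of the order of its stabilizer, and compare the constant terms of
  sum R(k) e^(-kt) as t tends to 0. On the side of the forms, every two-dimensional theta series is c/t + o(1), so
  leaving out the zero vector contributes -H/2. On the arithmetic side, primitive representations correspond to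
  square roots of the discriminant modulo 4k, and counting these shows that the Dirichlet series of R is
  zeta(s) L(s, chi_D) times a finite Dirichlet polynomial; the sum over k of (1 * chi_D)(k) e^(-kt) is
  C/t - L(0, chi_D)/2 + o(1), because L(0, chi_D) is the Abel sum of chi_D. Both asymptotics come from Euler-Maclaurin summation.\<close>

section \<open>Euler-Maclaurin summation\<close>

text \<open>The comparison takes place at s = 0 because rescaling t to a t changes c / t but not the
  constant term: a finite Dirichlet polynomial then enters only through its value at 0, and the
  coefficients of 1 / t never have to be evaluated. The obstacle is precision. Each theta series is
  a finite sum of products of two shifted Gaussian sums, each of size 1 / h with h of order sqrt t,
  so an error of order h in one of them would spoil the constant term; an error o(h), uniform in the
  shift, is required. Euler-Maclaurin summation with a bound on the third derivative gives O(h^2),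
  because the boundary terms cancel by parity. On the other side L(0, chi_D) is defined through an
  entire continuation, which has to be constructed: repeated Abel summation replaces k^(-s) by
  iterated differences, and at s = 0 all of these vanish, so that only the mean of the partial sums
  of chi_D over a period survives. The same mean is the value at q = 1 of the rational function sum
  chi_D(k) q^k, and this is where the two meanings of L(0, chi_D) meet.\<close>

lemma euler_maclaurin_step:
  fixes F g g1 g2 g3 :: "real \<Rightarrow> real"
  assumes h: "0 < h"
    and F: "\<And>x. a \<le> x \<Longrightarrow> (F has_real_derivative g x) (at x)"
    and g: "\<And>x. a \<le> x \<Longrightarrow> (g has_real_derivative g1 x) (at x)"
    and g1: "\<And>x. a \<le> x \<Longrightarrow> (g1 has_real_derivative g2 x) (at x)"
    and g2: "\<And>x. a \<le> x \<Longrightarrow> (g2 has_real_derivative g3 x) (at x)"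
    and bd: "\<And>x. a \<le> x \<Longrightarrow> \<bar>g3 x\<bar> \<le> K / (1 + x\<^sup>2)"
  shows "\<bar>F (a + h) - F a - h * (g a + g (a + h)) / 2 + h\<^sup>2 * (g1 (a + h) - g1 a) / 12\<bar>
           \<le> h ^ 3 * (K * arctan (a + h) - K * arctan a)"
proof -
  define s where "s = (\<lambda>x. (x - a) / h)"
  \<comment> \<open>p is B_3/6 for the third Bernoulli polynomial; with B below, B' = h^3 p g3 and B (a + h) - B a is
    minus the quadrature error.\<close>
  define p where "p = (\<lambda>x. s x ^ 3 / 6 - s x ^ 2 / 4 + s x / 12)"
  define p1 where "p1 = (\<lambda>x. s x ^ 2 / 2 - s x / 2 + 1 / 12)"
  define p2 where "p2 = (\<lambda>x. s x - 1 / 2)"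
  define B where "B = (\<lambda>x. h ^ 3 * p x * g2 x - h\<^sup>2 * p1 x * g1 x + h * p2 x * g x - F x)"
  have ds: "(s has_real_derivative 1 / h) (at x)" for x
    unfolding s_def using h by (auto intro!: derivative_eq_intros)
  have dp: "(p has_real_derivative p1 x / h) (at x)" for x
    unfolding p_def p1_def by (rule derivative_eq_intros ds refl | simp)+ (use h in \<open>simp add: field_simps power2_eq_square\<close>)
  have dp1: "(p1 has_real_derivative p2 x / h) (at x)" for x
    unfolding p1_def p2_def by (rule derivative_eq_intros ds refl | simp)+ (use h in \<open>simp add: field_simps power2_eq_square\<close>)
  have dp2: "(p2 has_real_derivative 1 / h) (at x)" for x
    unfolding p2_def by (rule derivative_eq_intros ds refl | simp)+
  have dB: "(B has_real_derivative h ^ 3 * p x * g3 x) (at x)" if "a \<le> x" for x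
    unfolding B_def
    by (rule derivative_eq_intros dp dp1 dp2 F g g1 g2 that refl | simp)+
       (use h in \<open>simp add: field_simps power2_eq_square power3_eq_cube\<close>)
  have pb: "\<bar>p x\<bar> \<le> 1" if "a \<le> x" "x \<le> a + h" for x
  proof -
    have s: "0 \<le> s x" "s x \<le> 1" using that h by (auto simp: s_def field_simps)
    have "s x ^ 3 \<le> 1" "s x ^ 2 \<le> 1" "0 \<le> s x ^ 3" "0 \<le> s x ^ 2"
      using s by (auto intro: power_le_one)
    thus ?thesis using s unfolding p_def by linarith
  qed
  have dB': "\<bar>h ^ 3 * p x * g3 x\<bar> \<le> h ^ 3 * (K / (1 + x\<^sup>2))" if "a \<le> x" "x \<le> a + h" for x
  proof -
    have "\<bar>h ^ 3 * p x * g3 x\<bar> = h ^ 3 * (\<bar>p x\<bar> * \<bar>g3 x\<bar>)" using h by (simp add: abs_mult)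
    also have "\<dots> \<le> h ^ 3 * (1 * (K / (1 + x\<^sup>2)))"
      using pb[OF that] bd[OF that(1)] h by (intro mult_left_mono mult_mono) auto
    finally show ?thesis by simp
  qed
  have dV: "((\<lambda>x. h ^ 3 * (K * arctan x)) has_real_derivative h ^ 3 * (K / (1 + x\<^sup>2))) (at x)" for x
    by (rule derivative_eq_intros refl | simp)+ (simp add: divide_inverse)
  \<comment> \<open>Integration is avoided: |B'| is at most the derivative of h^3 K arctan, so h^3 K
    arctan - B and h^3 K arctan + B are both nondecreasing, which bounds the increment of B from
    both sides.\<close>
  have m1: "h ^ 3 * (K * arctan a) - B a \<le> h ^ 3 * (K * arctan (a + h)) - B (a + h)"
  proof (rule DERIV_nonneg_imp_nondecreasing[of a "a + h" "\<lambda>x. h ^ 3 * (K * arctan x) - B x"])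
    fix x assume x: "a \<le> x" "x \<le> a + h"
    have "((\<lambda>x. h ^ 3 * (K * arctan x) - B x) has_real_derivative
        (h ^ 3 * (K / (1 + x\<^sup>2)) - h ^ 3 * p x * g3 x)) (at x)"
      by (intro DERIV_diff dV dB x)
    thus "\<exists>y. ((\<lambda>x. h ^ 3 * (K * arctan x) - B x) has_real_derivative y) (at x) \<and> 0 \<le> y"
      using dB'[OF x] by (intro exI[of _ "h ^ 3 * (K / (1 + x\<^sup>2)) - h ^ 3 * p x * g3 x"]) auto
  qed (use h in auto)
  have m2: "h ^ 3 * (K * arctan a) + B a \<le> h ^ 3 * (K * arctan (a + h)) + B (a + h)"
  proof (rule DERIV_nonneg_imp_nondecreasing[of a "a + h" "\<lambda>x. h ^ 3 * (K * arctan x) + B x"])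
    fix x assume x: "a \<le> x" "x \<le> a + h"
    have "((\<lambda>x. h ^ 3 * (K * arctan x) + B x) has_real_derivative
        (h ^ 3 * (K / (1 + x\<^sup>2)) + h ^ 3 * p x * g3 x)) (at x)"
      by (intro DERIV_add dV dB x)
    thus "\<exists>y. ((\<lambda>x. h ^ 3 * (K * arctan x) + B x) has_real_derivative y) (at x) \<and> 0 \<le> y"
      using dB'[OF x] by (intro exI[of _ "h ^ 3 * (K / (1 + x\<^sup>2)) + h ^ 3 * p x * g3 x"]) auto
  qed (use h in auto)
  have s: "s a = 0" "s (a + h) = 1" using h by (auto simp: s_def)
  have "B (a + h) - B a = - (F (a + h) - F a - h * (g a + g (a + h)) / 2
      + h\<^sup>2 * (g1 (a + h) - g1 a) / 12)"
    unfolding B_def p_def p1_def p2_def s by (simp add: field_simps)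
  thus ?thesis using m1 m2 by (simp add: algebra_simps abs_le_iff)
qed

text \<open>The corrections telescope, and so does the arctan bound. This is why the third
  derivative is measured against K / (1 + x^2): the total error stays below K pi h^3 however many
  steps are taken.\<close>

lemma euler_maclaurin_sum:
  fixes F g g1 g2 g3 :: "real \<Rightarrow> real"
  assumes h: "0 < h"
    and F: "\<And>x. a \<le> x \<Longrightarrow> (F has_real_derivative g x) (at x)"
    and g: "\<And>x. a \<le> x \<Longrightarrow> (g has_real_derivative g1 x) (at x)"
    and g1: "\<And>x. a \<le> x \<Longrightarrow> (g1 has_real_derivative g2 x) (at x)"
    and g2: "\<And>x. a \<le> x \<Longrightarrow> (g2 has_real_derivative g3 x) (at x)"
    and bd: "\<And>x. a \<le> x \<Longrightarrow> \<bar>g3 x\<bar> \<le> K / (1 + x\<^sup>2)"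
  shows "\<bar>h * (\<Sum>j<J. g (a + real j * h)) - (F (a + real J * h) - F a)
            + h * (g (a + real J * h) - g a) / 2 - h\<^sup>2 * (g1 (a + real J * h) - g1 a) / 12\<bar>
           \<le> h ^ 3 * (K * arctan (a + real J * h) - K * arctan a)"
proof (induction J)
  case (Suc J)
  define b where "b = a + real J * h"
  have b: "a \<le> b" using h by (simp add: b_def)
  have b': "a + real (Suc J) * h = b + h" by (simp add: b_def algebra_simps)
  have "\<bar>F (b + h) - F b - h * (g b + g (b + h)) / 2 + h\<^sup>2 * (g1 (b + h) - g1 b) / 12\<bar>
           \<le> h ^ 3 * (K * arctan (b + h) - K * arctan b)"
    by (rule euler_maclaurin_step[where ?g2.0 = g2 and ?g3.0 = g3])
       (use h F g g1 g2 bd b in \<open>auto intro: order_trans\<close>)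
  moreover have "h * ((\<Sum>j<J. g (a + real j * h)) + g b) - (F (b + h) - F a)
            + h * (g (b + h) - g a) / 2 - h\<^sup>2 * (g1 (b + h) - g1 a) / 12
     = (h * (\<Sum>j<J. g (a + real j * h)) - (F b - F a)
            + h * (g b - g a) / 2 - h\<^sup>2 * (g1 b - g1 a) / 12)
       - (F (b + h) - F b - h * (g b + g (b + h)) / 2 + h\<^sup>2 * (g1 (b + h) - g1 b) / 12)"
    by (simp add: field_simps)
  moreover have "h ^ 3 * (K * arctan (b + h) - K * arctan a)
     = h ^ 3 * (K * arctan b - K * arctan a) + h ^ 3 * (K * arctan (b + h) - K * arctan b)"
    by (simp add: algebra_simps)
  moreover note Suc.IH[folded b_def]
  ultimately show ?case unfolding b' sum.lessThan_Suc b_def[symmetric] by linarith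
qed simp

text \<open>The bounds on g and g1 kill the boundary terms at infinity; those at a remain, and the
  term h g(a) / 2 is the source of the constant term in the half-line expansion below.\<close>

lemma euler_maclaurin_suminf:
  fixes F g g1 g2 g3 :: "real \<Rightarrow> real"
  assumes h: "0 < h"
    and F: "\<And>x. a \<le> x \<Longrightarrow> (F has_real_derivative g x) (at x)"
    and g: "\<And>x. a \<le> x \<Longrightarrow> (g has_real_derivative g1 x) (at x)"
    and g1: "\<And>x. a \<le> x \<Longrightarrow> (g1 has_real_derivative g2 x) (at x)"
    and g2: "\<And>x. a \<le> x \<Longrightarrow> (g2 has_real_derivative g3 x) (at x)"
    and bd: "\<And>x. a \<le> x \<Longrightarrow> \<bar>g3 x\<bar> \<le> K / (1 + x\<^sup>2)"
    and bd0: "\<And>x. a \<le> x \<Longrightarrow> \<bar>g x\<bar> \<le> K / (1 + x\<^sup>2)"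
    and bd1: "\<And>x. a \<le> x \<Longrightarrow> \<bar>g1 x\<bar> \<le> K / (1 + x\<^sup>2)"
    and L: "(F \<longlongrightarrow> L) at_top"
    and S: "(\<lambda>j. g (a + real j * h)) sums S"
  shows "\<bar>h * S - (L - F a) - h * g a / 2 + h\<^sup>2 * g1 a / 12\<bar> \<le> h ^ 3 * (K * pi)"
proof -
  have lim: "filterlim (\<lambda>J. a + real J * h) at_top sequentially"
    using h by real_asymp
  have "K / (1 + a\<^sup>2) \<ge> 0" using bd[of a] by linarith
  moreover have "1 + a\<^sup>2 > 0" by (simp add: add_pos_nonneg)
  ultimately have K: "K \<ge> 0" by (simp add: zero_le_divide_iff)
  have z: "((\<lambda>x. K / (1 + x\<^sup>2)) \<longlongrightarrow> 0) at_top" by real_asymp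
  have ev: "eventually (\<lambda>x. a \<le> x) at_top" by (rule eventually_ge_at_top)
  have g0: "(g \<longlongrightarrow> 0) at_top"
    by (rule Lim_null_comparison[OF _ z], rule eventually_mono[OF ev]) (use bd0 in auto)
  have g10: "(g1 \<longlongrightarrow> 0) at_top"
    by (rule Lim_null_comparison[OF _ z], rule eventually_mono[OF ev]) (use bd1 in auto)
  have "(\<lambda>J. \<bar>h * (\<Sum>j<J. g (a + real j * h)) - (F (a + real J * h) - F a)
            + h * (g (a + real J * h) - g a) / 2 - h\<^sup>2 * (g1 (a + real J * h) - g1 a) / 12\<bar>)
     \<longlonglongrightarrow> \<bar>h * S - (L - F a) + h * (0 - g a) / 2 - h\<^sup>2 * (0 - g1 a) / 12\<bar>"
    by (intro tendsto_intros S[unfolded sums_def] filterlim_compose[OF L lim]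
        filterlim_compose[OF g0 lim] filterlim_compose[OF g10 lim]) auto
  moreover have "\<forall>J. \<bar>h * (\<Sum>j<J. g (a + real j * h)) - (F (a + real J * h) - F a)
            + h * (g (a + real J * h) - g a) / 2 - h\<^sup>2 * (g1 (a + real J * h) - g1 a) / 12\<bar>
      \<le> h ^ 3 * (K * pi)"
  proof
    fix J
    have "arctan (a + real J * h) - arctan a \<le> pi"
      using arctan_bounded[of "a + real J * h"] arctan_bounded[of a] by linarith
    hence "h ^ 3 * (K * arctan (a + real J * h) - K * arctan a) \<le> h ^ 3 * (K * pi)"
      using h K by (simp flip: right_diff_distrib add: mult_left_mono)
    thus "\<bar>h * (\<Sum>j<J. g (a + real j * h)) - (F (a + real J * h) - F a)
            + h * (g (a + real J * h) - g a) / 2 - h\<^sup>2 * (g1 (a + real J * h) - g1 a) / 12\<bar>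
      \<le> h ^ 3 * (K * pi)"
      by (intro order_trans[OF euler_maclaurin_sum[OF h F g g1 g2 bd, where J = J and a = a]])
  qed
  ultimately have "\<bar>h * S - (L - F a) + h * (0 - g a) / 2 - h\<^sup>2 * (0 - g1 a) / 12\<bar> \<le> h ^ 3 * (K * pi)"
    by (intro LIMSEQ_le_const2) auto
  thus ?thesis by simp
qed

text \<open>F + K arctan is nondecreasing and bounded, hence convergent; this stands in for an
  improper integral. The normalization F 0 = 0 makes L the integral of g over the half-line.\<close>

lemma convergent_antiderivative:
  fixes g :: "real \<Rightarrow> real"
  assumes cont: "\<And>x. isCont g x" and bd: "\<And>x. 0 \<le> x \<Longrightarrow> \<bar>g x\<bar> \<le> K / (1 + x\<^sup>2)"
  obtains F L where "\<And>x. (F has_real_derivative g x) (at x)" "(F \<longlongrightarrow> L) at_top" "F 0 = 0"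
proof -
  have "\<exists>F. \<forall>x. (-\<infinity>::ereal) < ereal x \<longrightarrow> ereal x < \<infinity> \<longrightarrow> (F has_vector_derivative g x) (at x)"
    by (rule einterval_antiderivative) (use cont in auto)
  then obtain F0 where F0: "\<And>x. (F0 has_real_derivative g x) (at x)"
    by (auto simp: has_real_derivative_iff_has_vector_derivative)
  define F where "F = (\<lambda>x. F0 x - F0 0)"
  have F: "(F has_real_derivative g x) (at x)" for x
    unfolding F_def using F0[of x] by (auto intro!: derivative_eq_intros)
  define G where "G = (\<lambda>x. F x + K * arctan x)"
  have dV: "((\<lambda>x. K * arctan x) has_real_derivative (K / (1 + x\<^sup>2))) (at x)" for x
    by (rule derivative_eq_intros refl | simp)+ (simp add: divide_inverse)
  have mono: "G x \<le> G y" if "0 \<le> x" "x \<le> y" for x y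
  proof (rule DERIV_nonneg_imp_nondecreasing[OF that(2)])
    fix z assume z: "x \<le> z" "z \<le> y"
    have "(G has_real_derivative (g z + K / (1 + z\<^sup>2))) (at z)"
      unfolding G_def by (intro DERIV_add F dV)
    thus "\<exists>u. (G has_real_derivative u) (at z) \<and> 0 \<le> u"
      using bd[of z] z that by (intro exI[of _ "g z + K / (1 + z\<^sup>2)"]) auto
  qed
  have mono2: "K * arctan x - F x \<le> K * arctan y - F y" if "0 \<le> x" "x \<le> y" for x y
  proof (rule DERIV_nonneg_imp_nondecreasing[OF that(2), of "\<lambda>x. K * arctan x - F x"])
    fix z assume z: "x \<le> z" "z \<le> y"
    have "((\<lambda>x. K * arctan x - F x) has_real_derivative (K / (1 + z\<^sup>2) - g z)) (at z)"
      by (intro DERIV_diff F dV)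
    thus "\<exists>u. ((\<lambda>x. K * arctan x - F x) has_real_derivative u) (at z) \<and> 0 \<le> u"
      using bd[of z] z that by (intro exI[of _ "K / (1 + z\<^sup>2) - g z"]) auto
  qed
  have K: "K \<ge> 0" using bd[of 0] by simp
  have ub: "G x \<le> K * pi" if "0 \<le> x" for x
  proof -
    have "F x \<le> K * arctan x" using mono2[of 0 x] that by (simp add: F_def)
    hence "G x \<le> K * (2 * arctan x)" by (simp add: G_def)
    also have "\<dots> \<le> K * pi" using K arctan_bounded[of x] by (intro mult_left_mono) auto
    finally show ?thesis .
  qed
  define L where "L = (SUP x\<in>{0..}. G x)"
  have bdd: "bdd_above (G ` {0..})" using ub by (intro bdd_aboveI[of _ "K * pi"]) auto
  have "(G \<longlongrightarrow> L) at_top"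
  proof (rule order_tendstoI)
    fix l assume "l < L"
    then obtain x where x: "x \<ge> 0" "l < G x"
      unfolding L_def using less_cSUP_iff[OF _ bdd, of l] by auto
    show "eventually (\<lambda>x. l < G x) at_top"
      using eventually_ge_at_top[of x]
      by eventually_elim (use mono[of x] x in \<open>auto intro: less_le_trans\<close>)
  next
    fix u assume u: "L < u"
    show "eventually (\<lambda>x. G x < u) at_top"
      using eventually_ge_at_top[of 0]
      by eventually_elim (use cSUP_upper[OF _ bdd] u in \<open>auto simp: L_def intro: le_less_trans\<close>)
  qed
  moreover have "((\<lambda>x. K * arctan x) \<longlongrightarrow> K * (pi / 2)) at_top"
    by (intro tendsto_intros tendsto_arctan_at_top)
  ultimately have "((\<lambda>x. G x - K * arctan x) \<longlongrightarrow> L - K * (pi / 2)) at_top"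
    by (rule tendsto_diff)
  hence "(F \<longlongrightarrow> L - K * (pi / 2)) at_top" by (simp add: G_def)
  thus ?thesis using that[OF F, of "L - K * (pi / 2)"] by (simp add: F_def)
qed

text \<open>Only the constant term is used later, so C, the integral of g over the half-line, is
  left unspecified.\<close>

lemma riemann_sum_half_line_asymp:
  fixes g g1 g2 g3 :: "real \<Rightarrow> real"
  assumes g: "\<And>x. (g has_real_derivative g1 x) (at x)"
    and g1: "\<And>x. (g1 has_real_derivative g2 x) (at x)"
    and g2: "\<And>x. (g2 has_real_derivative g3 x) (at x)"
    and bd0: "\<And>x. 0 \<le> x \<Longrightarrow> \<bar>g x\<bar> \<le> K / (1 + x\<^sup>2)"
    and bd1: "\<And>x. 0 \<le> x \<Longrightarrow> \<bar>g1 x\<bar> \<le> K / (1 + x\<^sup>2)"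
    and bd: "\<And>x. 0 \<le> x \<Longrightarrow> \<bar>g3 x\<bar> \<le> K / (1 + x\<^sup>2)"
    and S: "\<And>h. 0 < h \<Longrightarrow> (\<lambda>j. g (real (Suc j) * h)) sums S h"
  obtains C where "((\<lambda>h. S h - C / h) \<longlongrightarrow> - g 0 / 2) (at_right 0)"
proof -
  obtain F L where F: "\<And>x. (F has_real_derivative g x) (at x)" and L: "(F \<longlongrightarrow> L) at_top" and F0: "F 0 = 0"
    using convergent_antiderivative[OF DERIV_isCont[OF g] bd0] by blast
  have main: "\<bar>S h - L / h - (- g 0 / 2)\<bar> \<le> h * (\<bar>g1 0\<bar> / 12) + h\<^sup>2 * (K * pi)" if h: "0 < h" for h
  proof -
    \<comment> \<open>The sum starts at j = 1 while Euler-Maclaurin starts at j = 0: adding the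
      missing g 0 and removing half of it through the boundary term leaves - g 0 / 2.\<close>
    have S': "(\<lambda>j. g (0 + real j * h)) sums (S h + g 0)"
      using sums_Suc[of "\<lambda>j. g (0 + real j * h)" "S h"] S[OF h] by simp
    have "\<bar>h * (S h + g 0) - (L - F 0) - h * g 0 / 2 + h\<^sup>2 * g1 0 / 12\<bar> \<le> h ^ 3 * (K * pi)"
      by (rule euler_maclaurin_suminf[OF h F g g1 g2 bd bd0 bd1 L S'])
    also have "h * (S h + g 0) - (L - F 0) - h * g 0 / 2 + h\<^sup>2 * g1 0 / 12
       = h * (S h - L / h - (- g 0 / 2) + h * g1 0 / 12)"
      using h F0 by (simp add: field_simps power2_eq_square)
    also have "\<bar>\<dots>\<bar> = h * \<bar>S h - L / h - (- g 0 / 2) + h * g1 0 / 12\<bar>"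
      using h by (simp add: abs_mult)
    finally have "h * \<bar>S h - L / h - (- g 0 / 2) + h * g1 0 / 12\<bar> \<le> h * (h\<^sup>2 * (K * pi))"
      by (simp add: power2_eq_square power3_eq_cube mult_ac)
    hence "\<bar>S h - L / h - (- g 0 / 2) + h * g1 0 / 12\<bar> \<le> h\<^sup>2 * (K * pi)"
      using h by (simp add: mult_le_cancel_left)
    moreover have "\<bar>h * g1 0 / 12\<bar> = h * (\<bar>g1 0\<bar> / 12)" using h by (simp add: abs_mult)
    ultimately show ?thesis by linarith
  qed
  have z: "((\<lambda>h. h * (\<bar>g1 0\<bar> / 12) + h\<^sup>2 * (K * pi)) \<longlongrightarrow> 0) (at_right 0)"
    by real_asymp
  have "((\<lambda>h. S h - L / h - (- g 0 / 2)) \<longlongrightarrow> 0) (at_right 0)"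
    by (rule Lim_null_comparison[OF _ z], rule eventually_mono[OF eventually_at_right_less])
       (use main in auto)
  hence "((\<lambda>h. S h - L / h) \<longlongrightarrow> - g 0 / 2) (at_right 0)" by (simp only: Lim_null[symmetric])
  thus ?thesis by (rule that)
qed

section \<open>Shifted Gaussian sums\<close>

lemma exp_square_poly_bound:
  fixes x :: real
  shows "(1 + x\<^sup>2) ^ 3 * exp (- x\<^sup>2) \<le> 81"
proof -
  \<comment> \<open>Cubing 1 + y <= exp y at y = (1 + x^2) / 3 produces 27 e exp (x^2); the constant
    81 is 27 times the bound 3 for e.\<close>
  have "1 + (1 + x\<^sup>2) / 3 \<le> exp ((1 + x\<^sup>2) / 3)" by (rule exp_ge_add_one_self)
  hence "(1 + x\<^sup>2) / 3 \<le> exp ((1 + x\<^sup>2) / 3)" by linarith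
  hence "((1 + x\<^sup>2) / 3) ^ 3 \<le> exp ((1 + x\<^sup>2) / 3) ^ 3" by (intro power_mono) auto
  also have "\<dots> = exp 1 * exp (x\<^sup>2)" by (simp flip: exp_of_nat_mult exp_add)
  also have "\<dots> \<le> 3 * exp (x\<^sup>2)" using exp_le by (intro mult_right_mono) auto
  finally have "(1 + x\<^sup>2) ^ 3 \<le> 81 * exp (x\<^sup>2)" by (simp add: power_divide)
  thus ?thesis by (simp add: exp_minus field_simps)
qed

text \<open>The coefficient 20 = 8 + 12 is dictated by the third derivative (- 8 x^3 + 12 x) exp (-
  x^2), the largest case; 1620 is 20 * 81.\<close>

lemma gaussian_poly_bound:
  fixes x c :: real
  assumes "\<bar>c\<bar> \<le> 20 * (1 + x\<^sup>2) ^ 2"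
  shows "\<bar>c * exp (- x\<^sup>2)\<bar> \<le> 1620 / (1 + x\<^sup>2)"
proof -
  have p: "1 + x\<^sup>2 > 0" by (simp add: add_pos_nonneg)
  have "\<bar>c * exp (- x\<^sup>2)\<bar> * (1 + x\<^sup>2) = \<bar>c\<bar> * (exp (- x\<^sup>2) * (1 + x\<^sup>2))" by (simp add: abs_mult)
  also have "\<dots> \<le> (20 * (1 + x\<^sup>2) ^ 2) * (exp (- x\<^sup>2) * (1 + x\<^sup>2))"
    using assms p by (intro mult_right_mono) auto
  also have "\<dots> = 20 * ((1 + x\<^sup>2) ^ 3 * exp (- x\<^sup>2))" by (simp add: power2_eq_square power3_eq_cube)
  also have "\<dots> \<le> 1620" using exp_square_poly_bound[of x] by linarith
  finally show ?thesis using p by (simp add: pos_le_divide_eq)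
qed

definition gauss_sum :: "real \<Rightarrow> real \<Rightarrow> real" where
  "gauss_sum h \<alpha> = (\<Sum>\<^sub>\<infinity>j. exp (- (h * (of_int j + \<alpha>))\<^sup>2))"

lemma gaussian_half_summable:
  fixes h :: real
  assumes h: "0 < h"
  shows "summable (\<lambda>j. exp (- (a + real j * h)\<^sup>2))"
proof -
  have "summable (\<lambda>j. 1 / (1 + (a + real j * h)\<^sup>2))"
  proof (rule summable_comparison_test_bigo)
    show "summable (\<lambda>n. norm (1 / real n powr 2))"
      using summable_real_powr_iff[of "-2"] by (simp add: powr_minus divide_inverse)
    show "(\<lambda>j. 1 / (1 + (a + real j * h)\<^sup>2)) \<in> O(\<lambda>n. 1 / real n powr 2)"
      using h by real_asymp
  qed
  moreover have le: "norm (exp (- y\<^sup>2)) \<le> 1 / (1 + y\<^sup>2)" for y :: real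
  proof -
    have "1 + y\<^sup>2 > 0" by (simp add: add_pos_nonneg)
    thus ?thesis using exp_ge_add_one_self[of "y\<^sup>2"]
      by (simp add: exp_minus inverse_eq_divide frac_le)
  qed
  ultimately show ?thesis
    by (rule summable_comparison_test'[where N = 0 and g = "\<lambda>j. 1 / (1 + (a + real j * h)\<^sup>2)"])
qed

lemma gaussian_nat_sums_to_int:
  fixes h \<alpha> :: real
  assumes A: "(\<lambda>j. exp (- (h * \<alpha> + real j * h)\<^sup>2)) sums A"
    and B: "(\<lambda>j. exp (- (- (h * \<alpha>) + real j * h)\<^sup>2)) sums B"
  shows "((\<lambda>j::int. exp (- (h * (of_int j + \<alpha>))\<^sup>2)) has_sum (A + B - exp (- (h * \<alpha>)\<^sup>2))) UNIV"
proof -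
  let ?f = "\<lambda>j::int. exp (- (h * (of_int j + \<alpha>))\<^sup>2)"
  have "(\<lambda>j. exp (- (h * \<alpha> + real j * h)\<^sup>2)) = ?f \<circ> int"
    by (auto simp: fun_eq_iff algebra_simps)
  with A have "(?f \<circ> int) sums A" by simp
  hence "((?f \<circ> int) has_sum A) UNIV"
    by (intro norm_summable_imp_has_sum) (auto simp: sums_iff o_def)
  hence 1: "(?f has_sum A) (range int)"
    by (subst (asm) has_sum_reindex[symmetric]) (auto simp: inj_def)
  \<comment> \<open>Both half-sums contain the term j = 0, so it is removed from the second
    one.\<close>
  define B' where "B' = B - exp (- (h * \<alpha>)\<^sup>2)"
  have "(\<lambda>j. exp (- (- (h * \<alpha>) + real (Suc j) * h)\<^sup>2)) sums B'"
    using B by (subst sums_Suc_iff) (simp add: B'_def)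
  moreover have "(\<lambda>j. exp (- (- (h * \<alpha>) + real (Suc j) * h)\<^sup>2)) = ?f \<circ> (\<lambda>j. - int (Suc j))"
  proof
    fix j
    have "(- (h * \<alpha>) + real (Suc j) * h)\<^sup>2 = (h * (of_int (- int (Suc j)) + \<alpha>))\<^sup>2"
      by (simp add: power2_eq_square algebra_simps)
    thus "exp (- (- (h * \<alpha>) + real (Suc j) * h)\<^sup>2) = (?f \<circ> (\<lambda>j. - int (Suc j))) j" by simp
  qed
  ultimately have "(?f \<circ> (\<lambda>j. - int (Suc j))) sums B'" by simp
  hence "((?f \<circ> (\<lambda>j. - int (Suc j))) has_sum B') UNIV"
    by (intro norm_summable_imp_has_sum) (auto simp: sums_iff o_def)
  hence 2: "(?f has_sum B') (range (\<lambda>j. - int (Suc j)))"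
    by (subst (asm) has_sum_reindex[symmetric]) (auto simp: inj_def)
  have "(?f has_sum (A + B')) (range int \<union> range (\<lambda>j. - int (Suc j)))"
    by (rule has_sum_Un_disjoint[OF 1 2]) auto
  moreover have "range int \<union> range (\<lambda>j. - int (Suc j)) = UNIV"
  proof -
    have "x \<in> range int \<union> range (\<lambda>j. - int (Suc j))" for x
      by (cases x rule: int_cases) blast+
    thus ?thesis by auto
  qed
  ultimately show ?thesis by (simp add: B'_def add_diff_eq)
qed

lemma gauss_sum_has_sum:
  assumes "0 < h"
  shows "((\<lambda>j::int. exp (- (h * (of_int j + \<alpha>))\<^sup>2)) has_sum gauss_sum h \<alpha>) UNIV"
proof -
  note gaussian_nat_sums_to_int[OF summable_sums[OF gaussian_half_summable[OF assms]]
      summable_sums[OF gaussian_half_summable[OF assms]], of \<alpha>]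
  thus ?thesis
    unfolding gauss_sum_def by (simp add: has_sum_iff)
qed

text \<open>Euler-Maclaurin is applied to the two half-lines starting at h alpha and - h alpha. The
  antiderivative and the first derivative are odd, so their boundary terms cancel, and the two
  half-values of g are absorbed by the overlap j = 0. What remains is O(h^3) for h times the sum,
  with constants independent of alpha. Both the uniformity and an error below order h are needed in
  \<open>form_theta_asymp\<close>.\<close>

lemma gauss_sum_bound:
  obtains c M where "\<And>h \<alpha>. 0 < h \<Longrightarrow> \<bar>gauss_sum h \<alpha> - c / h\<bar> \<le> M * h\<^sup>2"
proof -
  define g where "g = (\<lambda>x::real. exp (- x\<^sup>2))"
  define g1 where "g1 = (\<lambda>x::real. (- 2 * x) * exp (- x\<^sup>2))"
  define g2 where "g2 = (\<lambda>x::real. (4 * x\<^sup>2 - 2) * exp (- x\<^sup>2))"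
  define g3 where "g3 = (\<lambda>x::real. (- 8 * x ^ 3 + 12 * x) * exp (- x\<^sup>2))"
  have d: "(g has_real_derivative g1 x) (at x)" for x
    unfolding g_def g1_def by (auto intro!: derivative_eq_intros)
  have d1: "(g1 has_real_derivative g2 x) (at x)" for x
    unfolding g1_def g2_def by (auto intro!: derivative_eq_intros simp: power2_eq_square algebra_simps)
  have d2: "(g2 has_real_derivative g3 x) (at x)" for x
    unfolding g2_def g3_def
    by (auto intro!: derivative_eq_intros simp: power2_eq_square power3_eq_cube algebra_simps)
  have xb: "\<bar>x\<bar> \<le> 1 + x\<^sup>2" for x :: real
  proof -
    have "0 \<le> (\<bar>x\<bar> - 1)\<^sup>2" by simp
    thus ?thesis by (simp add: power2_eq_square algebra_simps abs_if split: if_splits)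
  qed
  have p1: "1 + x\<^sup>2 \<le> (1 + x\<^sup>2) ^ 2" for x :: real
    by (rule self_le_power) auto
  have b0: "\<bar>g x\<bar> \<le> 1620 / (1 + x\<^sup>2)" for x
  proof -
    have "1 \<le> (1 + x\<^sup>2) ^ 2" by (rule one_le_power) simp
    hence "\<bar>1\<bar> \<le> 20 * (1 + x\<^sup>2) ^ 2" by linarith
    from gaussian_poly_bound[OF this] show ?thesis by (simp add: g_def)
  qed
  have b1: "\<bar>g1 x\<bar> \<le> 1620 / (1 + x\<^sup>2)" for x
    unfolding g1_def using xb[of x] p1[of x] by (intro gaussian_poly_bound) (simp add: abs_mult)
  have b3: "\<bar>g3 x\<bar> \<le> 1620 / (1 + x\<^sup>2)" for x
    unfolding g3_def
  proof (intro gaussian_poly_bound)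
    have "\<bar>x ^ 3\<bar> = \<bar>x\<bar> * x\<^sup>2" by (simp add: power_abs power2_eq_square power3_eq_cube abs_mult)
    also have "\<dots> \<le> (1 + x\<^sup>2) * (1 + x\<^sup>2)" using xb[of x] by (intro mult_mono) auto
    finally have "\<bar>x ^ 3\<bar> \<le> (1 + x\<^sup>2) ^ 2" by (simp add: power2_eq_square)
    moreover have "\<bar>- 8 * x ^ 3 + 12 * x\<bar> \<le> 8 * \<bar>x ^ 3\<bar> + 12 * \<bar>x\<bar>" by linarith
    ultimately show "\<bar>- 8 * x ^ 3 + 12 * x\<bar> \<le> 20 * (1 + x\<^sup>2) ^ 2"
      using xb[of x] p1[of x] by linarith
  qed
  obtain F L where F: "\<And>x. (F has_real_derivative g x) (at x)" and L: "(F \<longlongrightarrow> L) at_top" and F0: "F 0 = 0"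
    using convergent_antiderivative[OF DERIV_isCont[OF d] b0] by blast
  have odd: "F (- x) = - F x" for x
  proof -
    have "((\<lambda>x. F x + F (- x)) has_real_derivative (g y + - g (- y))) (at y)" for y
      by (intro DERIV_add F F[of "- y", unfolded DERIV_mirror])
    hence "\<forall>y. ((\<lambda>x. F x + F (- x)) has_real_derivative 0) (at y)" by (simp add: g_def)
    from DERIV_isconst_all[OF this, of x 0] show ?thesis using F0 by simp
  qed
  have "\<bar>gauss_sum h \<alpha> - (2 * L) / h\<bar> \<le> (2 * (1620 * pi)) * h\<^sup>2" if h: "0 < h" for h \<alpha>
  proof -
    define A where "A = (\<Sum>j. g (h * \<alpha> + real j * h))"
    define B where "B = (\<Sum>j. g (- (h * \<alpha>) + real j * h))"
    have A: "(\<lambda>j. g (h * \<alpha> + real j * h)) sums A"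
      unfolding A_def g_def using gaussian_half_summable[OF h] by (auto simp: summable_sums)
    have B: "(\<lambda>j. g (- (h * \<alpha>) + real j * h)) sums B"
      unfolding B_def g_def by (rule summable_sums[OF gaussian_half_summable[OF h]])
    have eq: "gauss_sum h \<alpha> = A + B - g (h * \<alpha>)"
      using has_sum_unique[OF gauss_sum_has_sum[OF h]
          gaussian_nat_sums_to_int[OF A[unfolded g_def] B[unfolded g_def]]] by (simp add: g_def)
    have EA: "\<bar>h * A - (L - F (h * \<alpha>)) - h * g (h * \<alpha>) / 2 + h\<^sup>2 * g1 (h * \<alpha>) / 12\<bar> \<le> h ^ 3 * (1620 * pi)"
      by (rule euler_maclaurin_suminf[OF h F d d1 d2 b3 b0 b1 L A])
    have EB: "\<bar>h * B - (L - F (- (h * \<alpha>))) - h * g (- (h * \<alpha>)) / 2 + h\<^sup>2 * g1 (- (h * \<alpha>)) / 12\<bar>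
        \<le> h ^ 3 * (1620 * pi)"
      by (rule euler_maclaurin_suminf[OF h F d d1 d2 b3 b0 b1 L B])
    have sym: "g (- (h * \<alpha>)) = g (h * \<alpha>)" "g1 (- (h * \<alpha>)) = - g1 (h * \<alpha>)"
      by (auto simp: g_def g1_def)
    have "\<bar>h * gauss_sum h \<alpha> - 2 * L\<bar> \<le> 2 * (h ^ 3 * (1620 * pi))"
      using EA EB unfolding sym odd eq right_diff_distrib distrib_left by (simp add: abs_le_iff)
    also have "h * gauss_sum h \<alpha> - 2 * L = h * (gauss_sum h \<alpha> - 2 * L / h)"
      using h by (simp add: field_simps)
    finally have "h * \<bar>gauss_sum h \<alpha> - 2 * L / h\<bar> \<le> h * ((2 * (1620 * pi)) * h\<^sup>2)"
      using h by (simp add: abs_mult power2_eq_square power3_eq_cube mult_ac)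
    thus ?thesis using h by (simp add: mult_le_cancel_left)
  qed
  thus ?thesis by (rule that)
qed

section \<open>Entire continuation of periodic Dirichlet series\<close>

text \<open>Up to sign the M-th forward difference of z^(-s) with step 1. Each difference gains one
  power of decay, so the terms become summable further to the left.\<close>

primrec powr_diff :: "nat \<Rightarrow> complex \<Rightarrow> complex \<Rightarrow> complex" where
  "powr_diff 0 s z = z powr (- s)"
| "powr_diff (Suc M) s z = powr_diff M s z - powr_diff M s (z + 1)"

lemma powr_diff_holomorphic: "(\<lambda>s. powr_diff M s z) holomorphic_on A"
  by (induction M arbitrary: z) (auto intro!: holomorphic_intros)

lemma powr_diff_at_0: "Re z > 0 \<Longrightarrow> powr_diff M 0 z = (if M = 0 then 1 else 0)"
proof (induction M arbitrary: z)
  case (Suc M)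
  have "Re (z + 1) > 0" using Suc.prems by simp
  with Suc show ?case by simp
qed auto

lemma powr_diff_deriv:
  "Re z > 0 \<Longrightarrow> (powr_diff M s has_field_derivative (- s * powr_diff M (s + 1) z)) (at z)"
proof (induction M arbitrary: z)
  case 0
  hence "z \<notin> \<real>\<^sub>\<le>\<^sub>0" by (auto simp: complex_nonpos_Reals_iff)
  from has_field_derivative_powr[OF this, of "- s"] have
    "((\<lambda>z. z powr (- s)) has_field_derivative (- s * z powr (- (s + 1)))) (at z)" by simp
  thus ?case by (simp add: fun_eq_iff[symmetric] ext)
next
  case (Suc M)
  have 1: "(powr_diff M s has_field_derivative (- s * powr_diff M (s + 1) z)) (at z)"
    using Suc by auto
  have "(powr_diff M s has_field_derivative (- s * powr_diff M (s + 1) (z + 1))) (at (z + 1))"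
    using Suc.IH[of "z + 1"] Suc.prems by simp
  hence 2: "((\<lambda>z. powr_diff M s (z + 1)) has_field_derivative (- s * powr_diff M (s + 1) (z + 1))) (at z)"
    by (simp add: DERIV_shift)
  have "((\<lambda>z. powr_diff M s z - powr_diff M s (z + 1)) has_field_derivative
      (- s * powr_diff M (s + 1) z - - s * powr_diff M (s + 1) (z + 1))) (at z)"
    by (rule DERIV_diff[OF 1 2])
  moreover have "powr_diff (Suc M) s = (\<lambda>z. powr_diff M s z - powr_diff M s (z + 1))" by (auto simp: fun_eq_iff)
  ultimately show ?case by (simp add: algebra_simps)
qed

text \<open>Each difference is estimated by the mean value inequality on the segment from x to x +
  1, using that differentiation in z turns s into s + 1. The product bounds the rising factorial s
  (s + 1) ... in modulus; the condition on Re s makes the power nonincreasing along the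
  segment.\<close>

lemma powr_diff_bound:
  fixes x :: real
  assumes "x > 0" "Re s + real M \<ge> 0"
  shows "norm (powr_diff M s (of_real x)) \<le> (\<Prod>i<M. norm s + real i) * x powr (- Re s - real M)"
  using assms
proof (induction M arbitrary: s x)
  case 0
  thus ?case by (simp add: norm_powr_real_powr)
next
  case (Suc M)
  define C where "C = (\<Prod>i<M. norm (s + 1) + real i)"
  have C: "C \<ge> 0" unfolding C_def by (intro prod_nonneg) auto
  have le: "C \<le> (\<Prod>i<M. norm s + real (Suc i))" unfolding C_def
  proof (intro prod_mono conjI)
    fix i
    have "norm (s + 1) \<le> norm s + norm (1::complex)" by (rule norm_triangle_ineq)
    thus "norm (s + 1) + real i \<le> norm s + real (Suc i)" by simp
  qed auto
  define S where "S = closed_segment (of_real x) (of_real (x + 1) :: complex)"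
  have mem: "\<exists>\<xi>. x \<le> \<xi> \<and> z = of_real \<xi>" if "z \<in> S" for z
    using that unfolding S_def closed_segment_of_real by (auto simp: closed_segment_eq_real_ivl)
  have "norm (powr_diff M s (of_real x) - powr_diff M s (of_real (x + 1)))
      \<le> (norm s * (C * x powr (- Re s - real (Suc M)))) * norm (of_real x - of_real (x + 1) :: complex)"
  proof (rule field_differentiable_bound[where S = S and f = "powr_diff M s"
        and f' = "\<lambda>z. - s * powr_diff M (s + 1) z"])
    show "convex S" by (simp add: S_def)
    show "of_real x \<in> S" "of_real (x + 1) \<in> S" by (auto simp: S_def)
  next
    fix z assume "z \<in> S"
    then obtain \<xi> where \<xi>: "x \<le> \<xi>" "z = of_real \<xi>" using mem by blast
    have "Re z > 0" using \<xi> Suc.prems by simp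
    from powr_diff_deriv[OF this] show
      "(powr_diff M s has_field_derivative - s * powr_diff M (s + 1) z) (at z within S)"
      by (rule has_field_derivative_at_within)
    have "norm (powr_diff M (s + 1) z) \<le> C * \<xi> powr (- Re (s + 1) - real M)"
      unfolding \<xi> C_def using Suc.prems \<xi> by (intro Suc.IH) auto
    also have "\<dots> \<le> C * x powr (- Re (s + 1) - real M)"
      using Suc.prems \<xi> C by (intro mult_left_mono powr_mono2') auto
    also have "- Re (s + 1) - real M = - Re s - real (Suc M)" by simp
    finally have "norm (powr_diff M (s + 1) z) \<le> C * x powr (- Re s - real (Suc M))" .
    thus "norm (- s * powr_diff M (s + 1) z) \<le> norm s * (C * x powr (- Re s - real (Suc M)))"
      by (simp add: norm_mult mult_left_mono)
  qed
  also have "norm (of_real x - of_real (x + 1) :: complex) = 1"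
    by (simp flip: of_real_diff add: norm_of_real)
  also have "norm s * (C * x powr (- Re s - real (Suc M))) * 1
     \<le> (norm s * (\<Prod>i<M. norm s + real (Suc i))) * x powr (- Re s - real (Suc M))"
    using le by (simp add: mult_left_mono mult_right_mono mult.assoc)
  also have "norm s * (\<Prod>i<M. norm s + real (Suc i)) = (\<Prod>i<Suc M. norm s + real i)"
    by (subst prod.lessThan_Suc_shift) simp
  finally show ?case by (simp add: add.commute)
qed

text \<open>Abel summation trades a periodic mean-zero coefficient sequence for its partial sums, recentred
  to have mean zero again, at the cost of one boundary term and one more difference of the powers.\<close>

definition psum_mean :: "nat \<Rightarrow> (nat \<Rightarrow> complex) \<Rightarrow> complex" where
  "psum_mean N f = (\<Sum>k<N. \<Sum>j\<le>k. f j) / of_nat N"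

definition psum_centred :: "nat \<Rightarrow> (nat \<Rightarrow> complex) \<Rightarrow> nat \<Rightarrow> complex" where
  "psum_centred N f k = (\<Sum>j\<le>k. f j) - psum_mean N f"

definition periodic_zero :: "nat \<Rightarrow> (nat \<Rightarrow> complex) \<Rightarrow> bool" where
  "periodic_zero N f \<longleftrightarrow> N > 0 \<and> (\<forall>k. f (k + N) = f k) \<and> (\<Sum>k<N. f k) = 0"

lemma periodic_sum_shift:
  fixes f :: "nat \<Rightarrow> 'a::ab_group_add"
  assumes "\<And>k. f (k + N) = f k"
  shows "(\<Sum>j<k + N. f j) = (\<Sum>j<k. f j) + (\<Sum>j<N. f j)"
  by (induction k) (simp_all add: assms algebra_simps)

lemma periodic_zero_centred:
  assumes "periodic_zero N f"
  shows "periodic_zero N (psum_centred N f)"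
proof -
  have p: "\<And>k. f (k + N) = f k" and z: "(\<Sum>k<N. f k) = 0" and N: "N > 0"
    using assms by (auto simp: periodic_zero_def)
  have "(\<Sum>j\<le>k + N. f j) = (\<Sum>j\<le>k. f j)" for k
    using periodic_sum_shift[of f N "Suc k", OF p] z by (simp flip: lessThan_Suc_atMost)
  thus ?thesis using N
    by (auto simp: periodic_zero_def psum_centred_def sum_subtractf psum_mean_def)
qed

lemma periodic_bounded:
  assumes N: "N > 0" and p: "\<And>k. f (k + N) = f k"
  obtains K where "\<And>k::nat. norm (f k :: 'a::real_normed_vector) \<le> K" "K \<ge> 0"
proof -
  have m: "f k = f (k mod N)" for k
  proof (induction k rule: less_induct)
    case (less k)
    show ?case
    proof (cases "k < N")
      case False
      have "f k = f (k - N)" using p[of "k - N"] False by simp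
      also have "\<dots> = f ((k - N) mod N)" using False N by (intro less) auto
      finally show ?thesis using False by (simp add: le_mod_geq)
    qed auto
  qed
  have "norm (f k) \<le> (\<Sum>i<N. norm (f i))" for k
    by (subst m) (rule member_le_sum[of "k mod N" "{..<N}" "\<lambda>i. norm (f i)"], use N in auto)
  thus ?thesis by (intro that[of "\<Sum>i<N. norm (f i)"]) (auto intro: sum_nonneg)
qed

text \<open>Here i is the order of the difference already reached and M the number of Abel
  summations still to be performed; the series reached at the end converges for Re s > 1 - i -
  M.\<close>

primrec dirichlet_cont :: "nat \<Rightarrow> nat \<Rightarrow> nat \<Rightarrow> (nat \<Rightarrow> complex) \<Rightarrow> complex \<Rightarrow> complex" where
  "dirichlet_cont N 0 i f s = (\<Sum>k. f k * powr_diff i s (of_nat (Suc k)))"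
| "dirichlet_cont N (Suc M) i f s =
     psum_mean N f * powr_diff i s 1 + dirichlet_cont N M (Suc i) (psum_centred N f) s"

lemma powr_diff_nat_bound:
  assumes "Re s + real i \<ge> \<delta>" "\<delta> \<ge> 0"
  shows "norm (powr_diff i s (of_nat (Suc k))) \<le> (\<Prod>j<i. norm s + real j) * real (Suc k) powr (- \<delta>)"
proof -
  have "norm (powr_diff i s (of_real (real (Suc k))))
      \<le> (\<Prod>j<i. norm s + real j) * real (Suc k) powr (- Re s - real i)"
    using assms by (intro powr_diff_bound) auto
  also have "\<dots> \<le> (\<Prod>j<i. norm s + real j) * real (Suc k) powr (- \<delta>)"
    using assms by (intro mult_left_mono powr_mono prod_nonneg) auto
  finally show ?thesis by simp
qed

lemma summable_Suc_powr: "\<delta> > 1 \<Longrightarrow> summable (\<lambda>k. c * real (Suc k) powr (- \<delta>))"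
  using summable_real_powr_iff[of "- \<delta>"] summable_Suc_iff[of "\<lambda>k. real k powr (- \<delta>)"]
  by (intro summable_mult) auto

text \<open>For Re s > 1 the value does not depend on M: one Abel summation rewrites the series as a
  boundary term plus the series of recentred partial sums against the next difference.\<close>

lemma dirichlet_cont_sums:
  assumes "periodic_zero N f" "Re s > 1"
  shows "(\<lambda>k. f k * powr_diff i s (of_nat (Suc k))) sums dirichlet_cont N M i f s"
  using assms(1)
proof (induction M arbitrary: i f)
  case 0
  obtain K where K: "\<And>k. norm (f k) \<le> K" "K \<ge> 0"
    using 0 periodic_bounded[of N f] unfolding periodic_zero_def by metis
  have "summable (\<lambda>k. f k * powr_diff i s (of_nat (Suc k)))"
  proof (rule summable_comparison_test'[where N = 0])
    show "summable (\<lambda>k. (K * (\<Prod>j<i. norm s + real j)) * real (Suc k) powr (- Re s))"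
      using assms by (rule_tac summable_Suc_powr)
    fix k
    have "norm (f k * powr_diff i s (of_nat (Suc k)))
        \<le> K * ((\<Prod>j<i. norm s + real j) * real (Suc k) powr (- Re s))"
      unfolding norm_mult using K assms(2)
      by (intro mult_mono powr_diff_nat_bound) auto
    thus "norm (f k * powr_diff i s (of_nat (Suc k)))
        \<le> (K * (\<Prod>j<i. norm s + real j)) * real (Suc k) powr (- Re s)" by (simp add: mult.assoc)
  qed
  thus ?case by (simp add: summable_sums)
next
  case (Suc M)
  define u where "u = (\<lambda>k. powr_diff i s (of_nat (Suc k)))"
  define T where "T = (\<lambda>n. \<Sum>j<n. f j)"
  have u0: "u \<longlonglongrightarrow> 0"
  proof (rule Lim_null_comparison)
    show "eventually (\<lambda>k. norm (u k) \<le> (\<Prod>j<i. norm s + real j) * real (Suc k) powr (- 1)) sequentially"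
      unfolding u_def using assms(2) by (intro always_eventually allI powr_diff_nat_bound) auto
    have "(\<lambda>k. (\<Prod>j<i. norm s + real j) * (1 / real (Suc k))) \<longlonglongrightarrow> (\<Prod>j<i. norm s + real j) * 0"
      by (intro tendsto_mult tendsto_const lim_inverse_n'[THEN LIMSEQ_Suc])
    thus "(\<lambda>k. (\<Prod>j<i. norm s + real j) * real (Suc k) powr (- 1)) \<longlonglongrightarrow> 0"
      by (simp add: powr_minus divide_inverse)
  qed
  have ps: "periodic_zero N (psum_centred N f)" using Suc.prems by (rule periodic_zero_centred)
  obtain K where K: "\<And>k. norm (psum_centred N f k) \<le> K" "K \<ge> 0"
    using ps periodic_bounded[of N "psum_centred N f"] unfolding periodic_zero_def by metis
  have T1: "T (Suc n) = psum_centred N f n + psum_mean N f" for n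
    by (simp add: T_def psum_centred_def lessThan_Suc_atMost)
  have Tb: "norm (T n) \<le> K + norm (psum_mean N f)" for n
  proof (cases n)
    case 0
    thus ?thesis using K by (simp add: T_def)
  next
    case (Suc m)
    thus ?thesis using T1[of m] K(1)[of m] norm_triangle_ineq[of "psum_centred N f m" "psum_mean N f"] by simp
  qed
  have Tu: "(\<lambda>n. T n * u n) \<longlonglongrightarrow> 0"
  proof (rule Lim_null_comparison)
    show "eventually (\<lambda>n. norm (T n * u n) \<le> (K + norm (psum_mean N f)) * norm (u n)) sequentially"
      unfolding norm_mult by (intro always_eventually allI mult_right_mono Tb) auto
    show "(\<lambda>n. (K + norm (psum_mean N f)) * norm (u n)) \<longlonglongrightarrow> 0"
      using tendsto_mult_right_zero[OF tendsto_norm_zero[OF u0]] by blast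
  qed
  \<comment> \<open>Finite Abel summation. Writing each partial sum as its centred version plus the
    mean splits off a telescoping sum of differences of u, whence the term with u 0 - u n.\<close>
  have part: "(\<Sum>k<n. f k * u k) = T n * u n
      + (\<Sum>k<n. psum_centred N f k * powr_diff (Suc i) s (of_nat (Suc k))) + psum_mean N f * (u 0 - u n)" for n
  proof (induction n)
    case 0
    show ?case by (simp add: T_def)
  next
    case (Suc n)
    have "psum_centred N f n = T n + f n - psum_mean N f" using T1[of n] by (simp add: T_def)
    moreover have "powr_diff (Suc i) s (of_nat (Suc n)) = u n - u (Suc n)"
      by (simp add: u_def add.commute add.left_commute)
    moreover have "T (Suc n) = T n + f n" by (simp add: T_def)
    ultimately show ?case using Suc.IH by (simp only: sum.lessThan_Suc) (simp add: algebra_simps)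
  qed
  have "(\<lambda>n. T n * u n
      + (\<Sum>k<n. psum_centred N f k * powr_diff (Suc i) s (of_nat (Suc k))) + psum_mean N f * (u 0 - u n))
    \<longlonglongrightarrow> 0 + dirichlet_cont N M (Suc i) (psum_centred N f) s + psum_mean N f * (u 0 - 0)"
    by (intro tendsto_intros Tu u0 Suc.IH[OF ps, unfolded sums_def])
  hence "(\<lambda>k. f k * u k) sums (0 + dirichlet_cont N M (Suc i) (psum_centred N f) s + psum_mean N f * (u 0 - 0))"
    unfolding sums_def part .
  thus ?case by (simp add: u_def add.commute)
qed

lemma dirichlet_cont_holomorphic:
  assumes "periodic_zero N f"
  shows "dirichlet_cont N M i f holomorphic_on {s. Re s > 1 - real i - real M}"
  using assms
proof (induction M arbitrary: i f)
  case 0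
  obtain K where K: "\<And>k. norm (f k) \<le> K" "K \<ge> 0"
    using 0 periodic_bounded[of N f] unfolding periodic_zero_def by metis
  have "dirichlet_cont N 0 i f holomorphic_on {s. Re s > 1 - real i}"
  proof (rule holomorphic_uniform_sequence)
    show "open {s. Re s > 1 - real i}" by (rule open_halfspace_Re_gt)
    show "(\<lambda>s. \<Sum>k<n. f k * powr_diff i s (of_nat (Suc k))) holomorphic_on {s. Re s > 1 - real i}" for n
      by (intro holomorphic_intros powr_diff_holomorphic)
    fix z assume z: "z \<in> {s. Re s > 1 - real i}"
    \<comment> \<open>Half the distance to the boundary line, so that the exponent of decay stays at
      least 1 + d on the whole closed ball.\<close>
    define d where "d = (Re z - (1 - real i)) / 2"
    have d: "d > 0" using z by (simp add: d_def)
    have re: "Re s + real i \<ge> 1 + d" if "s \<in> cball z d" for s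
    proof -
      have "\<bar>Re (z - s)\<bar> \<le> d" using that abs_Re_le_cmod[of "z - s"] by (simp add: dist_norm)
      hence "Re z - Re s \<le> d" by simp
      moreover have "Re z = 2 * d + 1 - real i" by (simp add: d_def field_simps)
      ultimately show ?thesis by linarith
    qed
    have ul: "uniform_limit (cball z d) (\<lambda>n s. \<Sum>k<n. f k * powr_diff i s (of_nat (Suc k)))
        (dirichlet_cont N 0 i f) sequentially"
      unfolding dirichlet_cont.simps
    proof (rule Weierstrass_m_test)
      show "summable (\<lambda>k. (K * (\<Prod>j<i. norm z + d + real j)) * real (Suc k) powr (- (1 + d)))"
        using d by (intro summable_Suc_powr) auto
      fix k s assume s: "s \<in> cball z d"
      have ns: "norm s \<le> norm z + d"
        using s norm_triangle_ineq2[of s z] by (simp add: dist_norm norm_minus_commute)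
      have "norm (powr_diff i s (of_nat (Suc k))) \<le> (\<Prod>j<i. norm s + real j) * real (Suc k) powr (- (1 + d))"
        using re[OF s] d by (intro powr_diff_nat_bound) auto
      also have "\<dots> \<le> (\<Prod>j<i. norm z + d + real j) * real (Suc k) powr (- (1 + d))"
        using ns by (intro mult_right_mono prod_mono) auto
      finally have "norm (f k) * norm (powr_diff i s (of_nat (Suc k)))
         \<le> K * ((\<Prod>j<i. norm z + d + real j) * real (Suc k) powr (- (1 + d)))"
        using K by (intro mult_mono) auto
      thus "norm (f k * powr_diff i s (of_nat (Suc k)))
          \<le> (K * (\<Prod>j<i. norm z + d + real j)) * real (Suc k) powr (- (1 + d))"
        by (simp add: norm_mult mult.assoc)
    qed
    have "cball z d \<subseteq> {s. Re s > 1 - real i}" using re d by force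
    with d ul show "\<exists>d>0. cball z d \<subseteq> {s. Re s > 1 - real i} \<and>
        uniform_limit (cball z d) (\<lambda>n s. \<Sum>k<n. f k * powr_diff i s (of_nat (Suc k)))
        (dirichlet_cont N 0 i f) sequentially" by blast
  qed
  thus ?case by (simp del: dirichlet_cont.simps)
next
  case (Suc M)
  have "dirichlet_cont N M (Suc i) (psum_centred N f) holomorphic_on {s. Re s > 1 - real (Suc i) - real M}"
    by (intro Suc.IH periodic_zero_centred Suc.prems)
  also have "{s. Re s > 1 - real (Suc i) - real M} = {s. Re s > 1 - real i - real (Suc M)}"
    by (rule Collect_cong) auto
  finally have "dirichlet_cont N M (Suc i) (psum_centred N f) holomorphic_on {s. Re s > 1 - real i - real (Suc M)}" .
  moreover have "dirichlet_cont N (Suc M) i f = (\<lambda>s. psum_mean N f * powr_diff i s 1 +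
      dirichlet_cont N M (Suc i) (psum_centred N f) s)" by (auto simp: fun_eq_iff)
  ultimately show ?case by (auto intro!: holomorphic_intros powr_diff_holomorphic)
qed

text \<open>At s = 0 the power is the constant 1, whose differences of positive order vanish; hence
  only the first mean survives in \<open>dirichlet_cont_at_0\<close>.\<close>

lemma dirichlet_cont_at_0_pos: "dirichlet_cont N M (Suc i) f 0 = 0"
  by (induction M arbitrary: i f) (simp_all del: powr_diff.simps add: powr_diff_at_0)

lemma dirichlet_cont_at_0: "dirichlet_cont N (Suc M) 0 f 0 = psum_mean N f"
  using dirichlet_cont_at_0_pos[of N M 0] by simp

text \<open>The continuations to the half-planes Re s > 1 - M agree by the identity theorem and are
  glued by letting M depend on s.\<close>

theorem periodic_dirichlet_series_entire:
  assumes f: "periodic_zero N f"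
  obtains F where "F holomorphic_on UNIV"
    "\<And>s. Re s > 1 \<Longrightarrow> (\<lambda>k. f k / of_nat (Suc k) powr s) sums F s"
    "F 0 = psum_mean N f"
proof -
  let ?c = "\<lambda>M. dirichlet_cont N M 0 f"
  let ?H = "\<lambda>M. {s. Re s > 1 - real M}"
  have eq1: "?c M s = ?c M' s" if "Re s > 1" for M M' s
    using dirichlet_cont_sums[OF f that] by (rule sums_unique2) (rule dirichlet_cont_sums[OF f that])
  have eq: "?c M s = ?c M' s" if "M \<le> M'" "s \<in> ?H M" for M M' s
  proof (rule analytic_continuation_open[of "{s. Re s > 1}" "?H M" "?c M" "?c M'"])
    show "open {s. Re s > 1}" "open (?H M)" by (auto intro: open_halfspace_Re_gt)
    show "{s. Re s > 1} \<noteq> {}" by (auto intro!: exI[of _ "2::complex"])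
    show "connected (?H M)" by (intro convex_connected convex_halfspace_Re_gt)
    show "?c M holomorphic_on ?H M" using dirichlet_cont_holomorphic[OF f, of M 0] by simp
    show "?c M' holomorphic_on ?H M"
      by (rule holomorphic_on_subset[OF dirichlet_cont_holomorphic[OF f, of M' 0]]) (use that in auto)
  qed (use that eq1 in auto)
  define m where "m = (\<lambda>s::complex. nat \<lceil>\<bar>Re s\<bar>\<rceil> + 2)"
  have m: "s \<in> ?H (m s)" for s
  proof -
    have "\<bar>Re s\<bar> \<le> real (nat \<lceil>\<bar>Re s\<bar>\<rceil>)" by (rule real_nat_ceiling_ge)
    moreover have "real (m s) = real (nat \<lceil>\<bar>Re s\<bar>\<rceil>) + 2" by (simp only: m_def of_nat_add of_nat_numeral)
    ultimately have "1 - real (m s) < Re s" using abs_ge_minus_self[of "Re s"] by linarith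
    thus ?thesis by simp
  qed
  define F where "F = (\<lambda>s. ?c (m s) s)"
  have FM: "F s = ?c M s" if "s \<in> ?H M" for s M
  proof (cases "M \<le> m s")
    case True
    show ?thesis unfolding F_def by (rule eq[OF True that, symmetric])
  next
    case False
    hence "m s \<le> M" by simp
    thus ?thesis unfolding F_def by (rule eq[OF _ m])
  qed
  have "F holomorphic_on (\<Union>M\<in>UNIV. ?H M)"
  proof (rule holomorphic_on_UN_open)
    fix M
    show "F holomorphic_on ?H M"
    proof (rule holomorphic_transform)
      show "?c M holomorphic_on ?H M" using dirichlet_cont_holomorphic[OF f, of M 0] by simp
      show "?c M s = F s" if "s \<in> ?H M" for s using FM[OF that] by (rule sym)
    qed
    show "open (?H M)" by (rule open_halfspace_Re_gt)
  qed
  moreover have "(\<Union>M\<in>UNIV. ?H M) = UNIV" using m by blast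
  ultimately have "F holomorphic_on UNIV" by simp
  moreover have "(\<lambda>k. f k / of_nat (Suc k) powr s) sums F s" if "Re s > 1" for s
    using dirichlet_cont_sums[OF f that, of 0 "m s"] unfolding F_def
    by (simp add: powr_minus divide_inverse)
  \<comment> \<open>M = 2 is the first index whose half-plane Re s > 1 - M contains 0.\<close>
  moreover have "F 0 = psum_mean N f"
    using FM[of 0 2] dirichlet_cont_at_0[of N 1 f] by (simp add: numeral_2_eq_2)
  ultimately show ?thesis by (rule that)
qed

text \<open>The identity theorem makes the entire function in the definition unique, so the
  description operator picks the continuation just built.\<close>

lemma L_at_0_eq:
  assumes "periodic_zero N (\<lambda>k. of_int (kronecker D (Suc k)))"
  shows "L_at_0 D = (\<Sum>k<N. \<Sum>j\<le>k. of_int (kronecker D (Suc j))) / real N"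
proof -
  let ?f = "\<lambda>k. of_int (kronecker D (Suc k)) :: complex"
  let ?P = "\<lambda>F. F holomorphic_on UNIV \<and> (\<forall>s. 1 < Re s \<longrightarrow>
         (\<lambda>k. of_int (kronecker D (Suc k)) / (of_nat (Suc k)) powr s) sums F s)"
  obtain F where F: "F holomorphic_on UNIV"
    "\<And>s. Re s > 1 \<Longrightarrow> (\<lambda>k. ?f k / of_nat (Suc k) powr s) sums F s" "F 0 = psum_mean N ?f"
    using periodic_dirichlet_series_entire[OF assms] by blast
  have "(THE F. ?P F) = F"
  proof (rule the_equality)
    show "?P F" using F by auto
    fix G assume G: "?P G"
    show "G = F"
    proof
      fix z
      show "G z = F z"
      proof (rule analytic_continuation_open[of "{s. Re s > 1}" UNIV G F])
        show "{s. Re s > 1} \<noteq> {}" by (auto intro!: exI[of _ "2::complex"])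
        show "G s = F s" if "s \<in> {s. Re s > 1}" for s
          using G F(2)[of s] that sums_unique2 by blast
      qed (use G F in \<open>auto intro: open_halfspace_Re_gt\<close>)
    qed
  qed
  hence "L_at_0 D = Re (psum_mean N ?f)" unfolding L_at_0_def using F(3) by simp
  also have "psum_mean N ?f = of_real ((\<Sum>k<N. \<Sum>j\<le>k. of_int (kronecker D (Suc j))) / real N)"
    by (simp add: psum_mean_def)
  finally show ?thesis by simp
qed

section \<open>Periodicity of the Kronecker symbol\<close>

text \<open>\<open>chi4\<close> is the odd character modulo 4 and \<open>chi8\<close> the even
  primitive character modulo 8: the two supplementary laws for (-1/p) and (2/p).\<close>

definition chi4 :: "int \<Rightarrow> int" where
  "chi4 x = (if even x then 0 else if x mod 4 = 1 then 1 else -1)"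

definition chi8 :: "int \<Rightarrow> int" where
  "chi8 x = (if even x then 0 else if x mod 8 = 1 \<or> x mod 8 = 7 then 1 else -1)"

lemma chi4_mult: "chi4 (x * y) = chi4 x * chi4 y"
proof (cases "even x \<or> even y")
  case False
  hence "x mod 4 = 1 \<or> x mod 4 = 3" "y mod 4 = 1 \<or> y mod 4 = 3" by presburger+
  moreover have "(x * y) mod 4 = ((x mod 4) * (y mod 4)) mod 4" by (simp add: mod_mult_eq)
  ultimately show ?thesis using False unfolding chi4_def by (elim disjE) auto
qed (auto simp: chi4_def)

lemma chi8_mult: "chi8 (x * y) = chi8 x * chi8 y"
proof (cases "even x \<or> even y")
  case False
  hence "x mod 8 = 1 \<or> x mod 8 = 3 \<or> x mod 8 = 5 \<or> x mod 8 = 7"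
    "y mod 8 = 1 \<or> y mod 8 = 3 \<or> y mod 8 = 5 \<or> y mod 8 = 7" by presburger+
  moreover have "(x * y) mod 8 = ((x mod 8) * (y mod 8)) mod 8" by (simp add: mod_mult_eq)
  ultimately show ?thesis using False unfolding chi8_def by (elim disjE) auto
qed (auto simp: chi8_def)

lemma chi4_1 [simp]: "chi4 1 = 1" and chi8_1 [simp]: "chi8 1 = 1"
  by (simp_all add: chi4_def chi8_def)

lemma chi4_prod: "chi4 (\<Prod>i\<in>A. f i) = (\<Prod>i\<in>A. chi4 (f i))"
  by (induction A rule: infinite_finite_induct) (simp_all add: chi4_mult)

lemma chi8_prod: "chi8 (\<Prod>i\<in>A. f i) = (\<Prod>i\<in>A. chi8 (f i))"
  by (induction A rule: infinite_finite_induct) (simp_all add: chi8_mult)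

section \<open>Legendre symbols at -1, 2 and odd primes\<close>

lemma Legendre_cong: "[a = b] (mod p) \<Longrightarrow> Legendre a p = Legendre b p"
proof -
  assume ab: "[a = b] (mod p)"
  hence "[a = 0] (mod p) \<longleftrightarrow> [b = 0] (mod p)" by (simp add: cong_def)
  moreover have "QuadRes p a \<longleftrightarrow> QuadRes p b" using ab unfolding QuadRes_def
    by (auto simp: cong_def)
  ultimately show ?thesis by (simp add: Legendre_def)
qed

lemma Legendre_values: "Legendre a p \<in> {-1, 0, 1}"
  by (simp add: Legendre_def)

text \<open>The values -1, 0, 1 are distinct modulo p > 2, so congruences such as Euler's criterion
  turn into equalities of symbols.\<close>

lemma eq_if_cong_trits:
  fixes a b p :: int
  assumes "a \<in> {-1, 0, 1}" "b \<in> {-1, 0, 1}" "p > 2" "[a = b] (mod p)"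
  shows "a = b"
proof -
  have "p dvd a - b" using assms(4) by (simp add: cong_iff_dvd_diff)
  moreover have "\<bar>a - b\<bar> < p" using assms by auto
  ultimately show ?thesis using dvd_imp_le_int[of "a - b" p] assms(3) by fastforce
qed

lemma Legendre_mult:
  assumes "prime p" "2 < p"
  shows "Legendre (a * b) (int p) = Legendre a (int p) * Legendre b (int p)"
proof (rule eq_if_cong_trits[of _ _ "int p"])
  have "[Legendre (a * b) (int p) = (a * b) ^ ((p - 1) div 2)] (mod int p)"
    by (rule euler_criterion[OF assms])
  moreover have "[Legendre a (int p) * Legendre b (int p) = a ^ ((p - 1) div 2) * b ^ ((p - 1) div 2)] (mod int p)"
    by (intro cong_mult euler_criterion[OF assms])
  ultimately show "[Legendre (a * b) (int p) = Legendre a (int p) * Legendre b (int p)] (mod int p)"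
    by (simp add: power_mult_distrib) (metis cong_sym cong_trans)
qed (use assms Legendre_values[of "a * b" "int p"] Legendre_values[of a "int p"]
      Legendre_values[of b "int p"] in auto)

lemma Legendre_one: "prime p \<Longrightarrow> Legendre 1 (int p) = 1"
proof -
  assume "prime p"
  hence "p > 1" by (rule prime_gt_1_nat)
  hence "\<not> [1 = 0] (mod int p)" by (simp add: cong_def)
  moreover have "QuadRes (int p) 1" unfolding QuadRes_def by (intro exI[of _ 1]) simp
  ultimately show ?thesis by (simp add: Legendre_def)
qed

lemma Legendre_prod:
  assumes "prime p" "2 < p"
  shows "Legendre (\<Prod>i\<in>A. f i) (int p) = (\<Prod>i\<in>A. Legendre (f i) (int p))"
  by (induction A rule: infinite_finite_induct)
     (simp_all add: Legendre_mult[OF assms] Legendre_one[OF assms(1)])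

lemma odd_prime_gt_2: "prime (p::nat) \<Longrightarrow> odd p \<Longrightarrow> 2 < p"
  using prime_ge_2_nat[of p] by (cases "p = 2") auto

lemma Legendre_minus_one:
  assumes "prime p" "odd p"
  shows "Legendre (- 1) (int p) = chi4 (int p)"
proof (rule eq_if_cong_trits[of _ _ "int p"])
  have p2: "2 < p" using odd_prime_gt_2 assms by auto
  have "[Legendre (- 1) (int p) = (- 1) ^ ((p - 1) div 2)] (mod int p)"
    by (rule euler_criterion[OF assms(1) p2])
  moreover have "(- 1) ^ ((p - 1) div 2) = chi4 (int p)"
  proof -
    have "p mod 4 = 1 \<or> p mod 4 = 3" using assms(2) by presburger
    thus ?thesis
    proof
      assume p: "p mod 4 = 1"
      hence "even ((p - 1) div 2)" by presburger
      moreover have "int p mod 4 = 1" using p by presburger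
      ultimately show ?thesis using assms(2) by (simp add: chi4_def)
    next
      assume p: "p mod 4 = 3"
      hence "odd ((p - 1) div 2)" by presburger
      moreover have "int p mod 4 = 3" using p by presburger
      ultimately show ?thesis using assms(2) by (simp add: chi4_def)
    qed
  qed
  ultimately show "[Legendre (- 1) (int p) = chi4 (int p)] (mod int p)" by simp
qed (use assms Legendre_values[of "-1" "int p"] odd_prime_gt_2 in \<open>auto simp: chi4_def\<close>)

lemma Legendre_two:
  assumes "prime p" "odd p"
  shows "Legendre 2 (int p) = chi8 (int p)"
proof -
  have p2: "2 < p" using odd_prime_gt_2 assms by auto
  interpret GAUSS p 2
  proof
    show "[2 \<noteq> 0] (mod int p)" using p2 by (simp add: cong_def)
  qed (use assms p2 in auto)
  define h where "h = (int p - 1) div 2"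
  have p: "int p = 2 * h + 1" using assms(2) unfolding h_def by presburger
  \<comment> \<open>The doubled residues 2, 4, ..., 2 h are already below p = 2 h + 1, so reduction
    changes nothing, and Gauss's lemma counts the x with h < 2 x <= 2 h.\<close>
  have "C = B"
  proof -
    have "(\<lambda>x. x mod int p) ` B = (\<lambda>x. x) ` B"
      by (rule image_cong) (auto simp: B_def A_def p)
    thus ?thesis by (simp add: C_def)
  qed
  hence "E = (\<lambda>x. x * 2) ` {h div 2 <.. h}"
    unfolding E_def B_def A_def by (auto simp: p)
  hence "card E = nat (h - h div 2)"
    by (simp add: card_image inj_on_def)
  hence L: "Legendre 2 (int p) = (- 1) ^ nat (h - h div 2)" using gauss_lemma by simp
  have h0: "h \<ge> 0" using p2 p by linarith
  have "h mod 4 = 0 \<or> h mod 4 = 1 \<or> h mod 4 = 2 \<or> h mod 4 = 3" by presburger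
  thus ?thesis
  proof (elim disjE)
    assume h: "h mod 4 = 0"
    hence "even (h - h div 2)" "int p mod 8 = 1" unfolding p by presburger+
    thus ?thesis using assms(2) h0 unfolding L by (simp add: chi8_def even_nat_iff)
  next
    assume h: "h mod 4 = 1"
    hence "odd (h - h div 2)" "int p mod 8 = 3" unfolding p by presburger+
    thus ?thesis using assms(2) h0 unfolding L by (simp add: chi8_def even_nat_iff)
  next
    assume h: "h mod 4 = 2"
    hence "odd (h - h div 2)" "int p mod 8 = 5" unfolding p by presburger+
    thus ?thesis using assms(2) h0 unfolding L by (simp add: chi8_def even_nat_iff)
  next
    assume h: "h mod 4 = 3"
    hence "even (h - h div 2)" "int p mod 8 = 7" unfolding p by presburger+
    thus ?thesis using assms(2) h0 unfolding L by (simp add: chi8_def even_nat_iff)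
  qed
qed

text \<open>The reciprocity sign is written through \<open>chi4 (int p)\<close> so that it can be
  multiplied over all odd p dividing D.\<close>

lemma Legendre_swap:
  assumes "prime p" "odd p" "prime q" "odd q" "p \<noteq> q"
  shows "Legendre (int p) (int q) = Legendre (int q) (int p) * (if chi4 (int q) = 1 then 1 else chi4 (int p))"
proof -
  have p2: "2 < p" "2 < q" using odd_prime_gt_2 assms by auto
  have QR: "Legendre (int p) (int q) * Legendre (int q) (int p) = (- 1) ^ ((p - 1) div 2 * ((q - 1) div 2))"
    by (rule Quadratic_Reciprocity) (use assms p2 in auto)
  have e: "(- 1) ^ ((p - 1) div 2 * ((q - 1) div 2)) = (if chi4 (int q) = 1 then 1 else chi4 (int p))"
  proof -
    have par: "even ((r - 1) div 2) \<longleftrightarrow> chi4 (int r) = 1" if "odd r" for r :: nat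
    proof -
      have "even ((r - 1) div 2) \<longleftrightarrow> int r mod 4 = 1" using that by presburger
      thus ?thesis using that by (simp add: chi4_def)
    qed
    have "chi4 (int p) = 1 \<or> chi4 (int p) = - 1" using assms(2) by (simp add: chi4_def)
    thus ?thesis using par[OF assms(2)] par[OF assms(4)] by (auto simp: uminus_power_if)
  qed
  have "Legendre (int q) (int p) \<noteq> 0"
    using QR by auto
  hence "Legendre (int q) (int p) * Legendre (int q) (int p) = 1"
    using Legendre_values[of "int q" "int p"] by auto
  hence "Legendre (int p) (int q) = (Legendre (int p) (int q) * Legendre (int q) (int p)) * Legendre (int q) (int p)"
    by (simp add: mult.assoc)
  thus ?thesis unfolding QR e by (simp add: mult.commute)
qed

section \<open>The Kronecker symbol and fundamental discriminants\<close>

lemma kronecker_1 [simp]: "kronecker D 1 = 1" "kronecker D (Suc 0) = 1"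
  by (simp_all add: kronecker_def)

lemma kronecker_prime: "prime p \<Longrightarrow> kronecker D p = kron_prime D p"
proof -
  assume p: "prime p"
  hence "p \<noteq> 0" by auto
  thus ?thesis using p by (simp add: kronecker_def prime_prime_factors)
qed

lemma kronecker_conv_prod:
  assumes "k \<noteq> 0" "finite A" "prime_factors k \<subseteq> A" "\<And>p. p \<in> A \<Longrightarrow> prime p"
  shows "kronecker D k = (\<Prod>p\<in>A. kron_prime D p ^ multiplicity p k)"
proof -
  have "(\<Prod>p\<in>prime_factors k. kron_prime D p ^ multiplicity p k) = (\<Prod>p\<in>A. kron_prime D p ^ multiplicity p k)"
  proof (rule prod.mono_neutral_left)
    show "\<forall>i\<in>A - prime_factors k. kron_prime D i ^ multiplicity i k = 1"
      using assms by (auto simp: prime_factors_multiplicity)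
  qed (use assms in auto)
  thus ?thesis using assms by (simp add: kronecker_def)
qed

lemma kronecker_mult:
  assumes "a \<noteq> 0" "b \<noteq> 0"
  shows "kronecker D (a * b) = kronecker D a * kronecker D b"
proof -
  let ?A = "prime_factors a \<union> prime_factors b"
  have "kronecker D (a * b) = (\<Prod>p\<in>?A. kron_prime D p ^ multiplicity p (a * b))"
    using assms by (intro kronecker_conv_prod) (auto simp: prime_factors_product)
  also have "\<dots> = (\<Prod>p\<in>?A. kron_prime D p ^ multiplicity p a * kron_prime D p ^ multiplicity p b)"
    using assms by (intro prod.cong refl)
      (auto simp: prime_elem_multiplicity_mult_distrib power_add in_prime_factors_iff)
  also have "\<dots> = kronecker D a * kronecker D b"
    unfolding prod.distrib using assms
    by (intro arg_cong2[of _ _ _ _ "(*)"] kronecker_conv_prod[symmetric]) auto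
  finally show ?thesis .
qed

lemma kron_prime_values: "kron_prime D p \<in> {-1, 0, 1}"
  using Legendre_values[of D "int p"] by (auto simp: kron_prime_def)

lemma kronecker_abs_le_1: "\<bar>kronecker D k\<bar> \<le> 1"
proof (cases "k = 0")
  case False
  have "\<bar>\<Prod>p\<in>prime_factors k. kron_prime D p ^ multiplicity p k\<bar> \<le> 1"
    unfolding abs_prod power_abs
  proof (intro prod_le_1 conjI power_le_one)
    show "\<bar>kron_prime D p\<bar> \<le> 1" for p using kron_prime_values[of D p] by auto
  qed auto
  thus ?thesis using False by (simp add: kronecker_def)
qed (simp add: kronecker_def)

lemma square_mod_8: "odd (x::int) \<Longrightarrow> x\<^sup>2 mod 8 = 1"
proof -
  assume "odd x"
  hence "x mod 8 = 1 \<or> x mod 8 = 3 \<or> x mod 8 = 5 \<or> x mod 8 = 7" by presburger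
  moreover have "x\<^sup>2 mod 8 = ((x mod 8) * (x mod 8)) mod 8" by (simp add: power2_eq_square mod_mult_eq)
  ultimately show ?thesis by (elim disjE) auto
qed

lemma is_disc_odd_square_mult:
  assumes "odd (x::int)"
  shows "is_disc (D * x\<^sup>2) \<longleftrightarrow> is_disc D"
proof -
  have "x\<^sup>2 mod 4 = 1" using square_mod_8[OF assms] by presburger
  hence "(D * x\<^sup>2) mod 4 = D mod 4" by (metis mod_mult_right_eq mult.right_neutral)
  thus ?thesis by (simp add: is_disc_def)
qed

lemma fundamental_disc_odd_prime:
  assumes "fundamental_disc D" "prime p" "odd p"
  shows "\<not> (int p)\<^sup>2 dvd D"
proof
  assume "(int p)\<^sup>2 dvd D"
  then obtain D' where D': "D = D' * (int p)\<^sup>2" by (auto simp: dvd_def mult.commute)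
  have "is_disc D" using assms by (simp add: fundamental_disc_def)
  hence "is_disc D'" using is_disc_odd_square_mult[of "int p" D'] assms(3) by (simp add: D')
  moreover have "int p > 1" using prime_gt_1_nat[OF assms(2)] by simp
  ultimately show False using assms(1) D' unfolding fundamental_disc_def by blast
qed

lemma fundamental_disc_even:
  assumes "fundamental_disc D" "even D"
  shows "\<exists>d. D = 4 * d \<and> (d mod 4 = 2 \<or> d mod 4 = 3)"
proof -
  have "is_disc D" using assms(1) by (simp add: fundamental_disc_def)
  hence "D mod 4 = 0" using assms(2) unfolding is_disc_def by presburger
  then obtain d where d: "D = 4 * d" by (auto simp: dvd_def mod_eq_0_iff_dvd)
  have "\<not> is_disc d"
  proof
    assume "is_disc d"
    moreover have "D = d * 2\<^sup>2" by (simp add: d)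
    ultimately show False using assms(1) unfolding fundamental_disc_def
      by (metis one_less_numeral_iff semiring_norm(76))
  qed
  hence "d mod 4 = 2 \<or> d mod 4 = 3" unfolding is_disc_def by presburger
  thus ?thesis using d by blast
qed

text \<open>For a fundamental discriminant this is the full odd part of |D|, since no odd prime
  divides D twice.\<close>

definition odd_part :: "int \<Rightarrow> int" where
  "odd_part D = (\<Prod>p\<in>prime_factors (nat \<bar>D\<bar>) - {2}. int p)"

text \<open>The Kronecker symbol with its arguments exchanged by reciprocity. The factor
  \<open>chi8\<close> belongs to the prime discriminants 8 and -8, the factor \<open>chi4\<close> to
  -4 and -8; for negative fundamental D the latter occur exactly when the odd part is 1 modulo 4.
  Unlike \<open>kronecker\<close>, this is multiplicative on all integers and its periodicity can be
  read off.\<close>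

definition recip_char :: "int \<Rightarrow> int \<Rightarrow> int" where
  "recip_char D x = (\<Prod>p\<in>prime_factors (nat \<bar>D\<bar>) - {2}. Legendre x (int p))
     * (if odd_part D mod 4 = 1 then chi4 x else 1) * (if 8 dvd D then chi8 x else 1)"

context
  fixes D :: int
  assumes fund: "fundamental_disc D" and neg: "D < 0"
begin

private lemma odd_prime: "p \<in> prime_factors (nat \<bar>D\<bar>) - {2} \<Longrightarrow> prime p \<and> odd p \<and> 2 < p \<and> int p dvd D"
proof -
  assume p: "p \<in> prime_factors (nat \<bar>D\<bar>) - {2}"
  hence "prime p" "p dvd nat \<bar>D\<bar>" by auto
  moreover have "odd p" using p \<open>prime p\<close> by (metis DiffE insertI1 primes_dvd_imp_eq two_is_prime_nat)
  moreover have "int p dvd D" using \<open>p dvd nat \<bar>D\<bar>\<close> by (simp add: dvd_nat_abs_iff)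
  ultimately show ?thesis using odd_prime_gt_2 by auto
qed

private lemma odd_part_odd: "odd (odd_part D)"
  unfolding odd_part_def using odd_prime by (subst even_prod_iff) auto

text \<open>No odd prime divides D twice, so D is minus a power of 2 times
  \<open>odd_part D\<close>. That D is a discriminant, but not 4 times one, leaves the exponents 0,
  2, 3 and the stated congruences.\<close>

private lemma decomp:
  "D = - odd_part D \<and> odd_part D mod 4 = 3 \<or> D = - 4 * odd_part D \<and> odd_part D mod 4 = 1
    \<or> D = - 8 * odd_part D"
proof -
  let ?P = "prime_factors (nat \<bar>D\<bar>)"
  have nz: "nat \<bar>D\<bar> > 0" using neg by simp
  have m1: "multiplicity p (nat \<bar>D\<bar>) = 1" if "p \<in> ?P - {2}" for p
  proof -
    note p = odd_prime[OF that]
    have "\<not> p\<^sup>2 dvd nat \<bar>D\<bar>"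
    proof
      assume "p\<^sup>2 dvd nat \<bar>D\<bar>"
      hence "int (p\<^sup>2) dvd D" by (simp add: dvd_nat_abs_iff)
      thus False using fundamental_disc_odd_prime[OF fund] p by simp
    qed
    moreover have "p ^ 1 dvd nat \<bar>D\<bar>" using that by auto
    ultimately show ?thesis using p nz by (intro multiplicity_eqI) (auto simp: numeral_2_eq_2)
  qed
  have "nat \<bar>D\<bar> = (\<Prod>p\<in>?P. p ^ multiplicity p (nat \<bar>D\<bar>))"
    using nz by (rule prime_factorization_nat)
  also have "\<dots> = (\<Prod>p\<in>insert 2 (?P - {2}). p ^ multiplicity p (nat \<bar>D\<bar>))"
  proof (rule prod.mono_neutral_left)
    show "\<forall>i\<in>insert 2 (?P - {2}) - ?P. i ^ multiplicity i (nat \<bar>D\<bar>) = 1"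
      by (auto simp: prime_factors_multiplicity)
  qed auto
  also have "\<dots> = 2 ^ multiplicity 2 (nat \<bar>D\<bar>) * (\<Prod>p\<in>?P - {2}. p ^ multiplicity p (nat \<bar>D\<bar>))"
    by (subst prod.insert) auto
  also have "(\<Prod>p\<in>?P - {2}. p ^ multiplicity p (nat \<bar>D\<bar>)) = (\<Prod>p\<in>?P - {2}. p)"
    by (rule prod.cong) (auto simp: m1)
  finally obtain e where "nat \<bar>D\<bar> = 2 ^ e * (\<Prod>p\<in>?P - {2}. p)" by blast
  hence "int (nat \<bar>D\<bar>) = int (2 ^ e * (\<Prod>p\<in>?P - {2}. p))" by (rule arg_cong)
  also have "int (nat \<bar>D\<bar>) = - D" using neg by simp
  finally have e: "- D = 2 ^ e * odd_part D" by (simp add: odd_part_def)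
  show ?thesis
  proof (cases "even D")
    case False
    have "e = 0"
    proof (rule ccontr)
      assume "e \<noteq> 0"
      hence "even (2 ^ e * odd_part D)" by simp
      thus False using e False by (metis even_minus)
    qed
    hence D: "D = - odd_part D" using e by simp
    have "is_disc D" using fund by (simp add: fundamental_disc_def)
    hence "D mod 4 = 1" using False unfolding is_disc_def by presburger
    hence "odd_part D mod 4 = 3" using D by presburger
    thus ?thesis using D by blast
  next
    case True
    then obtain d where d: "D = 4 * d" "d mod 4 = 2 \<or> d mod 4 = 3"
      using fundamental_disc_even[OF fund] by blast
    have "e \<noteq> 0"
    proof
      assume "e = 0"
      hence "- D = odd_part D" using e by simp
      thus False using True odd_part_odd by (metis even_minus)
    qed
    moreover have "e \<noteq> 1"
    proof
      assume "e = 1"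
      hence "4 * d = - 2 * odd_part D" using e d by simp
      thus False using odd_part_odd by presburger
    qed
    ultimately obtain i where i: "e = Suc (Suc i)" by (metis One_nat_def not0_implies_Suc)
    hence d': "- d = 2 ^ i * odd_part D" using e d by simp
    have "i < 2"
    proof (rule ccontr)
      assume "\<not> i < 2"
      then obtain j where "i = j + 2" by (metis add.commute le_Suc_ex not_less)
      hence "d = 4 * (- (2 ^ j * odd_part D))" using d' by simp
      hence "d mod 4 = 0" by simp
      thus False using d(2) by simp
    qed
    hence "i = 0 \<or> i = 1" by auto
    thus ?thesis
    proof
      assume "i = 0"
      hence D: "d = - odd_part D" using d' by simp
      hence "odd_part D mod 4 = 1" using d(2) odd_part_odd by presburger
      moreover have "D = - 4 * odd_part D" using D d(1) by linarith
      ultimately show ?thesis by blast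
    next
      assume "i = 1"
      hence "d = - 2 * odd_part D" using d' by simp
      hence "D = - 8 * odd_part D" using d(1) by linarith
      thus ?thesis by blast
    qed
  qed
qed

lemma recip_char_mult: "recip_char D (x * y) = recip_char D x * recip_char D y"
proof -
  have "(\<Prod>p\<in>prime_factors (nat \<bar>D\<bar>) - {2}. Legendre (x * y) (int p)) =
     (\<Prod>p\<in>prime_factors (nat \<bar>D\<bar>) - {2}. Legendre x (int p) * Legendre y (int p))"
    by (intro prod.cong refl Legendre_mult) (use odd_prime in blast)+
  thus ?thesis by (simp add: recip_char_def chi4_mult chi8_mult prod.distrib)
qed

lemma recip_char_1 [simp]: "recip_char D 1 = 1"
proof -
  have "(\<Prod>p\<in>prime_factors (nat \<bar>D\<bar>) - {2}. Legendre 1 (int p)) = 1"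
    by (intro prod.neutral ballI Legendre_one) auto
  thus ?thesis by (simp add: recip_char_def)
qed

lemma recip_char_prod: "recip_char D (\<Prod>i\<in>A. f i) = (\<Prod>i\<in>A. recip_char D (f i))"
  by (induction A rule: infinite_finite_induct) (simp_all add: recip_char_mult)

lemma recip_char_power: "recip_char D (x ^ n) = recip_char D x ^ n"
  by (induction n) (simp_all add: recip_char_mult)

text \<open>The sign of D makes the character odd: the Legendre symbols of -1 multiply to
  \<open>chi4 (odd_part D)\<close>, and the extra factor \<open>chi4 (- 1)\<close> is present
  exactly when this product is 1.\<close>

lemma recip_char_minus_1: "recip_char D (- 1) = - 1"
proof -
  have "(\<Prod>p\<in>prime_factors (nat \<bar>D\<bar>) - {2}. Legendre (- 1) (int p)) = chi4 (odd_part D)"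
    unfolding odd_part_def chi4_prod by (intro prod.cong refl Legendre_minus_one) (use odd_prime in blast)+
  moreover have "odd_part D mod 4 = 1 \<or> odd_part D mod 4 = 3" using odd_part_odd by presburger
  ultimately show ?thesis using odd_part_odd
    by (auto simp: recip_char_def chi4_def chi8_def)
qed

lemma recip_char_minus: "recip_char D (- x) = - recip_char D x"
  using recip_char_mult[of "-1" x] by (simp add: recip_char_minus_1)

lemma recip_char_periodic: "recip_char D (x + D) = recip_char D x"
proof -
  have "Legendre (x + D) (int p) = Legendre x (int p)" if "p \<in> prime_factors (nat \<bar>D\<bar>) - {2}" for p
    by (rule Legendre_cong) (use odd_prime[OF that] in \<open>auto simp: cong_iff_dvd_diff\<close>)
  hence 1: "(\<Prod>p\<in>prime_factors (nat \<bar>D\<bar>) - {2}. Legendre (x + D) (int p)) =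
     (\<Prod>p\<in>prime_factors (nat \<bar>D\<bar>) - {2}. Legendre x (int p))" by simp
  have 2: "chi8 (x + D) = chi8 x" if "8 dvd D"
  proof -
    obtain c where "D = 8 * c" using \<open>8 dvd D\<close> by (rule dvdE)
    hence "(x + D) mod 8 = x mod 8" "even (x + D) = even x" by simp_all
    thus ?thesis by (simp add: chi8_def)
  qed
  have 3: "chi4 (x + D) = chi4 x" if "odd_part D mod 4 = 1"
  proof -
    have "4 dvd D" using decomp
    proof (elim disjE conjE)
      assume "D = - 4 * odd_part D"
      hence "D = 4 * (- odd_part D)" by simp
      thus ?thesis by (metis dvd_triv_left)
    next
      assume "D = - 8 * odd_part D"
      hence "D = 4 * (- 2 * odd_part D)" by simp
      thus ?thesis by (metis dvd_triv_left)
    qed (use that in simp)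
    then obtain c where "D = 4 * c" by (rule dvdE)
    hence "(x + D) mod 4 = x mod 4" "even (x + D) = even x" by simp_all
    thus ?thesis by (simp add: chi4_def)
  qed
  show ?thesis using 1 2 3 by (simp add: recip_char_def)
qed

text \<open>Quadratic reciprocity and its supplements, one prime at a time; a prime dividing D makes
  both sides vanish. Multiplicativity then extends the equality to all positive integers.\<close>

lemma recip_char_prime:
  assumes q: "prime q"
  shows "recip_char D (int q) = kron_prime D q"
proof (cases "q = 2")
  case True
  have "(\<Prod>p\<in>prime_factors (nat \<bar>D\<bar>) - {2}. Legendre 2 (int p)) = chi8 (odd_part D)"
    unfolding odd_part_def chi8_prod by (intro prod.cong refl Legendre_two) (use odd_prime in blast)+
  hence R: "recip_char D 2 = chi8 (odd_part D) * (if odd_part D mod 4 = 1 then chi4 2 else 1)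
      * (if 8 dvd D then chi8 2 else 1)" by (simp add: recip_char_def)
  show ?thesis
  proof (cases "even D")
    case True': True
    have "odd_part D mod 4 = 1 \<or> 8 dvd D" using decomp
    proof (elim disjE conjE)
      assume "D = - odd_part D"
      thus ?thesis using True' odd_part_odd by (metis even_minus)
    next
      assume "D = - 8 * odd_part D"
      hence "D = 8 * (- odd_part D)" by simp
      thus ?thesis by (metis dvd_triv_left)
    qed simp
    thus ?thesis using R True True' by (auto simp: kron_prime_def chi4_def chi8_def)
  next
    case False
    have "D = - odd_part D \<and> odd_part D mod 4 = 3" using decomp
    proof (elim disjE)
      assume "D = - 8 * odd_part D"
      hence "D = 2 * (- 4 * odd_part D)" by simp
      thus ?thesis using False by (metis dvd_triv_left)
    next
      assume "D = - 4 * odd_part D \<and> odd_part D mod 4 = 1"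
      hence "D = 2 * (- 2 * odd_part D)" by simp
      thus ?thesis using False by (metis dvd_triv_left)
    qed simp
    hence D: "D = - odd_part D" "odd_part D mod 4 = 3" by auto
    have "odd_part D mod 8 = 3 \<or> odd_part D mod 8 = 7" using D(2) by presburger
    moreover have "D mod 8 = (- (odd_part D mod 8)) mod 8"
      using D(1) by (metis mod_minus_eq)
    ultimately have "odd_part D mod 8 = 7 \<longleftrightarrow> D mod 8 = 1 \<or> D mod 8 = 7" "odd_part D mod 8 \<noteq> 1"
      by (elim disjE; simp)+
    moreover have "\<not> 8 dvd D" using False by presburger
    ultimately show ?thesis using R True False D odd_part_odd by (simp add: kron_prime_def chi8_def)
  qed
next
  case False
  hence oq: "odd q" using q by (metis primes_dvd_imp_eq two_is_prime_nat)
  have q2: "2 < q" using odd_prime_gt_2 q oq by blast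
  show ?thesis
  proof (cases "int q dvd D")
    case True
    hence "q dvd nat \<bar>D\<bar>" by (simp only: dvd_nat_abs_iff)
    moreover have "nat \<bar>D\<bar> \<noteq> 0" using neg by simp
    ultimately have "q \<in> prime_factors (nat \<bar>D\<bar>) - {2}" using q False by (simp add: prime_factorsI)
    moreover have "Legendre (int q) (int q) = 0" by (simp add: Legendre_def cong_def)
    ultimately have "(\<Prod>p\<in>prime_factors (nat \<bar>D\<bar>) - {2}. Legendre (int q) (int p)) = 0"
      by (intro prod_zero) auto
    moreover have "Legendre D (int q) = 0" using True by (simp add: Legendre_def cong_0_iff)
    ultimately show ?thesis using False by (simp add: recip_char_def kron_prime_def)
  next
    case ndvd: False
    let ?P = "prime_factors (nat \<bar>D\<bar>) - {2}"
    let ?m = "odd_part D"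
    let ?L = "\<lambda>x. Legendre x (int q)"
    let ?R = "\<Prod>p\<in>?P. Legendre (int q) (int p)"
    have "?L ?m = (\<Prod>p\<in>?P. ?L (int p))"
      unfolding odd_part_def by (rule Legendre_prod[OF q q2])
    also have "\<dots> = (\<Prod>p\<in>?P. Legendre (int q) (int p) * (if chi4 (int q) = 1 then 1 else chi4 (int p)))"
    proof (intro prod.cong refl Legendre_swap)
      fix p assume "p \<in> ?P"
      from odd_prime[OF this] show "prime p" "odd p" "prime q" "odd q" "p \<noteq> q" using q oq ndvd by auto
    qed
    also have "\<dots> = ?R * (if chi4 (int q) = 1 then 1 else chi4 ?m)"
      unfolding odd_part_def chi4_prod prod.distrib by (cases "chi4 (int q) = 1") auto
    finally have Lm: "?L ?m = ?R * (if chi4 (int q) = 1 then 1 else chi4 ?m)" .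
    have c4: "chi4 (int q) = 1 \<or> chi4 (int q) = - 1" using oq by (simp add: chi4_def)
    have c8: "chi8 (int q) * chi8 (int q) = 1" using oq by (simp add: chi8_def)
    have m4: "chi4 ?m = (if ?m mod 4 = 1 then 1 else - 1)" using odd_part_odd by (simp add: chi4_def)
    have Lm': "?L (- 1 * ?m) = ?R * (if ?m mod 4 = 1 then chi4 (int q) else 1)"
      unfolding Legendre_mult[OF q q2] Lm Legendre_minus_one[OF q oq] m4 using c4 by auto
    have L4: "?L (2 * 2) = 1"
      unfolding Legendre_mult[OF q q2] Legendre_two[OF q oq] by (rule c8)
    have kq: "kron_prime D q = ?L D" using False by (simp add: kron_prime_def)
    from decomp show ?thesis
    proof (elim disjE conjE)
      assume D: "D = - ?m" "?m mod 4 = 3"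
      hence "?L D = ?L (- 1 * ?m)" by simp
      moreover have "\<not> 8 dvd D"
      proof
        assume "8 dvd D"
        hence "8 dvd 4 * ?m" proof -
          have "8 dvd - D" using \<open>8 dvd D\<close> by simp
          hence "8 dvd 4 * (- D)" by (rule dvd_mult)
          moreover have "4 * (- D) = 4 * ?m" using D(1) by simp
          ultimately show ?thesis by metis
        qed
        thus False using odd_part_odd by presburger
      qed
      ultimately show ?thesis using Lm' D kq by (simp add: recip_char_def)
    next
      assume D: "D = - 4 * ?m" "?m mod 4 = 1"
      hence "?L D = ?L ((2 * 2) * (- 1 * ?m))" by simp
      also have "\<dots> = ?L (- 1 * ?m)" by (subst Legendre_mult[OF q q2]) (simp only: L4 mult_1_left)
      finally have "?L D = ?L (- 1 * ?m)" .
      moreover have "\<not> 8 dvd D"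
      proof
        assume "8 dvd D"
        hence "8 dvd 4 * ?m" proof -
          have "8 dvd - D" using \<open>8 dvd D\<close> by simp
          moreover have "- D = 4 * ?m" using D(1) by simp
          ultimately show ?thesis by simp
        qed
        thus False using odd_part_odd by presburger
      qed
      ultimately show ?thesis using Lm' D kq by (simp add: recip_char_def)
    next
      assume D: "D = - 8 * ?m"
      hence "?L D = ?L ((2 * 2) * (2 * (- 1 * ?m)))" by simp
      also have "\<dots> = ?L 2 * ?L (- 1 * ?m)"
        by (subst Legendre_mult[OF q q2], subst Legendre_mult[OF q q2, of 2 "- 1 * ?m"]) (simp only: L4 mult_1_left)
      finally have "?L D = chi8 (int q) * ?L (- 1 * ?m)" by (simp only: Legendre_two[OF q oq])
      moreover have "8 dvd D" using D by presburger
      ultimately show ?thesis using Lm' kq by (simp add: recip_char_def)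
    qed
  qed
qed

lemma kronecker_eq_recip_char:
  assumes "k \<noteq> 0"
  shows "kronecker D k = recip_char D (int k)"
proof -
  have "recip_char D (int k) = recip_char D (int (\<Prod>p\<in>prime_factors k. p ^ multiplicity p k))"
    using assms prime_factorization_nat[of k] by simp
  also have "\<dots> = (\<Prod>p\<in>prime_factors k. recip_char D (int p) ^ multiplicity p k)"
    by (simp add: recip_char_prod recip_char_power)
  also have "\<dots> = (\<Prod>p\<in>prime_factors k. kron_prime D p ^ multiplicity p k)"
    by (intro prod.cong refl) (metis recip_char_prime in_prime_factors_imp_prime)
  finally show ?thesis using assms by (simp add: kronecker_def)
qed

lemma kronecker_periodic: "kronecker D (Suc (k + nat (- D))) = kronecker D (Suc k)"
proof -
  have "recip_char D (int (Suc (k + nat (- D)))) = recip_char D (int (Suc (k + nat (- D))) + D)"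
    by (rule recip_char_periodic[symmetric])
  also have "int (Suc (k + nat (- D))) + D = int (Suc k)" using neg by simp
  finally show ?thesis by (simp add: kronecker_eq_recip_char)
qed

text \<open>The character is odd and periodic, so the terms at k and at |D| - k cancel.\<close>

lemma kronecker_sum_period: "(\<Sum>k<nat (- D). kronecker D (Suc k)) = 0"
proof -
  define N where "N = nat (- D)"
  have "(\<Sum>k<N. kronecker D (Suc k)) = (\<Sum>k<N. recip_char D (int k + 1))"
    by (simp add: kronecker_eq_recip_char add.commute)
  also have "\<dots> = (\<Sum>k<N. - recip_char D (int (N - Suc k)))"
  proof (rule sum.cong)
    fix k assume k: "k \<in> {..<N}"
    have "recip_char D (int k + 1) = recip_char D (int k + 1 + D)" by (rule recip_char_periodic[symmetric])
    also have "int k + 1 + D = - int (N - Suc k)" using k neg by (auto simp: N_def of_nat_diff)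
    finally show "recip_char D (int k + 1) = - recip_char D (int (N - Suc k))" by (simp add: recip_char_minus)
  qed auto
  also have "\<dots> = - (\<Sum>k<N. recip_char D (int k))"
    using sum.nat_diff_reindex[of "\<lambda>k. recip_char D (int k)" N] by (simp add: sum_negf)
  also have "(\<Sum>k<N. recip_char D (int k)) = (\<Sum>k<N. recip_char D (int k + 1))"
  proof -
    have "(\<Sum>k<Suc N. recip_char D (int k)) = recip_char D (int 0) + (\<Sum>k<N. recip_char D (int (Suc k)))"
      by (rule sum.lessThan_Suc_shift)
    moreover have "recip_char D (int N) = recip_char D 0"
      using recip_char_periodic[of "int N"] neg by (simp add: N_def)
    ultimately show ?thesis by (simp add: add.commute)
  qed
  also have "\<dots> = (\<Sum>k<N. kronecker D (Suc k))"
    by (simp add: kronecker_eq_recip_char add.commute)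
  finally show ?thesis by (simp add: N_def)
qed

end

section \<open>Roots of quadratic polynomials modulo k\<close>

definition count_mod :: "(int \<Rightarrow> bool) \<Rightarrow> nat \<Rightarrow> nat" where
  "count_mod P k = card {x \<in> {0..<int k}. P x}"

definition respects_mod :: "nat \<Rightarrow> (int \<Rightarrow> bool) \<Rightarrow> bool" where
  "respects_mod k P \<longleftrightarrow> (\<forall>x y. [x = y] (mod int k) \<longrightarrow> P x = P y)"

lemma respects_modD: "respects_mod k P \<Longrightarrow> [x = y] (mod int k) \<Longrightarrow> P x = P y"
  by (auto simp: respects_mod_def)

lemma respects_mod_mod: "respects_mod k P \<Longrightarrow> P (x mod int k) = P x"
  by (erule respects_modD) (simp add: cong_def)

text \<open>A map that is injective on residues modulo k permutes them.\<close>

lemma count_mod_reindex: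
  assumes k: "k > 0" and P: "respects_mod k P"
    and inj: "\<And>x y. [f x = f y] (mod int k) \<Longrightarrow> [x = y] (mod int k)"
  shows "count_mod (\<lambda>x. P (f x)) k = count_mod P k"
proof -
  let ?h = "\<lambda>x. f x mod int k"
  have i: "inj_on ?h {0..<int k}"
  proof (rule inj_onI)
    fix x y assume "x \<in> {0..<int k}" "y \<in> {0..<int k}" "?h x = ?h y"
    thus "x = y" using inj[of x y] by (simp add: cong_def)
  qed
  have sub: "?h ` {0..<int k} \<subseteq> {0..<int k}" using k by auto
  have surj: "?h ` {0..<int k} = {0..<int k}"
    by (rule endo_inj_surj[OF _ sub i]) simp
  have "{y \<in> {0..<int k}. P y} = ?h ` {x \<in> {0..<int k}. P (f x)}"
  proof (intro equalityI subsetI)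
    fix y assume y: "y \<in> {y \<in> {0..<int k}. P y}"
    hence "y \<in> ?h ` {0..<int k}" using surj by simp
    then obtain x where "x \<in> {0..<int k}" "y = ?h x" by blast
    thus "y \<in> ?h ` {x \<in> {0..<int k}. P (f x)}" using y respects_mod_mod[OF P] by auto
  qed (use k respects_mod_mod[OF P] in auto)
  moreover have "card (?h ` {x \<in> {0..<int k}. P (f x)}) = card {x \<in> {0..<int k}. P (f x)}"
    by (rule card_image, rule inj_on_subset[OF i]) auto
  ultimately show ?thesis by (simp add: count_mod_def)
qed

lemma count_mod_shift:
  assumes "k > 0" "respects_mod k P"
  shows "count_mod (\<lambda>x. P (x + s)) k = count_mod P k"
  by (rule count_mod_reindex[OF assms]) (simp add: cong_add_rcancel)

lemma count_mod_scale:
  assumes "k > 0" "respects_mod k P" "coprime u (int k)"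
  shows "count_mod (\<lambda>x. P (u * x)) k = count_mod P k"
  by (rule count_mod_reindex[OF assms(1,2)]) (use assms(3) in \<open>simp add: cong_mult_lcancel\<close>)

lemma count_mod_crt:
  assumes ab: "coprime a b" "a > 0" "b > 0" and P: "respects_mod a P" and Q: "respects_mod b Q"
  shows "count_mod (\<lambda>x. P x \<and> Q x) (a * b) = count_mod P a * count_mod Q b"
proof -
  let ?h = "\<lambda>x. (x mod int a, x mod int b)"
  have "bij_betw ?h {x \<in> {0..<int (a * b)}. P x \<and> Q x} ({x \<in> {0..<int a}. P x} \<times> {x \<in> {0..<int b}. Q x})"
  proof (rule bij_betwI')
    fix x y assume xy: "x \<in> {x \<in> {0..<int (a * b)}. P x \<and> Q x}" "y \<in> {x \<in> {0..<int (a * b)}. P x \<and> Q x}"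
    show "(?h x = ?h y) = (x = y)"
    proof
      assume "?h x = ?h y"
      hence "[x = y] (mod int a)" "[x = y] (mod int b)" by (auto simp: cong_def)
      hence "[x = y] (mod int a * int b)" using ab by (intro coprime_cong_mult) auto
      thus "x = y" using xy by (simp add: cong_def)
    qed auto
  next
    fix x assume "x \<in> {x \<in> {0..<int (a * b)}. P x \<and> Q x}"
    thus "?h x \<in> {x \<in> {0..<int a}. P x} \<times> {x \<in> {0..<int b}. Q x}"
      using ab respects_mod_mod[OF P] respects_mod_mod[OF Q] by auto
  next
    fix y assume "y \<in> {x \<in> {0..<int a}. P x} \<times> {x \<in> {0..<int b}. Q x}"
    then obtain u v where y: "y = (u, v)" "0 \<le> u" "u < int a" "P u" "0 \<le> v" "v < int b" "Q v" by auto
    obtain x where x: "[x = u] (mod int a)" "[x = v] (mod int b)"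
      using binary_chinese_remainder_int[of "int a" "int b" u v] ab by auto
    define z where "z = x mod int (a * b)"
    have z: "[z = u] (mod int a)" "[z = v] (mod int b)"
      using x unfolding z_def cong_def by (simp_all add: mod_mod_cancel)
    have "P z" "Q z" using respects_modD[OF P z(1)] respects_modD[OF Q z(2)] y by auto
    moreover have "z \<in> {0..<int (a * b)}" unfolding z_def using ab by (simp add: pos_mod_bound del: of_nat_mult)
    moreover have "z mod int a = u" "z mod int b = v" using z y by (auto simp: cong_def)
    ultimately show "\<exists>x\<in>{x \<in> {0..<int (a * b)}. P x \<and> Q x}. y = ?h x" using y by auto
  qed
  thus ?thesis unfolding count_mod_def by (simp add: bij_betw_same_card card_cartesian_product)
qed

lemma count_mod_period:
  assumes "j > 0" "respects_mod j P"
  shows "count_mod P (j * t) = t * count_mod P j"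
proof (induction t)
  case (Suc t)
  have "int (j * Suc t) = int (j * t) + int j" "0 \<le> int (j * t)" by simp_all
  hence un: "{x \<in> {0..<int (j * Suc t)}. P x} = {x \<in> {0..<int (j * t)}. P x} \<union> {x \<in> {int (j * t)..<int (j * t) + int j}. P x}"
    by (auto simp del: of_nat_mult)
  have "{x \<in> {0..<int (j * t)}. P x} \<inter> {x \<in> {int (j * t)..<int (j * t) + int j}. P x} = {}"
    by auto
  moreover have "finite {x \<in> {0..<int (j * t)}. P x}"
    by (rule finite_subset[of _ "{0..<int (j * t)}"]) auto
  moreover have "finite {x \<in> {int (j * t)..<int (j * t) + int j}. P x}"
    by (rule finite_subset[of _ "{int (j * t)..<int (j * t) + int j}"]) auto
  ultimately have "card {x \<in> {0..<int (j * Suc t)}. P x} =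
      card {x \<in> {0..<int (j * t)}. P x} + card {x \<in> {int (j * t)..<int (j * t) + int j}. P x}"
    unfolding un by (intro card_Un_disjoint)
  also have "{x \<in> {int (j * t)..<int (j * t) + int j}. P x} = (\<lambda>x. x + int (j * t)) ` {x \<in> {0..<int j}. P x}"
  proof (intro equalityI subsetI)
    fix x assume x: "x \<in> {x \<in> {int (j * t)..<int (j * t) + int j}. P x}"
    have "P (x - int (j * t)) = P x"
      by (rule respects_modD[OF assms(2)]) (simp add: cong_iff_dvd_diff)
    thus "x \<in> (\<lambda>x. x + int (j * t)) ` {x \<in> {0..<int j}. P x}"
      using x by (intro image_eqI[of _ _ "x - int (j * t)"]) auto
  next
    fix x assume "x \<in> (\<lambda>x. x + int (j * t)) ` {x \<in> {0..<int j}. P x}"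
    then obtain y where y: "y \<in> {0..<int j}" "P y" "x = y + int (j * t)" by auto
    have "P (y + int (j * t)) = P y"
      by (rule respects_modD[OF assms(2)]) (simp add: cong_iff_dvd_diff)
    thus "x \<in> {x \<in> {int (j * t)..<int (j * t) + int j}. P x}" using y by auto
  qed
  also have "card \<dots> = card {x \<in> {0..<int j}. P x}" by (rule card_image) (auto simp: inj_on_def)
  finally show ?case using Suc.IH by (simp add: count_mod_def)
qed (simp add: count_mod_def)

lemma count_mod_multiples:
  assumes "p > 0" "\<And>x. P x \<Longrightarrow> int p dvd x"
  shows "count_mod P (p * k) = count_mod (\<lambda>y. P (int p * y)) k"
proof -
  have "{x \<in> {0..<int (p * k)}. P x} = (\<lambda>y. int p * y) ` {y \<in> {0..<int k}. P (int p * y)}"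
  proof (intro equalityI subsetI)
    fix x assume x: "x \<in> {x \<in> {0..<int (p * k)}. P x}"
    then obtain y where y: "x = int p * y" using assms(2)[of x] by auto
    have "0 \<le> y" "y < int k" using x y assms(1) by (auto simp: zero_le_mult_iff)
    thus "x \<in> (\<lambda>y. int p * y) ` {y \<in> {0..<int k}. P (int p * y)}" using x y by auto
  qed (use assms(1) in auto)
  moreover have "card ((\<lambda>y. int p * y) ` {y \<in> {0..<int k}. P (int p * y)}) = card {y \<in> {0..<int k}. P (int p * y)}"
    by (rule card_image) (use assms(1) in \<open>auto simp: inj_on_def\<close>)
  ultimately show ?thesis by (simp add: count_mod_def)
qed

lemma count_mod_cong: "(\<And>x. P x = Q x) \<Longrightarrow> count_mod P k = count_mod Q k"
  by (simp add: count_mod_def)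

section \<open>Roots of x^2 + B x + C modulo k\<close>

definition quad_roots :: "int \<Rightarrow> int \<Rightarrow> nat \<Rightarrow> nat" where
  "quad_roots B C k = count_mod (\<lambda>x. int k dvd x\<^sup>2 + B * x + C) k"

lemma respects_mod_quad: "d dvd k \<Longrightarrow> respects_mod k (\<lambda>x. int d dvd x\<^sup>2 + B * x + C)"
  unfolding respects_mod_def
proof (intro allI impI)
  fix x y assume "d dvd k" "[x = y] (mod int k)"
  hence "[x = y] (mod int d)" using cong_dvd_modulus[of x y "int k" "int d"] by simp
  hence "[x\<^sup>2 + B * x + C = y\<^sup>2 + B * y + C] (mod int d)" by (intro cong_add cong_mult cong_pow cong_refl)
  thus "(int d dvd x\<^sup>2 + B * x + C) = (int d dvd y\<^sup>2 + B * y + C)" by (rule cong_dvd_iff)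
qed

text \<open>B and B' have the same parity, so x -> x + s with B' = B + 2 s carries one polynomial
  into the other without dividing by 2 modulo k. Working with x^2 + B x + C rather than with square
  roots of the discriminant keeps the prime 2 on the same footing as the others.\<close>

lemma quad_roots_disc_eq:
  assumes "B\<^sup>2 - 4 * C = B'\<^sup>2 - 4 * C'" "k > 0"
  shows "quad_roots B C k = quad_roots B' C' k"
proof -
  have "B\<^sup>2 - B'\<^sup>2 = 4 * (C - C')" using assms(1) by simp
  hence "even (B\<^sup>2 - B'\<^sup>2)" by simp
  hence "even B = even B'" by simp
  hence "even (B' - B)" by simp
  then obtain s where s: "B' - B = 2 * s" by (rule evenE)
  hence B': "B' = B + 2 * s" by simp
  have "4 * C' = 4 * (s\<^sup>2 + B * s + C)" using assms(1) unfolding B' by (simp add: power2_eq_square algebra_simps)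
  hence C': "C' = s\<^sup>2 + B * s + C" by simp
  have "quad_roots B C k = count_mod (\<lambda>x. int k dvd (x + s)\<^sup>2 + B * (x + s) + C) k"
    unfolding quad_roots_def
    by (rule count_mod_shift[symmetric, where P = "\<lambda>x. int k dvd x\<^sup>2 + B * x + C"])
       (use assms(2) in \<open>auto intro: respects_mod_quad\<close>)
  also have "\<dots> = quad_roots B' C' k"
    unfolding quad_roots_def by (rule count_mod_cong) (simp add: B' C' power2_eq_square algebra_simps)
  finally show ?thesis .
qed

lemma quad_roots_mult:
  assumes "coprime a b" "a > 0" "b > 0"
  shows "quad_roots B C (a * b) = quad_roots B C a * quad_roots B C b"
proof -
  have "quad_roots B C (a * b) = count_mod (\<lambda>x. int a dvd x\<^sup>2 + B * x + C \<and> int b dvd x\<^sup>2 + B * x + C) (a * b)"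
    unfolding quad_roots_def
  proof (rule count_mod_cong)
    fix x
    show "(int (a * b) dvd x\<^sup>2 + B * x + C) = (int a dvd x\<^sup>2 + B * x + C \<and> int b dvd x\<^sup>2 + B * x + C)"
      using divides_mult[of "int a" "x\<^sup>2 + B * x + C" "int b"] assms(1)
        dvd_mult_left[of "int a" "int b"] dvd_mult_right[of "int a" "int b"] by auto
  qed
  thus ?thesis using count_mod_crt[OF assms respects_mod_quad respects_mod_quad] by (simp add: quad_roots_def)
qed

lemma quad_roots_1: "quad_roots B C 1 = 1"
proof -
  have "{x \<in> {0..<int 1}. int 1 dvd x\<^sup>2 + B * x + C} = {0}" by auto
  thus ?thesis unfolding quad_roots_def count_mod_def by simp
qed

lemma quad_scaled:
  "(int p * x)\<^sup>2 + int p * B * (int p * x) + (int p)\<^sup>2 * C = (int p)\<^sup>2 * (x\<^sup>2 + B * x + C)"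
  by (simp add: power2_eq_square algebra_simps)

lemma prime_dvd_quad_scaled:
  assumes "prime p" "int p dvd x\<^sup>2 + int p * B * x + (int p)\<^sup>2 * C"
  shows "int p dvd x"
proof -
  have "int p dvd int p * (B * x + int p * C)" by simp
  moreover have "x\<^sup>2 + int p * B * x + (int p)\<^sup>2 * C = x\<^sup>2 + int p * (B * x + int p * C)"
    by (simp add: power2_eq_square algebra_simps)
  ultimately have "int p dvd x\<^sup>2" using assms(2) by (simp add: dvd_add_left_iff)
  thus ?thesis using assms(1) by (simp add: prime_dvd_power_iff)
qed

text \<open>Every root is p y with y a root modulo t of the unscaled polynomial, and y runs through
  residues modulo p t, which accounts for the factor p.\<close>

lemma quad_roots_scaled_square:
  assumes p: "prime p" and t: "t > 0"
  shows "quad_roots (int p * B) ((int p)\<^sup>2 * C) (p\<^sup>2 * t) = p * quad_roots B C t"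
proof -
  have p0: "p > 0" using p by (simp add: prime_gt_0_nat)
  let ?P = "\<lambda>x. int (p\<^sup>2 * t) dvd x\<^sup>2 + int p * B * x + (int p)\<^sup>2 * C"
  have "quad_roots (int p * B) ((int p)\<^sup>2 * C) (p\<^sup>2 * t) = count_mod ?P (p * (p * t))"
    by (simp add: quad_roots_def power2_eq_square mult.assoc)
  also have "\<dots> = count_mod (\<lambda>y. ?P (int p * y)) (p * t)"
  proof (rule count_mod_multiples[OF p0])
    fix x assume "?P x"
    moreover have "int p dvd int (p\<^sup>2 * t)" by (simp add: power2_eq_square)
    ultimately show "int p dvd x" using prime_dvd_quad_scaled[OF p] dvd_trans by blast
  qed
  also have "\<dots> = count_mod (\<lambda>y. int t dvd y\<^sup>2 + B * y + C) (t * p)"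
    unfolding quad_scaled using p0 by (simp add: mult.commute)
  also have "\<dots> = p * quad_roots B C t"
    unfolding quad_roots_def by (rule count_mod_period[OF t respects_mod_quad]) simp
  finally show ?thesis .
qed

text \<open>With a single p in the modulus the roots are again multiples of p, but then the
  condition at p holds automatically, so nothing of the p-part survives.\<close>

lemma quad_roots_scaled_once:
  assumes p: "prime p" and t: "t > 0" "\<not> p dvd t"
  shows "quad_roots (int p * B) ((int p)\<^sup>2 * C) (p * t) = quad_roots B C t"
proof -
  have p0: "p > 0" using p by (simp add: prime_gt_0_nat)
  let ?P = "\<lambda>x. int (p * t) dvd x\<^sup>2 + int p * B * x + (int p)\<^sup>2 * C"
  have "coprime t p" using p t(2) by (meson coprime_commute prime_imp_coprime)
  hence cop: "coprime (int t) (int p)" by simp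
  have "count_mod ?P (p * t) = count_mod (\<lambda>y. ?P (int p * y)) t"
  proof (rule count_mod_multiples[OF p0])
    fix x assume "?P x"
    moreover have "int p dvd int (p * t)" by simp
    ultimately show "int p dvd x" using prime_dvd_quad_scaled[OF p] dvd_trans by blast
  qed
  also have "\<dots> = quad_roots B C t" unfolding quad_roots_def
  proof (rule count_mod_cong)
    fix y
    have "int (p * t) dvd (int p)\<^sup>2 * (y\<^sup>2 + B * y + C) \<longleftrightarrow> int p * int t dvd int p * (int p * (y\<^sup>2 + B * y + C))"
      by (simp add: power2_eq_square mult.assoc)
    also have "\<dots> \<longleftrightarrow> int t dvd int p * (y\<^sup>2 + B * y + C)" using p0 by (subst dvd_mult_cancel_left) auto
    also have "\<dots> \<longleftrightarrow> int t dvd y\<^sup>2 + B * y + C" by (rule coprime_dvd_mult_right_iff[OF cop])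
    finally show "?P (int p * y) = (int t dvd y\<^sup>2 + B * y + C)" unfolding quad_scaled .
  qed
  finally show ?thesis by (simp add: quad_roots_def)
qed

lemma quad_roots_scaled_coprime:
  assumes p: "prime p" and t: "t > 0" "\<not> p dvd t"
  shows "quad_roots (int p * B) ((int p)\<^sup>2 * C) t = quad_roots B C t"
proof -
  have "coprime t p" using p t(2) by (meson coprime_commute prime_imp_coprime)
  hence cop: "coprime (int t) (int p)" by simp
  let ?P = "\<lambda>x. int t dvd x\<^sup>2 + int p * B * x + (int p)\<^sup>2 * C"
  have "count_mod ?P t = count_mod (\<lambda>x. ?P (int p * x)) t"
    by (rule count_mod_scale[OF t(1) _ , symmetric, where P = ?P])
       (use cop in \<open>auto intro: respects_mod_quad simp: coprime_commute\<close>)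
  also have "\<dots> = quad_roots B C t" unfolding quad_roots_def
  proof (rule count_mod_cong)
    fix y
    have "coprime (int t) ((int p)\<^sup>2)" using cop by simp
    thus "?P (int p * y) = (int t dvd y\<^sup>2 + B * y + C)"
      unfolding quad_scaled by (rule coprime_dvd_mult_right_iff)
  qed
  finally show ?thesis by (simp add: quad_roots_def)
qed

text \<open>The symbol at 2 is read off modulo 8, and for odd B the discriminant modulo 8 records
  exactly the parity of C.\<close>

lemma quad_roots_two:
  "int (quad_roots B C 2) = 1 + kron_prime (B\<^sup>2 - 4 * C) 2"
proof -
  have s: "{0..<int 2} = {0, 1}" by auto
  have r: "quad_roots B C 2 = card {x \<in> {0, 1}. 2 dvd x\<^sup>2 + B * x + C}"
    unfolding quad_roots_def count_mod_def s by simp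
  show ?thesis
  proof (cases "even B")
    case True
    have "{x \<in> {0, 1::int}. 2 dvd x\<^sup>2 + B * x + C} = (if even C then {0} else {1})"
      using True by auto
    moreover have "even (B\<^sup>2 - 4 * C)" using True by simp
    ultimately show ?thesis unfolding r by (simp add: kron_prime_def)
  next
    case False
    have "{x \<in> {0, 1::int}. 2 dvd x\<^sup>2 + B * x + C} = (if even C then {0, 1} else {})"
      using False by auto
    moreover have "odd (B\<^sup>2 - 4 * C)" using False by simp
    moreover have "(B\<^sup>2 - 4 * C) mod 8 = 1 \<or> (B\<^sup>2 - 4 * C) mod 8 = 7 \<longleftrightarrow> even C"
    proof -
      have "B\<^sup>2 mod 8 = 1" by (rule square_mod_8) (use False in auto)
      then obtain b where b: "B\<^sup>2 = 8 * b + 1" by (metis mult_div_mod_eq)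
      show ?thesis unfolding b by presburger
    qed
    ultimately show ?thesis unfolding r by (simp add: kron_prime_def)
  qed
qed

lemma count_square_roots:
  assumes p: "prime p" "odd p"
  shows "int (count_mod (\<lambda>y. int p dvd y\<^sup>2 - D) p) = 1 + Legendre D (int p)"
proof (cases "int p dvd D")
  case True
  have "int p dvd y\<^sup>2 - D \<longleftrightarrow> int p dvd y" for y
    using True p(1) by (simp add: dvd_diff_left_iff prime_dvd_power_iff)
  moreover have "{y \<in> {0..<int p}. int p dvd y} = {0}"
    using p(1) by (auto simp: prime_gt_0_nat le_less dest: zdvd_not_zless)
  ultimately have "{y \<in> {0..<int p}. int p dvd y\<^sup>2 - D} = {0}" by simp
  thus ?thesis using True by (simp add: count_mod_def Legendre_def cong_0_iff)
next
  case False
  have p2: "2 < p" using p odd_prime_gt_2 by auto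
  show ?thesis
  proof (cases "QuadRes (int p) D")
    case True
    then obtain z where z: "[z\<^sup>2 = D] (mod int p)" by (auto simp: QuadRes_def)
    define y where "y = z mod int p"
    have y: "[y\<^sup>2 = D] (mod int p)" using z unfolding y_def by (simp add: cong_def power_mod)
    have y0: "0 \<le> y" "y < int p" using p2 by (auto simp: y_def)
    have yn: "\<not> int p dvd y"
    proof
      assume "int p dvd y"
      hence "int p dvd y\<^sup>2" by (simp add: power2_eq_square)
      thus False using y False cong_dvd_iff by blast
    qed
    hence "y \<noteq> 0" by auto
    have neq: "y \<noteq> int p - y" using p(2) by presburger
    have "{x \<in> {0..<int p}. int p dvd x\<^sup>2 - D} = {y, int p - y}"
    proof (intro equalityI subsetI)
      fix x assume x: "x \<in> {x \<in> {0..<int p}. int p dvd x\<^sup>2 - D}"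
      hence "[x\<^sup>2 = D] (mod int p)" by (simp add: cong_iff_dvd_diff)
      hence "[x\<^sup>2 = y\<^sup>2] (mod int p)" using y cong_sym cong_trans by blast
      hence "int p dvd (x - y) * (x + y)" by (simp add: cong_iff_dvd_diff power2_eq_square algebra_simps)
      hence "int p dvd x - y \<or> int p dvd x + y" using p(1) by (simp add: prime_dvd_mult_iff)
      thus "x \<in> {y, int p - y}"
      proof
        assume "int p dvd x - y"
        hence "[x = y] (mod int p)" by (simp add: cong_iff_dvd_diff)
        thus ?thesis using x y0 by (simp add: cong_def)
      next
        assume "int p dvd x + y"
        then obtain c where c: "x + y = int p * c" by auto
        have "0 < int p * c" "int p * c < int p * 2" unfolding c[symmetric] using x y0 \<open>y \<noteq> 0\<close> by auto
        hence "0 < c" "c < 2" using p2 by (simp_all add: zero_less_mult_iff mult_less_cancel_left)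
        hence "c = 1" by simp
        thus ?thesis using c by simp
      qed
    next
      fix x assume "x \<in> {y, int p - y}"
      thus "x \<in> {x \<in> {0..<int p}. int p dvd x\<^sup>2 - D}"
      proof
        assume "x = y"
        thus ?thesis using y y0 by (simp add: cong_iff_dvd_diff)
      next
        assume "x \<in> {int p - y}"
        hence x: "x = int p - y" by simp
        have "x\<^sup>2 - D = (y\<^sup>2 - D) + int p * (int p - 2 * y)" by (simp add: x power2_eq_square algebra_simps)
        moreover have "int p dvd y\<^sup>2 - D" using y by (simp add: cong_iff_dvd_diff)
        ultimately have "int p dvd x\<^sup>2 - D" by (simp only: dvd_add dvd_triv_left)
        thus ?thesis using x y0 \<open>y \<noteq> 0\<close> by simp
      qed
    qed
    moreover have "Legendre D (int p) = 1" using True False by (simp add: Legendre_def cong_0_iff)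
    ultimately show ?thesis using neq by (simp add: count_mod_def)
  next
    case nq: False
    have "{x \<in> {0..<int p}. int p dvd x\<^sup>2 - D} = {}"
      using nq by (auto simp: QuadRes_def cong_iff_dvd_diff)
    hence "count_mod (\<lambda>y. int p dvd y\<^sup>2 - D) p = 0" unfolding count_mod_def by (simp only: card.empty)
    thus ?thesis using nq False by (simp add: Legendre_def cong_0_iff)
  qed
qed

lemma quad_roots_prime:
  assumes p: "prime p"
  shows "int (quad_roots B C p) = 1 + kron_prime (B\<^sup>2 - 4 * C) p"
proof (cases "p = 2")
  case True
  thus ?thesis using quad_roots_two by simp
next
  case False
  hence op: "odd p" using p by (metis primes_dvd_imp_eq two_is_prime_nat)
  have p0: "p > 0" using p by (simp add: prime_gt_0_nat)
  let ?D = "B\<^sup>2 - 4 * C"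
  let ?P = "\<lambda>y. int p dvd y\<^sup>2 - ?D"
  have "?P = (\<lambda>x. int p dvd x\<^sup>2 + 0 * x + - ?D)" by (simp add: fun_eq_iff algebra_simps)
  hence resp: "respects_mod p ?P" using respects_mod_quad[of p p 0 "- ?D"] by simp
  have c2: "coprime (int p) 2" using op by simp
  hence c4: "coprime (int p) 4" using coprime_mult_right_iff[of "int p" 2 2] by simp
  have "quad_roots B C p = count_mod (\<lambda>x. ?P (2 * x + B)) p"
    unfolding quad_roots_def
  proof (rule count_mod_cong)
    fix x
    have "(2 * x + B)\<^sup>2 - ?D = 4 * (x\<^sup>2 + B * x + C)" by (simp add: power2_eq_square algebra_simps)
    thus "(int p dvd x\<^sup>2 + B * x + C) = ?P (2 * x + B)"
      by (simp only: coprime_dvd_mult_right_iff[OF c4])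
  qed
  also have "\<dots> = count_mod ?P p"
  proof (rule count_mod_reindex[OF p0 resp])
    fix x y assume "[2 * x + B = 2 * y + B] (mod int p)"
    hence "[2 * x = 2 * y] (mod int p)" by (simp add: cong_add_rcancel)
    thus "[x = y] (mod int p)" using c2 by (simp add: cong_mult_lcancel coprime_commute)
  qed
  finally show ?thesis using count_square_roots[OF p op, of ?D] False by (simp add: kron_prime_def)
qed

text \<open>At a root the square of the derivative 2 x + B is the discriminant modulo p, hence the
  derivative is a unit, also for p = 2, and each root lifts uniquely.\<close>

lemma quad_roots_hensel:
  assumes p: "prime p" and nd: "\<not> int p dvd B\<^sup>2 - 4 * C" and j: "j > 0"
  shows "quad_roots B C (p ^ Suc j) = quad_roots B C (p ^ j)"
proof -
  define k where "k = p ^ j"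
  define g where "g = (\<lambda>x. x\<^sup>2 + B * x + C)"
  have p0: "p > 0" using p by (simp add: prime_gt_0_nat)
  have k0: "k > 0" using p0 by (simp add: k_def)
  have pk: "int p dvd int k" using j by (simp add: k_def)
  have pint: "prime (int p)" using p by simp
  have exp: "g (x + t * int k) = g x + int k * (t * (2 * x + B) + t * t * int k)" for x t
    by (simp add: g_def power2_eq_square algebra_simps)
  have unit: "\<not> int p dvd 2 * x + B" if "int p dvd g x" for x
  proof
    assume "int p dvd 2 * x + B"
    hence "int p dvd (2 * x + B)\<^sup>2" by (simp add: power2_eq_square)
    moreover have "B\<^sup>2 - 4 * C = (2 * x + B)\<^sup>2 - 4 * g x" by (simp add: g_def power2_eq_square algebra_simps)
    moreover have "int p dvd 4 * g x" using that by simp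
    ultimately show False using nd by (metis dvd_diff)
  qed
  have "bij_betw (\<lambda>x. x mod int k) {x \<in> {0..<int (p * k)}. int (p * k) dvd g x} {x \<in> {0..<int k}. int k dvd g x}"
  proof (rule bij_betwI')
    fix x y
    assume x: "x \<in> {x \<in> {0..<int (p * k)}. int (p * k) dvd g x}"
      and y: "y \<in> {x \<in> {0..<int (p * k)}. int (p * k) dvd g x}"
    show "(x mod int k = y mod int k) = (x = y)"
    proof
      assume "x mod int k = y mod int k"
      hence "int k dvd y - x" by (simp add: mod_eq_dvd_iff dvd_diff_commute)
      then obtain t where t: "y - x = int k * t" by auto
      hence yx: "y = x + t * int k" by (simp add: algebra_simps)
      have "int (p * k) dvd g y - g x" using x y by (intro dvd_diff) auto
      hence "int k * int p dvd int k * (t * (2 * x + B) + t * t * int k)"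
        unfolding yx exp by (simp add: mult.commute)
      hence "int p dvd t * (2 * x + B) + t * t * int k" using k0 by simp
      hence "int p dvd t * (2 * x + B)" using pk by (simp add: dvd_add_left_iff)
      moreover have "int p dvd int (p * k)" by simp
      hence "int p dvd g x" using x dvd_trans by blast
      ultimately have "int p dvd t" using unit pint by (auto simp: prime_dvd_mult_iff)
      then obtain c where "t = int p * c" by auto
      hence "y - x = int (p * k) * c" using t by (simp add: mult_ac)
      hence "[y = x] (mod int (p * k))" by (simp add: cong_iff_dvd_diff del: of_nat_mult)
      thus "x = y" using x y by (simp add: cong_def del: of_nat_mult)
    qed simp
  next
    fix x assume x: "x \<in> {x \<in> {0..<int (p * k)}. int (p * k) dvd g x}"
    hence "int k dvd g x" by (auto intro: dvd_mult_right)
    moreover have "respects_mod k (\<lambda>x. int k dvd g x)" unfolding g_def by (rule respects_mod_quad) simp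
    ultimately show "x mod int k \<in> {x \<in> {0..<int k}. int k dvd g x}"
      using respects_mod_mod[of k "\<lambda>x. int k dvd g x" x] k0 by auto
  next
    fix x assume x: "x \<in> {x \<in> {0..<int k}. int k dvd g x}"
    then obtain c where c: "g x = int k * c" by auto
    have "int p dvd g x" using x pk dvd_trans by blast
    hence "coprime (2 * x + B) (int p)" using unit pint by (metis coprime_commute prime_imp_coprime)
    then obtain u where u: "[(2 * x + B) * u = 1] (mod int p)" using cong_solve_coprime_int by blast
    \<comment> \<open>The Newton correction: t solves t (2 x + B) + c = 0 modulo p, where c = g x /
      p^j.\<close>
    define t where "t = (- c * u) mod int p"
    have "[t * (2 * x + B) = (- c * u) * (2 * x + B)] (mod int p)"
      unfolding t_def by (intro cong_mult cong_refl) (simp add: cong_def)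
    also have "(- c * u) * (2 * x + B) = (- c) * ((2 * x + B) * u)" by (simp add: algebra_simps)
    also have "[(- c) * ((2 * x + B) * u) = (- c) * 1] (mod int p)" by (intro cong_mult cong_refl u)
    finally have "int p dvd t * (2 * x + B) + c" by (simp add: cong_iff_dvd_diff)
    hence "int p dvd (t * (2 * x + B) + c) + t * t * int k" using pk by simp
    hence "int k * int p dvd int k * ((t * (2 * x + B) + c) + t * t * int k)" by simp
    also have "int k * ((t * (2 * x + B) + c) + t * t * int k) = g (x + t * int k)"
      unfolding exp c by (simp add: algebra_simps)
    finally have root: "int (p * k) dvd g (x + t * int k)" by (simp add: mult.commute)
    have t: "0 \<le> t" "t < int p" using p0 by (auto simp: t_def)
    have "x + t * int k < int k + t * int k" using x by simp
    also have "\<dots> = (t + 1) * int k" by (simp add: algebra_simps)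
    also have "\<dots> \<le> int p * int k" using t by (intro mult_right_mono) auto
    finally have "x + t * int k \<in> {x \<in> {0..<int (p * k)}. int (p * k) dvd g x}" using x t root by simp
    moreover have "x = (x + t * int k) mod int k" using x by simp
    ultimately show "\<exists>y\<in>{x \<in> {0..<int (p * k)}. int (p * k) dvd g x}. x = y mod int k" by blast
  qed
  from bij_betw_same_card[OF this] show ?thesis
    unfolding quad_roots_def count_mod_def g_def k_def by simp
qed

text \<open>A root modulo p^2 would give 2 x + B = p y and exhibit D / p^2 = y^2 - 4 c as a
  discriminant, against fundamentality.\<close>

lemma quad_roots_ramified:
  assumes D: "fundamental_disc (B\<^sup>2 - 4 * C)" and p: "prime p" "int p dvd B\<^sup>2 - 4 * C" and j: "j \<ge> 2"
  shows "quad_roots B C (p ^ j) = 0"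
proof -
  have no: False if r: "int (p ^ j) dvd x\<^sup>2 + B * x + C" for x
  proof -
    let ?g = "x\<^sup>2 + B * x + C"
    have "p\<^sup>2 dvd p ^ j" using j by (rule le_imp_power_dvd)
    hence "int (p\<^sup>2) dvd int (p ^ j)" by (simp only: of_nat_dvd_iff)
    hence "int (p\<^sup>2) dvd ?g" using r by (rule dvd_trans)
    hence p2: "(int p)\<^sup>2 dvd ?g" by (simp only: of_nat_power)
    then obtain c where c: "?g = (int p)\<^sup>2 * c" by auto
    have eq: "(2 * x + B)\<^sup>2 = (B\<^sup>2 - 4 * C) + 4 * ?g" by (simp add: power2_eq_square algebra_simps)
    have "int p dvd (int p)\<^sup>2" by (simp add: power2_eq_square)
    hence "int p dvd ?g" using p2 by (rule dvd_trans)
    hence "int p dvd 4 * ?g" by (rule dvd_mult)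
    hence "int p dvd (2 * x + B)\<^sup>2" unfolding eq by (rule dvd_add[OF p(2)])
    hence "int p dvd 2 * x + B" using p(1) by (simp add: prime_dvd_power_iff)
    then obtain y where y: "2 * x + B = int p * y" by auto
    have Deq: "B\<^sup>2 - 4 * C = (y\<^sup>2 - 4 * c) * (int p)\<^sup>2"
    proof -
      have "B\<^sup>2 - 4 * C = (2 * x + B)\<^sup>2 - 4 * ?g" using eq by simp
      also have "\<dots> = (y\<^sup>2 - 4 * c) * (int p)\<^sup>2" unfolding y c by (simp add: power2_eq_square algebra_simps)
      finally show ?thesis .
    qed
    have "is_disc (y\<^sup>2 - 4 * c)"
    proof (cases "even y")
      case True
      then obtain z where "y = 2 * z" by auto
      hence "y\<^sup>2 - 4 * c = 4 * (z\<^sup>2 - c)" by (simp add: power2_eq_square)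
      thus ?thesis by (simp add: is_disc_def)
    next
      case False
      have "y\<^sup>2 mod 8 = 1" by (rule square_mod_8) (use False in auto)
      hence "(y\<^sup>2 - 4 * c) mod 4 = 1" by presburger
      thus ?thesis by (simp add: is_disc_def)
    qed
    moreover have "int p > 1" using prime_gt_1_nat[OF p(1)] by simp
    ultimately show False using D Deq unfolding fundamental_disc_def by blast
  qed
  have "{x \<in> {0..<int (p ^ j)}. int (p ^ j) dvd x\<^sup>2 + B * x + C} = {}" using no by blast
  thus ?thesis unfolding quad_roots_def count_mod_def by (simp only: card.empty)
qed

section \<open>Splitting one prime off sums over divisors\<close>

lemma prime_power_mult_dvd_iff:
  fixes p m :: nat
  assumes p: "prime p" and pm: "\<not> p dvd m" and pd: "\<not> p dvd d"
  shows "p ^ i * d dvd p ^ j * m \<longleftrightarrow> i \<le> j \<and> d dvd m"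
proof
  assume L: "p ^ i * d dvd p ^ j * m"
  have "coprime p d" "coprime p m" using p pm pd by (auto intro: prime_imp_coprime)
  hence cd: "coprime d (p ^ j)" "coprime (p ^ i) m"
    using coprime_commute[of p d] by simp_all
  have "d dvd p ^ j * m" using L by (rule dvd_mult_right)
  hence "d dvd m" using cd(1) by (simp add: coprime_dvd_mult_right_iff)
  moreover have "p ^ i dvd p ^ j * m" using L by (rule dvd_mult_left)
  hence "p ^ i dvd p ^ j" using cd(2) by (simp add: coprime_dvd_mult_left_iff)
  hence "i \<le> j" by (rule power_dvd_imp_le[OF _ prime_gt_1_nat[OF p]])
  ultimately show "i \<le> j \<and> d dvd m" by simp
qed (auto intro: mult_dvd_mono le_imp_power_dvd)

lemma bij_betw_divisors_prime_power:
  fixes p m :: nat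
  assumes p: "prime p" and m: "m > 0" "\<not> p dvd m"
  shows "bij_betw (\<lambda>(i, d). p ^ i * d) ({..j} \<times> {d. d dvd m}) {d. d dvd p ^ j * m}"
proof (rule bij_betwI')
  have nd: "\<not> p dvd d" if "d dvd m" for d using that m(2) dvd_trans by blast
  fix x y assume xy: "x \<in> {..j} \<times> {d. d dvd m}" "y \<in> {..j} \<times> {d. d dvd m}"
  obtain i d where x: "x = (i, d)" by (cases x)
  obtain i' d' where y: "y = (i', d')" by (cases y)
  show "((case x of (i, d) \<Rightarrow> p ^ i * d) = (case y of (i, d) \<Rightarrow> p ^ i * d)) = (x = y)"
  proof
    assume eq: "(case x of (i, d) \<Rightarrow> p ^ i * d) = (case y of (i, d) \<Rightarrow> p ^ i * d)"
    hence eq': "p ^ i * d = p ^ i' * d'" by (simp add: x y)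
    have nds: "\<not> p dvd d" "\<not> p dvd d'" using xy nd by (auto simp: x y)
    have "i \<le> i' \<and> d dvd d'" using prime_power_mult_dvd_iff[OF p nds(2,1), of i i'] eq' by simp
    moreover have "i' \<le> i \<and> d' dvd d" using prime_power_mult_dvd_iff[OF p nds(1,2), of i' i] eq' by simp
    ultimately show "x = y" by (auto simp: x y intro: dvd_antisym)
  qed auto
next
  fix x assume "x \<in> {..j} \<times> {d. d dvd m}"
  thus "(case x of (i, d) \<Rightarrow> p ^ i * d) \<in> {d. d dvd p ^ j * m}"
    by (auto intro: mult_dvd_mono le_imp_power_dvd)
next
  fix y assume y: "y \<in> {d. d dvd p ^ j * m}"
  have "p ^ j * m \<noteq> 0" using m p by (auto simp: prime_gt_0_nat)
  hence "y \<noteq> 0" using y by (cases "y = 0") simp_all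
  then obtain i d where d: "y = p ^ i * d" "\<not> p dvd d"
    using multiplicity_decompose'[of y p] p by (metis mult.commute prime_gt_1_nat not_prime_unit)
  have "i \<le> j \<and> d dvd m" using prime_power_mult_dvd_iff[OF p m(2) d(2)] y d by simp
  thus "\<exists>x\<in>{..j} \<times> {d. d dvd m}. y = (case x of (i, d) \<Rightarrow> p ^ i * d)" using d by force
qed

lemma bij_betw_square_divisors_prime_power:
  fixes p m :: nat
  assumes p: "prime p" and m: "m > 0" "\<not> p dvd m"
  shows "bij_betw (\<lambda>(i, d). p ^ i * d) ({..j div 2} \<times> {d. d\<^sup>2 dvd m}) {d. d\<^sup>2 dvd p ^ j * m}"
proof -
  have sq: "(p ^ i * d)\<^sup>2 = p ^ (2 * i) * d\<^sup>2" for i d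
    by (simp add: power_mult_distrib power_mult mult.commute)
  have dm: "d dvd m" if "d\<^sup>2 dvd m" for d using that by (metis dvd_mult_left power2_eq_square)
  have im: "(\<lambda>(i, d). p ^ i * d) ` ({..j div 2} \<times> {d. d\<^sup>2 dvd m}) = {d. d\<^sup>2 dvd p ^ j * m}"
  proof (intro equalityI subsetI)
    fix y assume "y \<in> (\<lambda>(i, d). p ^ i * d) ` ({..j div 2} \<times> {d. d\<^sup>2 dvd m})"
    then obtain i d where id: "i \<le> j div 2" "d\<^sup>2 dvd m" "y = p ^ i * d" by auto
    have "p ^ (2 * i) * d\<^sup>2 dvd p ^ j * m" using id by (intro mult_dvd_mono le_imp_power_dvd) auto
    thus "y \<in> {d. d\<^sup>2 dvd p ^ j * m}" using id sq by simp
  next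
    fix y assume y: "y \<in> {d. d\<^sup>2 dvd p ^ j * m}"
    have "p ^ j * m \<noteq> 0" using m p by (auto simp: prime_gt_0_nat)
    hence "y \<noteq> 0" using y by (cases "y = 0") simp_all
    then obtain i d where d: "y = p ^ i * d" "\<not> p dvd d"
      using multiplicity_decompose'[of y p] p by (metis mult.commute prime_gt_1_nat not_prime_unit)
    have nd: "\<not> p dvd d\<^sup>2" using d(2) p prime_dvd_power by blast
    have "2 * i \<le> j \<and> d\<^sup>2 dvd m" using prime_power_mult_dvd_iff[OF p m(2) nd, of "2 * i" j] y d sq by simp
    hence "(i, d) \<in> {..j div 2} \<times> {d. d\<^sup>2 dvd m}" by auto
    thus "y \<in> (\<lambda>(i, d). p ^ i * d) ` ({..j div 2} \<times> {d. d\<^sup>2 dvd m})" using d(1) by force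
  qed
  moreover have "inj_on (\<lambda>(i, d). p ^ i * d) ({..j div 2} \<times> {d. d\<^sup>2 dvd m})"
    by (rule inj_on_subset[OF bij_betw_imp_inj_on[OF bij_betw_divisors_prime_power[OF p m, of "j div 2"]]])
       (use dm in auto)
  ultimately show ?thesis by (simp add: bij_betw_def)
qed

text \<open>If primitive representations of k are counted by \<open>quad_roots\<close>, this counts
  all representations, g being the gcd of the two coordinates.\<close>

definition rep_sum :: "int \<Rightarrow> int \<Rightarrow> nat \<Rightarrow> int" where
  "rep_sum B C k = (\<Sum>g | g\<^sup>2 dvd k. int (quad_roots B C (k div g\<^sup>2)))"

definition char_sum :: "int \<Rightarrow> nat \<Rightarrow> nat \<Rightarrow> int" where
  "char_sum D q k = (\<Sum>d | d dvd k \<and> coprime d q. kronecker D d)"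

text \<open>In terms of X = p^(-s), passing from a discriminant Delta to p^2 Delta replaces the local factor L of
  the counting series by 1 + p X^2 L; unrolling this gives the following sum over d | f.\<close>

definition order_sum :: "int \<Rightarrow> nat \<Rightarrow> nat \<Rightarrow> int" where
  "order_sum D f k = (\<Sum>d | d dvd f \<and> d\<^sup>2 dvd k. int d * char_sum D (f div d) (k div d\<^sup>2))"

section \<open>Prime-by-prime recursions for the counting functions\<close>

lemma finite_square_divisors: "k > 0 \<Longrightarrow> finite {g::nat. g\<^sup>2 dvd k}"
proof (rule finite_subset)
  assume "k > 0"
  show "{g. g\<^sup>2 dvd k} \<subseteq> {d. d dvd k}" by (auto simp: power2_eq_square dest: dvd_mult_left)
  show "finite {d. d dvd k}" using \<open>k > 0\<close> by simp
qed

lemma prime_power_div_square: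
  fixes p m h :: nat
  assumes "prime p" "2 * i \<le> j" "h\<^sup>2 dvd m"
  shows "(p ^ j * m) div (p ^ i * h)\<^sup>2 = p ^ (j - 2 * i) * (m div h\<^sup>2)"
proof (cases "h = 0")
  case False
  obtain c where c: "m = h\<^sup>2 * c" using assms(3) by auto
  have "p ^ j = p ^ (2 * i) * p ^ (j - 2 * i)" using assms(2) by (simp flip: power_add)
  hence "p ^ j * m = (p ^ i * h)\<^sup>2 * (p ^ (j - 2 * i) * c)"
    by (simp add: c power_mult_distrib power_mult mult_ac)
  moreover have "(p ^ i * h)\<^sup>2 \<noteq> 0" using False assms(1) by (auto simp: prime_gt_0_nat)
  ultimately have "(p ^ j * m) div (p ^ i * h)\<^sup>2 = p ^ (j - 2 * i) * c"
    by (metis nonzero_mult_div_cancel_left)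
  moreover have "m div h\<^sup>2 = c" using c False by simp
  ultimately show ?thesis by simp
qed auto

lemma rep_sum_prime_power:
  assumes p: "prime p" and m: "m > 0" "\<not> p dvd m"
  shows "rep_sum B C (p ^ j * m) =
    (\<Sum>i\<le>j div 2. \<Sum>h | h\<^sup>2 dvd m. int (quad_roots B C (p ^ (j - 2 * i) * (m div h\<^sup>2))))"
proof -
  have "rep_sum B C (p ^ j * m) = (\<Sum>x\<in>{..j div 2} \<times> {d. d\<^sup>2 dvd m}.
      int (quad_roots B C ((p ^ j * m) div (case x of (i, d) \<Rightarrow> p ^ i * d)\<^sup>2)))"
    unfolding rep_sum_def
    by (rule sum.reindex_bij_betw[OF bij_betw_square_divisors_prime_power[OF p m], symmetric])
  also have "\<dots> = (\<Sum>(i, h)\<in>{..j div 2} \<times> {d. d\<^sup>2 dvd m}. int (quad_roots B C (p ^ (j - 2 * i) * (m div h\<^sup>2))))"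
  proof (rule sum.cong[OF refl])
    fix x assume x: "x \<in> {..j div 2} \<times> {d. d\<^sup>2 dvd m}"
    obtain i h where ih: "x = (i, h)" by (cases x)
    have "2 * i \<le> j" "h\<^sup>2 dvd m" using x by (auto simp: ih)
    from prime_power_div_square[OF p this] show
      "int (quad_roots B C ((p ^ j * m) div (case x of (i, d) \<Rightarrow> p ^ i * d)\<^sup>2)) =
       (case x of (i, h) \<Rightarrow> int (quad_roots B C (p ^ (j - 2 * i) * (m div h\<^sup>2))))" by (simp add: ih)
  qed
  also have "\<dots> = (\<Sum>i\<le>j div 2. \<Sum>h | h\<^sup>2 dvd m. int (quad_roots B C (p ^ (j - 2 * i) * (m div h\<^sup>2))))"
    by (rule sum.cartesian_product[symmetric])
  finally show ?thesis .
qed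

lemma square_divisor_quotient:
  fixes h m :: nat
  assumes "h\<^sup>2 dvd m" "m > 0" "\<not> p dvd m"
  shows "m div h\<^sup>2 > 0" "\<not> p dvd m div h\<^sup>2"
proof -
  have "m = h\<^sup>2 * (m div h\<^sup>2)" using assms(1) by simp
  thus "m div h\<^sup>2 > 0" using assms(2) by (metis mult_0_right neq0_conv)
  show "\<not> p dvd m div h\<^sup>2" using assms \<open>m = _\<close> by (metis dvd_mult)
qed

text \<open>In the sum over i, the top term i = j div 2 has at most one factor p left in the modulus
  and gives \<open>rep_sum B C m\<close>; every other term contains p^2 and equals p times the
  unscaled term with j lowered by 2.\<close>

lemma rep_sum_scaled:
  assumes p: "prime p" and m: "m > 0" "\<not> p dvd m"
  shows "rep_sum (int p * B) ((int p)\<^sup>2 * C) (p ^ j * m) =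
    rep_sum B C m + (if j \<ge> 2 then int p * rep_sum B C (p ^ (j - 2) * m) else 0)"
proof -
  let ?B = "int p * B" and ?C = "(int p)\<^sup>2 * C"
  let ?t = "\<lambda>i. \<Sum>h | h\<^sup>2 dvd m. int (quad_roots ?B ?C (p ^ (j - 2 * i) * (m div h\<^sup>2)))"
  have last: "?t (j div 2) = rep_sum B C m"
    unfolding rep_sum_def
  proof (rule sum.cong[OF refl])
    fix h assume "h \<in> {h. h\<^sup>2 dvd m}"
    hence h: "h\<^sup>2 dvd m" by simp
    note q = square_divisor_quotient[OF h m]
    have "j - 2 * (j div 2) = 0 \<or> j - 2 * (j div 2) = 1" by presburger
    thus "int (quad_roots ?B ?C (p ^ (j - 2 * (j div 2)) * (m div h\<^sup>2))) = int (quad_roots B C (m div h\<^sup>2))"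
      using quad_roots_scaled_once[OF p q] quad_roots_scaled_coprime[OF p q] by (elim disjE) simp_all
  qed
  have "rep_sum ?B ?C (p ^ j * m) = (\<Sum>i<j div 2. ?t i) + ?t (j div 2)"
    unfolding rep_sum_prime_power[OF p m] lessThan_Suc_atMost[symmetric] by simp
  also have "(\<Sum>i<j div 2. ?t i) = (if j \<ge> 2 then int p * rep_sum B C (p ^ (j - 2) * m) else 0)"
  proof (cases "j \<ge> 2")
    case True
    have "(\<Sum>i<j div 2. ?t i) = (\<Sum>i<j div 2. \<Sum>h | h\<^sup>2 dvd m.
        int p * int (quad_roots B C (p ^ (j - 2 - 2 * i) * (m div h\<^sup>2))))"
    proof (intro sum.cong refl)
      fix i h assume i: "i \<in> {..<j div 2}" and "h \<in> {h. h\<^sup>2 dvd m}"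
      hence h: "h\<^sup>2 dvd m" by simp
      have "j - 2 * i = 2 + (j - 2 - 2 * i)" using i by auto
      hence "p ^ (j - 2 * i) = p\<^sup>2 * p ^ (j - 2 - 2 * i)" by (metis power_add)
      hence e: "p ^ (j - 2 * i) * (m div h\<^sup>2) = p\<^sup>2 * (p ^ (j - 2 - 2 * i) * (m div h\<^sup>2))"
        by (simp only: mult.assoc)
      have "p ^ (j - 2 - 2 * i) * (m div h\<^sup>2) > 0"
        using square_divisor_quotient[OF h m] p by (simp add: prime_gt_0_nat)
      from quad_roots_scaled_square[OF p this] show
        "int (quad_roots ?B ?C (p ^ (j - 2 * i) * (m div h\<^sup>2))) =
         int p * int (quad_roots B C (p ^ (j - 2 - 2 * i) * (m div h\<^sup>2)))" unfolding e by simp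
    qed
    also have S: "{..<j div 2} = {..(j - 2) div 2}" using True by auto
    also have "(\<Sum>i\<le>(j - 2) div 2. \<Sum>h | h\<^sup>2 dvd m.
        int p * int (quad_roots B C (p ^ (j - 2 - 2 * i) * (m div h\<^sup>2)))) =
        int p * rep_sum B C (p ^ (j - 2) * m)"
      unfolding rep_sum_prime_power[OF p m] by (simp add: sum_distrib_left)
    finally show ?thesis using True unfolding S by simp
  next
    case False
    hence "j div 2 = 0" by simp
    thus ?thesis using False by simp
  qed
  finally show ?thesis using last by simp
qed

text \<open>The same recursion as for \<open>rep_sum\<close>: divisors d prime to p leave
  coprimality to p in the inner sum, which erases the p-part of k, while the others are p times a
  divisor of f.\<close>

lemma order_sum_scaled:
  assumes p: "prime p" and m: "m > 0" "\<not> p dvd m" and f: "f > 0"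
  shows "order_sum D (p * f) (p ^ j * m) =
    order_sum D f m + (if j \<ge> 2 then int p * order_sum D f (p ^ (j - 2) * m) else 0)"
proof -
  let ?k = "p ^ j * m"
  have p0: "p > 0" using p by (simp add: prime_gt_0_nat)
  have k0: "?k > 0" using m p0 by simp
  let ?S = "{d. d dvd p * f \<and> d\<^sup>2 dvd ?k}"
  let ?t = "\<lambda>d. int d * char_sum D (p * f div d) (?k div d\<^sup>2)"
  have fin: "finite ?S" by (rule finite_subset[OF _ finite_square_divisors[OF k0]]) auto
  have split: "order_sum D (p * f) ?k = sum ?t {d \<in> ?S. \<not> p dvd d} + sum ?t {d \<in> ?S. p dvd d}"
  proof -
    have "?S = {d \<in> ?S. \<not> p dvd d} \<union> {d \<in> ?S. p dvd d}" by auto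
    hence "sum ?t ?S = sum ?t ({d \<in> ?S. \<not> p dvd d} \<union> {d \<in> ?S. p dvd d})" by (rule arg_cong)
    also have "\<dots> = sum ?t {d \<in> ?S. \<not> p dvd d} + sum ?t {d \<in> ?S. p dvd d}"
    proof (rule sum.union_disjoint)
      show "finite {d \<in> ?S. \<not> p dvd d}" "finite {d \<in> ?S. p dvd d}"
        by (rule finite_subset[OF _ fin]; blast)+
    qed blast
    finally show ?thesis unfolding order_sum_def .
  qed
  have 1: "sum ?t {d \<in> ?S. \<not> p dvd d} = order_sum D f m"
    unfolding order_sum_def
  proof (rule sum.cong)
    have "(d dvd p * f \<and> d\<^sup>2 dvd ?k) \<and> \<not> p dvd d \<longleftrightarrow> d dvd f \<and> d\<^sup>2 dvd m" for d
    proof (cases "p dvd d")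
      case True
      have "\<not> d\<^sup>2 dvd m"
      proof
        assume "d\<^sup>2 dvd m"
        hence "d dvd m" by (metis dvd_mult_left power2_eq_square)
        thus False using True m(2) dvd_trans by blast
      qed
      thus ?thesis using True by simp
    next
      case False
      hence "coprime d p" using p prime_imp_coprime coprime_commute by blast
      hence "d dvd p * f \<longleftrightarrow> d dvd f" by (simp add: coprime_dvd_mult_right_iff)
      moreover have "\<not> p dvd d\<^sup>2" using False p prime_dvd_power by blast
      hence "d\<^sup>2 dvd ?k \<longleftrightarrow> d\<^sup>2 dvd m" using prime_power_mult_dvd_iff[OF p m(2), of "d\<^sup>2" 0 j] by simp
      ultimately show ?thesis using False by simp
    qed
    thus "{d \<in> ?S. \<not> p dvd d} = {d. d dvd f \<and> d\<^sup>2 dvd m}" by auto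
  next
    fix d assume "d \<in> {d. d dvd f \<and> d\<^sup>2 dvd m}"
    hence d: "d dvd f" "d\<^sup>2 dvd m" by auto
    have "d > 0" using d(1) f by (metis dvd_0_left neq0_conv not_gr0)
    have e1: "p * f div d = p * (f div d)" using d by (simp add: div_mult_swap)
    have e2: "?k div d\<^sup>2 = p ^ j * (m div d\<^sup>2)" using d by (simp add: div_mult_swap)
    note q = square_divisor_quotient[OF d(2) m]
    have "{x. x dvd p ^ j * (m div d\<^sup>2) \<and> coprime x (p * (f div d))} = {x. x dvd m div d\<^sup>2 \<and> coprime x (f div d)}"
    proof -
      have "x dvd p ^ j * (m div d\<^sup>2) \<and> coprime x (p * (f div d)) \<longleftrightarrow> x dvd m div d\<^sup>2 \<and> coprime x (f div d)" for x
      proof (cases "p dvd x")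
        case True
        hence "\<not> coprime x p" using p by (metis coprime_common_divisor_nat dvd_refl not_prime_1)
        moreover have "\<not> x dvd m div d\<^sup>2" using True q(2) dvd_trans by blast
        ultimately show ?thesis by simp
      next
        case False
        hence "coprime x p" using p prime_imp_coprime coprime_commute by blast
        thus ?thesis using prime_power_mult_dvd_iff[OF p q(2) False, of 0 j] by simp
      qed
      thus ?thesis by simp
    qed
    thus "?t d = int d * char_sum D (f div d) (m div d\<^sup>2)"
      unfolding e1 e2 char_sum_def by simp
  qed
  have 2: "sum ?t {d \<in> ?S. p dvd d} = (if j \<ge> 2 then int p * order_sum D f (p ^ (j - 2) * m) else 0)"
  proof (cases "j \<ge> 2")
    case True
    let ?k' = "p ^ (j - 2) * m"
    have "p ^ j = p\<^sup>2 * p ^ (j - 2)" using True by (metis power_add le_add_diff_inverse)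
    hence kk: "?k = p\<^sup>2 * ?k'" by (simp only: mult.assoc)
    have "bij_betw (\<lambda>d. p * d) {d. d dvd f \<and> d\<^sup>2 dvd ?k'} {d \<in> ?S. p dvd d}"
    proof (rule bij_betwI')
      fix x y show "(p * x = p * y) = (x = y)" using p0 by simp
    next
      fix x assume "x \<in> {d. d dvd f \<and> d\<^sup>2 dvd ?k'}"
      thus "p * x \<in> {d \<in> ?S. p dvd d}" unfolding kk by (simp add: power_mult_distrib mult_dvd_mono)
    next
      fix y assume y: "y \<in> {d \<in> ?S. p dvd d}"
      then obtain x where x: "y = p * x" by auto
      have "x dvd f" "x\<^sup>2 dvd ?k'" using y p0 unfolding kk x by (auto simp: power_mult_distrib)
      thus "\<exists>x\<in>{d. d dvd f \<and> d\<^sup>2 dvd ?k'}. y = p * x" using x by blast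
    qed
    hence "sum ?t {d \<in> ?S. p dvd d} = (\<Sum>d | d dvd f \<and> d\<^sup>2 dvd ?k'. ?t (p * d))"
      by (rule sum.reindex_bij_betw[symmetric])
    also have "\<dots> = (\<Sum>d | d dvd f \<and> d\<^sup>2 dvd ?k'. int p * (int d * char_sum D (f div d) (?k' div d\<^sup>2)))"
    proof (rule sum.cong[OF refl])
      fix d
      have "p * f div (p * d) = f div d" "?k div (p * d)\<^sup>2 = ?k' div d\<^sup>2"
        unfolding kk power_mult_distrib using p0 by (simp_all only: div_mult_mult1 div_mult_mult1_if) auto
      thus "?t (p * d) = int p * (int d * char_sum D (f div d) (?k' div d\<^sup>2))" by simp
    qed
    also have "\<dots> = int p * order_sum D f ?k'" by (simp add: order_sum_def sum_distrib_left)
    finally show ?thesis using True by simp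
  next
    case False
    have emp: "{d \<in> ?S. p dvd d} = {}"
    proof -
      have False if "d\<^sup>2 dvd ?k" "p dvd d" for d
      proof -
        have "p\<^sup>2 dvd d\<^sup>2" using that(2) by simp
        hence "p ^ 2 * 1 dvd p ^ j * m" using that(1) dvd_trans by (metis mult.right_neutral)
        moreover have "\<not> p dvd 1" using p by auto
        ultimately show False using prime_power_mult_dvd_iff[OF p m(2), of 1 2 j] False by simp
      qed
      thus ?thesis by auto
    qed
    show ?thesis unfolding emp using False by simp
  qed
  show ?thesis using split 1 2 by simp
qed

lemma char_sum_prime_power:
  assumes p: "prime p" and m: "m > 0" "\<not> p dvd m"
  shows "char_sum D 1 (p ^ j * m) = (\<Sum>i\<le>j. kronecker D p ^ i) * char_sum D 1 m"
proof -
  have pw: "kronecker D (p ^ i) = kronecker D p ^ i" for i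
    by (induction i) (use p in \<open>simp_all add: kronecker_mult prime_gt_0_nat\<close>)
  have "char_sum D 1 (p ^ j * m) = (\<Sum>x\<in>{..j} \<times> {d. d dvd m}. kronecker D (case x of (i, d) \<Rightarrow> p ^ i * d))"
    unfolding char_sum_def
    using sum.reindex_bij_betw[OF bij_betw_divisors_prime_power[OF p m], of "kronecker D" j] by simp
  also have "\<dots> = (\<Sum>(i, d)\<in>{..j} \<times> {d. d dvd m}. kronecker D p ^ i * kronecker D d)"
  proof (rule sum.cong[OF refl])
    fix x assume x: "x \<in> {..j} \<times> {d. d dvd m}"
    obtain i d where id: "x = (i, d)" by (cases x)
    have "d \<noteq> 0" using x m by (auto simp: id)
    thus "kronecker D (case x of (i, d) \<Rightarrow> p ^ i * d) = (case x of (i, d) \<Rightarrow> kronecker D p ^ i * kronecker D d)"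
      using p by (simp add: id kronecker_mult pw prime_gt_0_nat)
  qed
  also have "\<dots> = (\<Sum>i\<le>j. kronecker D p ^ i) * char_sum D 1 m"
    unfolding char_sum_def by (simp add: sum_product sum.cartesian_product)
  finally show ?thesis .
qed

text \<open>By multiplicativity only root counts rho(i) modulo p^i matter, and they satisfy rho(i +
  2) = chi^(i + 1) + chi^(i + 2): by Hensel lifting if chi is nonzero, and because no roots exist if
  chi = 0. Summing every second rho then fills in the whole geometric sum.\<close>

lemma rep_sum_fundamental_prime_power:
  assumes D: "fundamental_disc (B\<^sup>2 - 4 * C)" and p: "prime p" and m: "m > 0" "\<not> p dvd m"
  shows "rep_sum B C (p ^ j * m) = (\<Sum>i\<le>j. kronecker (B\<^sup>2 - 4 * C) p ^ i) * rep_sum B C m"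
proof -
  let ?D = "B\<^sup>2 - 4 * C"
  let ?\<rho> = "\<lambda>i. int (quad_roots B C (p ^ i))"
  let ?\<chi> = "kronecker ?D p"
  have "rep_sum B C (p ^ j * m) = (\<Sum>i\<le>j div 2. \<Sum>h | h\<^sup>2 dvd m. ?\<rho> (j - 2 * i) * int (quad_roots B C (m div h\<^sup>2)))"
    unfolding rep_sum_prime_power[OF p m]
  proof (intro sum.cong refl)
    fix i h assume "h \<in> {h. h\<^sup>2 dvd m}"
    hence h: "h\<^sup>2 dvd m" by simp
    note q = square_divisor_quotient[OF h m]
    have "coprime (p ^ (j - 2 * i)) (m div h\<^sup>2)" using q(2) p by (simp add: prime_imp_coprime)
    thus "int (quad_roots B C (p ^ (j - 2 * i) * (m div h\<^sup>2))) =
        ?\<rho> (j - 2 * i) * int (quad_roots B C (m div h\<^sup>2))"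
      using q p by (subst quad_roots_mult) (auto simp: prime_gt_0_nat)
  qed
  also have "\<dots> = (\<Sum>i\<le>j div 2. ?\<rho> (j - 2 * i)) * rep_sum B C m"
    unfolding rep_sum_def by (simp add: sum_product)
  also have "(\<Sum>i\<le>j div 2. ?\<rho> (j - 2 * i)) = (\<Sum>i\<le>j. ?\<chi> ^ i)"
  proof (induction j rule: less_induct)
    case (less j)
    have kp: "?\<chi> = kron_prime ?D p" by (rule kronecker_prime[OF p])
    have r0: "?\<rho> 0 = 1" using quad_roots_1 by simp
    have r1: "?\<rho> 1 = 1 + ?\<chi>" using quad_roots_prime[OF p] by (simp add: kp)
    have step: "?\<rho> (Suc (Suc i)) = ?\<chi> ^ Suc i + ?\<chi> ^ Suc (Suc i)" for i
    proof (cases "int p dvd ?D")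
      case True
      have "?\<chi> = 0"
      proof (cases "p = 2")
        case True
        thus ?thesis using \<open>int p dvd ?D\<close> unfolding kp by (simp add: kron_prime_def)
      next
        case False
        thus ?thesis using True by (simp add: kp kron_prime_def Legendre_def cong_0_iff)
      qed
      thus ?thesis using quad_roots_ramified[OF D p True, of "Suc (Suc i)"] by simp
    next
      case False
      have h: "?\<rho> (Suc i) = ?\<rho> 1" for i
      proof (induction i)
        case (Suc i)
        thus ?case using quad_roots_hensel[OF p False, of "Suc i"] by simp
      qed simp
      have "?\<chi> \<noteq> 0"
      proof (cases "p = 2")
        case True
        thus ?thesis using \<open>\<not> int p dvd ?D\<close> unfolding kp by (simp add: kron_prime_def)
      next
        case False
        thus ?thesis using \<open>\<not> int p dvd ?D\<close> by (simp add: kp kron_prime_def Legendre_def cong_0_iff)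
      qed
      hence "?\<chi> = 1 \<or> ?\<chi> = - 1" using kron_prime_values[of ?D p] kp by auto
      thus ?thesis using h[of "Suc i"] r1 by (elim disjE) auto
    qed
    consider "j = 0" | "j = 1" | i where "j = Suc (Suc i)" by (metis One_nat_def not0_implies_Suc)
    thus ?case
    proof cases
      case 3
      have "(\<Sum>i\<le>j div 2. ?\<rho> (j - 2 * i)) = ?\<rho> j + (\<Sum>l\<le>i div 2. ?\<rho> (i - 2 * l))"
        unfolding 3 by (simp add: sum.atMost_Suc_shift del: sum.atMost_Suc)
      also have "\<dots> = ?\<rho> j + (\<Sum>l\<le>i. ?\<chi> ^ l)" using less[of i] 3 by simp
      also have "\<dots> = (\<Sum>i\<le>j. ?\<chi> ^ i)" unfolding 3 step by simp
      finally show ?thesis .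
    qed (use r0 r1 in simp_all)
  qed
  finally show ?thesis .
qed

lemma rep_sum_fundamental:
  assumes D: "fundamental_disc (B\<^sup>2 - 4 * C)" and "k > 0"
  shows "rep_sum B C k = char_sum (B\<^sup>2 - 4 * C) 1 k"
  using assms(2)
proof (induction k rule: less_induct)
  case (less k)
  show ?case
  proof (cases "k = 1")
    case True
    have "{g::nat. g\<^sup>2 dvd 1} = {1}" by auto
    hence "rep_sum B C 1 = 1" unfolding rep_sum_def using quad_roots_1 by simp
    moreover have "{d::nat. d dvd 1 \<and> coprime d 1} = {1}" by auto
    hence "char_sum (B\<^sup>2 - 4 * C) 1 1 = 1" by (simp add: char_sum_def)
    ultimately show ?thesis using True by simp
  next
    case False
    then obtain p where p: "prime p" "p dvd k" using prime_factor_nat by blast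
    obtain j m where m: "k = p ^ j * m" "\<not> p dvd m"
      using multiplicity_decompose'[of k p] p less.prems
      by (metis mult.commute neq0_conv not_prime_unit)
    have m0: "m > 0" using m less.prems by (cases m) auto
    have "j \<noteq> 0" using p m by (intro notI) simp
    hence "1 < p ^ j" using p prime_gt_1_nat by (intro one_less_power) auto
    hence "m < k" unfolding m(1) using m0 by simp
    show ?thesis unfolding m(1) rep_sum_fundamental_prime_power[OF D p(1) m0 m(2)]
      char_sum_prime_power[OF p(1) m0 m(2)] less.IH[OF \<open>m < k\<close> m0] by (rule refl)
  qed
qed

text \<open>Both sides obey the same recursion when f is multiplied by a prime, so induction over
  the prime factors of f, with k arbitrary, reduces to the fundamental case.\<close>

theorem rep_sum_eq_order_sum:
  assumes D: "fundamental_disc (B\<^sup>2 - 4 * C)" and "f > 0" "k > 0"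
  shows "rep_sum (int f * B) ((int f)\<^sup>2 * C) k = order_sum (B\<^sup>2 - 4 * C) f k"
  using assms(2,3)
proof (induction f arbitrary: k rule: prime_divisors_induct)
  case (unit f)
  hence f: "f = 1" by simp
  have "{d::nat. d dvd 1 \<and> d\<^sup>2 dvd k} = {1}" by auto
  thus ?case using rep_sum_fundamental[OF D unit(3)] by (simp add: f order_sum_def)
next
  case (factor p f)
  have f0: "f > 0" using factor.prems by simp
  obtain j m where m: "k = p ^ j * m" "\<not> p dvd m"
    using multiplicity_decompose'[of k p] factor
    by (metis mult.commute neq0_conv not_prime_unit)
  have m0: "m > 0" using m factor.prems by (cases m) auto
  have p0: "p > 0" using factor by (simp add: prime_gt_0_nat)
  have e: "int (p * f) * B = int p * (int f * B)" "(int (p * f))\<^sup>2 * C = (int p)\<^sup>2 * ((int f)\<^sup>2 * C)"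
    by (simp_all add: power_mult_distrib mult_ac)
  have pm0: "p ^ (j - 2) * m > 0" using m0 p0 by simp
  show ?case unfolding e m(1) rep_sum_scaled[OF factor.hyps m0 m(2)] order_sum_scaled[OF factor.hyps m0 m(2) f0]
    factor.IH[OF f0 m0] factor.IH[OF f0 pm0] by (rule refl)
qed simp

section \<open>Binary quadratic forms\<close>

type_synonym mat2 = "int \<times> int \<times> int \<times> int"

definition SL2 :: "mat2 set" where
  "SL2 = {(\<alpha>, \<beta>, \<gamma>, \<delta>). \<alpha> * \<delta> - \<beta> * \<gamma> = 1}"

fun mat_mul :: "mat2 \<Rightarrow> mat2 \<Rightarrow> mat2" where
  "mat_mul (\<alpha>, \<beta>, \<gamma>, \<delta>) (\<alpha>', \<beta>', \<gamma>', \<delta>') =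
     (\<alpha> * \<alpha>' + \<beta> * \<gamma>', \<alpha> * \<beta>' + \<beta> * \<delta>', \<gamma> * \<alpha>' + \<delta> * \<gamma>', \<gamma> * \<beta>' + \<delta> * \<delta>')"

fun mat_adj :: "mat2 \<Rightarrow> mat2" where
  "mat_adj (\<alpha>, \<beta>, \<gamma>, \<delta>) = (\<delta>, - \<beta>, - \<gamma>, \<alpha>)"

fun act :: "mat2 \<Rightarrow> bqf \<Rightarrow> bqf" where
  "act (\<alpha>, \<beta>, \<gamma>, \<delta>) f = bqf_act \<alpha> \<beta> \<gamma> \<delta> f"

fun bqf_eval :: "bqf \<Rightarrow> int \<times> int \<Rightarrow> int" where
  "bqf_eval (a, b, c) (x, y) = a * x\<^sup>2 + b * x * y + c * y\<^sup>2"

lemma sl2_equiv_iff: "sl2_equiv f g \<longleftrightarrow> (\<exists>M\<in>SL2. g = act M f)"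
  unfolding sl2_equiv_def SL2_def by fastforce

text \<open>Substitution of variables is a right action: the matrix applied first stands on the
  left.\<close>

lemma act_mul: "act N (act M f) = act (mat_mul M N) f"
proof -
  obtain a b c where f: "f = (a, b, c)" by (cases f)
  obtain \<alpha> \<beta> \<gamma> \<delta> where M: "M = (\<alpha>, \<beta>, \<gamma>, \<delta>)" by (cases M)
  obtain \<alpha>' \<beta>' \<gamma>' \<delta>' where N: "N = (\<alpha>', \<beta>', \<gamma>', \<delta>')" by (cases N)
  show ?thesis unfolding f M N by (simp add: bqf_act_def power2_eq_square algebra_simps)
qed

lemma SL2_mul: "M \<in> SL2 \<Longrightarrow> N \<in> SL2 \<Longrightarrow> mat_mul M N \<in> SL2"
proof -
  assume MN: "M \<in> SL2" "N \<in> SL2"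
  obtain \<alpha> \<beta> \<gamma> \<delta> where M: "M = (\<alpha>, \<beta>, \<gamma>, \<delta>)" by (cases M)
  obtain \<alpha>' \<beta>' \<gamma>' \<delta>' where N: "N = (\<alpha>', \<beta>', \<gamma>', \<delta>')" by (cases N)
  have "(\<alpha> * \<alpha>' + \<beta> * \<gamma>') * (\<gamma> * \<beta>' + \<delta> * \<delta>') - (\<alpha> * \<beta>' + \<beta> * \<delta>') * (\<gamma> * \<alpha>' + \<delta> * \<gamma>')
    = (\<alpha> * \<delta> - \<beta> * \<gamma>) * (\<alpha>' * \<delta>' - \<beta>' * \<gamma>')" by (simp add: algebra_simps)
  thus ?thesis using MN by (simp add: M N SL2_def)
qed

lemma SL2_adj: "M \<in> SL2 \<Longrightarrow> mat_adj M \<in> SL2"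
  by (cases M) (auto simp: SL2_def algebra_simps)

lemma mat_mul_assoc: "mat_mul (mat_mul L M) N = mat_mul L (mat_mul M N)"
  by (cases L; cases M; cases N) (simp add: algebra_simps)

lemma mat_mul_one: "mat_mul M (1, 0, 0, 1) = M" "mat_mul (1, 0, 0, 1) M = M"
  by (cases M; simp)+

lemma mat_mul_adj: "M \<in> SL2 \<Longrightarrow> mat_mul M (mat_adj M) = (1, 0, 0, 1)"
  "M \<in> SL2 \<Longrightarrow> mat_mul (mat_adj M) M = (1, 0, 0, 1)"
  by (cases M; auto simp: SL2_def algebra_simps)+

lemma act_one: "act (1, 0, 0, 1) f = f"
  by (cases f) (simp add: bqf_act_def)

lemma one_in_SL2: "(1, 0, 0, 1) \<in> SL2" by (simp add: SL2_def)

lemma act_adj: "M \<in> SL2 \<Longrightarrow> act (mat_adj M) (act M f) = f"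
  by (simp only: act_mul mat_mul_adj act_one)

lemma sl2_equiv_refl: "sl2_equiv f f"
  using sl2_equiv_iff act_one one_in_SL2 by metis

lemma sl2_equiv_sym: "sl2_equiv f g \<Longrightarrow> sl2_equiv g f"
  using sl2_equiv_iff act_adj SL2_adj by metis

lemma sl2_equiv_trans: "sl2_equiv f g \<Longrightarrow> sl2_equiv g h \<Longrightarrow> sl2_equiv f h"
  using sl2_equiv_iff act_mul SL2_mul by metis

lemma bqf_disc_act: "M \<in> SL2 \<Longrightarrow> bqf_disc (act M f) = bqf_disc f"
proof -
  assume MS: "M \<in> SL2"
  obtain a b c where f: "f = (a, b, c)" by (cases f)
  obtain \<alpha> \<beta> \<gamma> \<delta> where M: "M = (\<alpha>, \<beta>, \<gamma>, \<delta>)" by (cases M)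
  have "bqf_disc (act M f) = (\<alpha> * \<delta> - \<beta> * \<gamma>)\<^sup>2 * bqf_disc f"
    unfolding f M by (simp add: bqf_disc_def bqf_act_def power2_eq_square algebra_simps)
  thus ?thesis using MS by (simp add: M SL2_def)
qed

lemma bqf_eval_square:
  "4 * a * bqf_eval (a, b, c) (x, y) = (2 * a * x + b * y)\<^sup>2 + (4 * a * c - b\<^sup>2) * y\<^sup>2"
  by (simp add: power2_eq_square algebra_simps)

lemma bqf_eval_pos:
  assumes "pos_def f" "(x, y) \<noteq> (0, 0)"
  shows "bqf_eval f (x, y) > 0"
proof -
  obtain a b c where f: "f = (a, b, c)" by (cases f)
  have a: "a > 0" "4 * a * c - b\<^sup>2 > 0" using assms by (auto simp: f pos_def_def)
  have "(2 * a * x + b * y)\<^sup>2 + (4 * a * c - b\<^sup>2) * y\<^sup>2 > 0"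
  proof (cases "y = 0")
    case True
    thus ?thesis using assms a by simp
  next
    case False
    hence "(4 * a * c - b\<^sup>2) * y\<^sup>2 > 0" using a by simp
    thus ?thesis by (simp add: add_nonneg_pos)
  qed
  hence "4 * a * bqf_eval (a, b, c) (x, y) > 0" unfolding bqf_eval_square .
  thus ?thesis using a by (simp add: f zero_less_mult_iff)
qed

lemma act_fst: "act (\<alpha>, \<beta>, \<gamma>, \<delta>) f = (a', b', c') \<Longrightarrow> a' = bqf_eval f (\<alpha>, \<gamma>)"
  by (cases f) (simp add: bqf_act_def)

lemma forms_of_act:
  assumes "f \<in> forms_of n" "M \<in> SL2" "n > 0"
  shows "act M f \<in> forms_of n"
proof -
  obtain \<alpha> \<beta> \<gamma> \<delta> where M: "M = (\<alpha>, \<beta>, \<gamma>, \<delta>)" by (cases M)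
  obtain a' b' c' where g: "act M f = (a', b', c')" by (cases "act M f")
  have d: "bqf_disc (act M f) = - int n" using assms by (simp add: bqf_disc_act forms_of_def)
  have "(\<alpha>, \<gamma>) \<noteq> (0, 0)" using assms(2) by (auto simp: M SL2_def)
  hence "a' > 0" using act_fst[OF g[unfolded M]] bqf_eval_pos[of f \<alpha> \<gamma>] assms(1) by (simp add: forms_of_def)
  thus ?thesis using d assms(3) by (simp add: forms_of_def g pos_def_def bqf_disc_def)
qed

abbreviation class_rel :: "nat \<Rightarrow> (bqf \<times> bqf) set" where
  "class_rel n \<equiv> {(f, g). f \<in> forms_of n \<and> g \<in> forms_of n \<and> sl2_equiv f g}"

lemma equiv_class_rel: "equiv (forms_of n) (class_rel n)"
proof (rule equivI)
  show "refl_on (forms_of n) (class_rel n)" by (auto simp: refl_on_def sl2_equiv_refl)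
  show "sym (class_rel n)" by (auto simp: sym_def intro: sl2_equiv_sym)
  show "trans (class_rel n)" unfolding trans_def using sl2_equiv_trans by blast
qed auto

section \<open>Reduction of forms\<close>

definition reduced :: "bqf \<Rightarrow> bool" where
  "reduced f = (case f of (a, b, c) \<Rightarrow> \<bar>b\<bar> \<le> a \<and> a \<le> c)"

text \<open>Take a form of least leading coefficient in the class. A translation brings b into [- a,
  a), and the substitution (x, y) -> (- y, x), which makes c the leading coefficient, gives a <= c
  by minimality.\<close>

lemma exists_reduced:
  assumes f: "f \<in> forms_of n" and n: "n > 0"
  obtains g where "g \<in> forms_of n" "sl2_equiv f g" "reduced g"
proof -
  let ?P = "\<lambda>g. g \<in> forms_of n \<and> sl2_equiv f g"
  obtain g where g: "?P g" and min: "\<And>h. ?P h \<Longrightarrow> nat (fst g) \<le> nat (fst h)"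
    using exists_least_iff[of "\<lambda>m. \<exists>g. ?P g \<and> nat (fst g) = m"] f sl2_equiv_refl
    by (metis not_le)
  obtain a b c where gabc: "g = (a, b, c)" by (cases g)
  have a: "a > 0" using g by (simp add: gabc forms_of_def pos_def_def)
  define j where "j = - ((b + a) div (2 * a))"
  define h where "h = act (1, j, 0, 1) g"
  have jS: "(1, j, 0, 1) \<in> SL2" by (simp add: SL2_def)
  have h: "h = (a, b + 2 * a * j, a * j\<^sup>2 + b * j + c)"
    by (simp add: h_def gabc bqf_act_def)
  have hP: "?P h"
    unfolding h_def using g forms_of_act[OF _ jS n] jS sl2_equiv_trans[of f g] sl2_equiv_iff[of g] by blast
  have "b + 2 * a * j = (b + a) mod (2 * a) - a"
    by (simp add: j_def minus_div_mult_eq_mod[symmetric] algebra_simps)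
  moreover have "0 \<le> (b + a) mod (2 * a)" "(b + a) mod (2 * a) < 2 * a" using a by simp_all
  ultimately have bb: "\<bar>b + 2 * a * j\<bar> \<le> a" by linarith
  define c' where "c' = a * j\<^sup>2 + b * j + c"
  have SS: "(0, - 1, 1, 0) \<in> SL2" by (simp add: SL2_def)
  have "act (0, - 1, 1, 0) h = (c', - (b + 2 * a * j), a)"
    by (simp add: h bqf_act_def c'_def)
  moreover have "?P (act (0, - 1, 1, 0) h)"
    using hP forms_of_act[OF _ SS n] SS sl2_equiv_trans[of f h] sl2_equiv_iff[of h] by blast
  ultimately have P': "?P (c', - (b + 2 * a * j), a)" by simp
  have "nat a \<le> nat c'" using min[OF P'] by (simp add: gabc)
  moreover have "c' > 0" using P' by (simp add: forms_of_def pos_def_def)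
  ultimately have "a \<le> c'" using a by simp
  hence "reduced h" using bb by (simp add: h reduced_def c'_def)
  thus ?thesis using that hP by blast
qed

lemma reduced_disc_bound:
  assumes "(a, b, c) \<in> forms_of n" "reduced (a, b, c)"
  shows "3 * a\<^sup>2 \<le> int n" "4 * a * c = int n + b\<^sup>2" "a > 0"
proof -
  show a: "a > 0" using assms by (simp add: forms_of_def pos_def_def)
  show eq: "4 * a * c = int n + b\<^sup>2" using assms by (simp add: forms_of_def bqf_disc_def)
  have "b\<^sup>2 \<le> a\<^sup>2" using assms(2) a by (simp add: reduced_def abs_le_square_iff[symmetric])
  moreover have "4 * (a * a) \<le> 4 * (a * c)" using assms(2) a by (simp add: reduced_def)
  ultimately show "3 * a\<^sup>2 \<le> int n" using eq by (simp add: power2_eq_square)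
qed

lemma finite_reduced: "n > 0 \<Longrightarrow> finite {f \<in> forms_of n. reduced f}"
proof (rule finite_subset)
  assume n: "n > 0"
  let ?N = "int n + int n * int n"
  show "{f \<in> forms_of n. reduced f} \<subseteq> {0..?N} \<times> {- ?N..?N} \<times> {0..?N}"
  proof
    fix f assume f: "f \<in> {f \<in> forms_of n. reduced f}"
    obtain a b c where abc: "f = (a, b, c)" by (cases f)
    have r: "(a, b, c) \<in> forms_of n" "reduced (a, b, c)" using f abc by auto
    note d = reduced_disc_bound[OF r]
    have "a \<le> a * a" using d(3) mult_left_mono[of 1 a a] by simp
    hence an: "a \<le> int n" using d(1,3) unfolding power2_eq_square by linarith
    have bn: "\<bar>b\<bar> \<le> a" "a \<le> c" using r by (auto simp: reduced_def)
    have "b\<^sup>2 \<le> (int n)\<^sup>2" using bn an by (simp add: abs_le_square_iff[symmetric])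
    hence b2: "b\<^sup>2 \<le> int n * int n" by (simp add: power2_eq_square)
    have "1 * c \<le> (4 * a) * c" using d(3) bn by (intro mult_right_mono) auto
    hence "c \<le> ?N" using d(2) b2 by simp
    moreover have "0 \<le> int n * int n" by simp
    ultimately show "f \<in> {0..?N} \<times> {- ?N..?N} \<times> {0..?N}" using an bn d(3) by (auto simp: abc)
  qed
qed simp

lemma finite_form_classes:
  assumes n: "n > 0"
  shows "finite (form_classes n)"
proof (rule finite_subset)
  show "form_classes n \<subseteq> (\<lambda>f. class_rel n `` {f}) ` {f \<in> forms_of n. reduced f}"
  proof
    fix C assume "C \<in> form_classes n"
    then obtain f where f: "f \<in> forms_of n" "C = class_rel n `` {f}"
      unfolding form_classes_def by (auto elim: quotientE)
    obtain g where g: "g \<in> forms_of n" "sl2_equiv f g" "reduced g" using exists_reduced[OF f(1) n] .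
    have "class_rel n `` {f} = class_rel n `` {g}"
      by (rule equiv_class_eq[OF equiv_class_rel]) (use f g in auto)
    thus "C \<in> (\<lambda>f. class_rel n `` {f}) ` {f \<in> forms_of n. reduced f}" using f g by auto
  qed
  show "finite ((\<lambda>f. class_rel n `` {f}) ` {f \<in> forms_of n. reduced f})"
    using finite_reduced[OF n] by simp
qed

section \<open>Stabilizers and class weights\<close>

definition transporter :: "bqf \<Rightarrow> bqf \<Rightarrow> mat2 set" where
  "transporter f g = {M \<in> SL2. act M f = g}"

text \<open>The matrices carrying f to g form a torsor under either stabilizer; any single one of
  them yields both bijections.\<close>

lemma card_transporter:
  assumes "M0 \<in> transporter f g"
  shows "card (transporter f g) = card (transporter f f)" "card (transporter f g) = card (transporter g g)"
    "finite (transporter f f) \<Longrightarrow> finite (transporter f g)" "finite (transporter g g) \<Longrightarrow> finite (transporter f g)"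
proof -
  have M0: "M0 \<in> SL2" "act M0 f = g" using assms by (auto simp: transporter_def)
  note simps = mat_mul_assoc mat_mul_adj[OF M0(1)] mat_mul_one
  have 1: "bij_betw (\<lambda>A. mat_mul A M0) (transporter f f) (transporter f g)"
  proof (rule bij_betw_byWitness[where f' = "\<lambda>M. mat_mul M (mat_adj M0)"])
    show "(\<lambda>A. mat_mul A M0) ` transporter f f \<subseteq> transporter f g"
      using M0 by (auto simp: transporter_def SL2_mul act_mul[symmetric])
    show "(\<lambda>M. mat_mul M (mat_adj M0)) ` transporter f g \<subseteq> transporter f f"
      using M0 act_adj[OF M0(1), of f] by (auto simp: transporter_def SL2_mul SL2_adj act_mul[symmetric])
  qed (auto simp: simps)
  have 2: "bij_betw (\<lambda>A. mat_mul M0 A) (transporter g g) (transporter f g)"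
  proof (rule bij_betw_byWitness[where f' = "\<lambda>M. mat_mul (mat_adj M0) M"])
    show "(\<lambda>A. mat_mul M0 A) ` transporter g g \<subseteq> transporter f g"
      using M0 by (auto simp: transporter_def SL2_mul act_mul[symmetric])
    show "(\<lambda>M. mat_mul (mat_adj M0) M) ` transporter f g \<subseteq> transporter g g"
      using M0 act_adj[OF M0(1), of f] by (auto simp: transporter_def SL2_mul SL2_adj act_mul[symmetric])
  qed (auto simp: simps simp flip: mat_mul_assoc)
  show "card (transporter f g) = card (transporter f f)" "card (transporter f g) = card (transporter g g)"
    "finite (transporter f f) \<Longrightarrow> finite (transporter f g)" "finite (transporter g g) \<Longrightarrow> finite (transporter f g)"
    using bij_betw_same_card[OF 1] bij_betw_same_card[OF 2] bij_betw_finite[OF 1] bij_betw_finite[OF 2] by simp_all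
qed

text \<open>A matrix M fixing the form with Gram matrix A satisfies A M = (M^T)^(-1) A; these are two of
  the entries of that identity.\<close>

lemma stabilizer_eqs:
  assumes M: "(\<alpha>, \<beta>, \<gamma>, \<delta>) \<in> transporter (a, b, c) (a, b, c)"
  shows "a * (\<alpha> - \<delta>) = - (b * \<gamma>)" "a * \<beta> = - (c * \<gamma>)" "\<alpha> * \<delta> - \<beta> * \<gamma> = 1"
    "a * \<alpha>\<^sup>2 + b * \<alpha> * \<gamma> + c * \<gamma>\<^sup>2 = a"
proof -
  have e: "\<alpha> * \<delta> - \<beta> * \<gamma> = 1" "a * \<alpha>\<^sup>2 + b * \<alpha> * \<gamma> + c * \<gamma>\<^sup>2 = a"
    "2 * a * \<alpha> * \<beta> + b * (\<alpha> * \<delta> + \<beta> * \<gamma>) + 2 * c * \<gamma> * \<delta> = b"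
    "a * \<beta>\<^sup>2 + b * \<beta> * \<delta> + c * \<delta>\<^sup>2 = c"
    using M by (auto simp: transporter_def SL2_def bqf_act_def)
  show "\<alpha> * \<delta> - \<beta> * \<gamma> = 1" "a * \<alpha>\<^sup>2 + b * \<alpha> * \<gamma> + c * \<gamma>\<^sup>2 = a" by (rule e)+
  have "2 * a * \<alpha> + b * \<gamma> = (2 * a * \<alpha> + b * \<gamma>) * (\<alpha> * \<delta> - \<beta> * \<gamma>)" by (simp only: e mult_1_right)
  also have "\<dots> = 2 * \<delta> * (a * \<alpha>\<^sup>2 + b * \<alpha> * \<gamma> + c * \<gamma>\<^sup>2)
      - \<gamma> * (2 * a * \<alpha> * \<beta> + b * (\<alpha> * \<delta> + \<beta> * \<gamma>) + 2 * c * \<gamma> * \<delta>)"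
    by (simp add: power2_eq_square algebra_simps)
  also have "\<dots> = 2 * \<delta> * a - \<gamma> * b" unfolding e ..
  finally show "a * (\<alpha> - \<delta>) = - (b * \<gamma>)" by (simp add: algebra_simps)
  have "2 * a * \<beta> + b * \<delta> = (2 * a * \<beta> + b * \<delta>) * (\<alpha> * \<delta> - \<beta> * \<gamma>)" by (simp only: e mult_1_right)
  also have "\<dots> = \<delta> * (2 * a * \<alpha> * \<beta> + b * (\<alpha> * \<delta> + \<beta> * \<gamma>) + 2 * c * \<gamma> * \<delta>)
      - 2 * \<gamma> * (a * \<beta>\<^sup>2 + b * \<beta> * \<delta> + c * \<delta>\<^sup>2)"
    by (simp add: power2_eq_square algebra_simps)
  also have "\<dots> = \<delta> * b - 2 * \<gamma> * c" unfolding e ..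
  finally show "a * \<beta> = - (c * \<gamma>)" by (simp add: algebra_simps)
qed

lemma square_le_1_int: "(x::int)\<^sup>2 \<le> 1 \<Longrightarrow> x = -1 \<or> x = 0 \<or> x = 1"
proof -
  assume "x\<^sup>2 \<le> 1"
  hence "\<bar>x\<bar> \<le> 1" using abs_le_square_iff[of x 1] by simp
  thus ?thesis by linarith
qed

lemma stabilizer_k0k:
  assumes "k > 0"
  shows "card (transporter (k, 0, k) (k, 0, k)) = 4"
proof -
  have "transporter (k, 0, k) (k, 0, k) = {(1, 0, 0, 1), (-1, 0, 0, -1), (0, -1, 1, 0), (0, 1, -1, 0)}"
  proof (intro equalityI subsetI)
    fix M assume M: "M \<in> transporter (k, 0, k) (k, 0, k)"
    obtain \<alpha> \<beta> \<gamma> \<delta> where m: "M = (\<alpha>, \<beta>, \<gamma>, \<delta>)" by (cases M)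
    note e = stabilizer_eqs[OF M[unfolded m]]
    have "\<delta> = \<alpha>" using e(1) assms by simp
    moreover have "k * (\<beta> + \<gamma>) = 0" using e(2) by (simp add: algebra_simps)
    hence "\<beta> = - \<gamma>" using assms by simp
    moreover have "\<alpha>\<^sup>2 + \<gamma>\<^sup>2 = 1" using e(3) calculation by (simp add: power2_eq_square)
    moreover have "0 \<le> \<alpha>\<^sup>2" "0 \<le> \<gamma>\<^sup>2" by simp_all
    moreover have "\<alpha> = -1 \<or> \<alpha> = 0 \<or> \<alpha> = 1" "\<gamma> = -1 \<or> \<gamma> = 0 \<or> \<gamma> = 1"
      by (rule square_le_1_int, use calculation in linarith)+
    ultimately show "M \<in> {(1, 0, 0, 1), (-1, 0, 0, -1), (0, -1, 1, 0), (0, 1, -1, 0)}"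
      unfolding m by (elim disjE) auto
  qed (auto simp: transporter_def SL2_def bqf_act_def)
  thus ?thesis by simp
qed

lemma stabilizer_kkk:
  assumes "k > 0"
  shows "card (transporter (k, k, k) (k, k, k)) = 6"
proof -
  have "transporter (k, k, k) (k, k, k) = {(1, 0, 0, 1), (-1, 0, 0, -1), (0, -1, 1, 1), (0, 1, -1, -1),
      (1, 1, -1, 0), (-1, -1, 1, 0)}"
  proof (intro equalityI subsetI)
    fix M assume M: "M \<in> transporter (k, k, k) (k, k, k)"
    obtain \<alpha> \<beta> \<gamma> \<delta> where m: "M = (\<alpha>, \<beta>, \<gamma>, \<delta>)" by (cases M)
    note e = stabilizer_eqs[OF M[unfolded m]]
    have "k * (\<alpha> - \<delta> + \<gamma>) = 0" using e(1) by (simp add: algebra_simps)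
    hence d: "\<delta> = \<alpha> + \<gamma>" using assms by simp
    have "k * (\<beta> + \<gamma>) = 0" using e(2) by (simp add: algebra_simps)
    hence b: "\<beta> = - \<gamma>" using assms by simp
    have s: "\<alpha>\<^sup>2 + \<alpha> * \<gamma> + \<gamma>\<^sup>2 = 1" using e(3) unfolding d b by (simp add: power2_eq_square algebra_simps)
    have "(2 * \<alpha> + \<gamma>)\<^sup>2 + 3 * \<gamma>\<^sup>2 = 4 * (\<alpha>\<^sup>2 + \<alpha> * \<gamma> + \<gamma>\<^sup>2)"
      "(2 * \<gamma> + \<alpha>)\<^sup>2 + 3 * \<alpha>\<^sup>2 = 4 * (\<alpha>\<^sup>2 + \<alpha> * \<gamma> + \<gamma>\<^sup>2)"
      by (simp_all add: power2_eq_square algebra_simps)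
    hence sq: "(2 * \<alpha> + \<gamma>)\<^sup>2 + 3 * \<gamma>\<^sup>2 = 4" "(2 * \<gamma> + \<alpha>)\<^sup>2 + 3 * \<alpha>\<^sup>2 = 4" unfolding s by simp_all
    have "0 \<le> (2 * \<alpha> + \<gamma>)\<^sup>2" "0 \<le> (2 * \<gamma> + \<alpha>)\<^sup>2" by simp_all
    hence "\<gamma>\<^sup>2 \<le> 1" "\<alpha>\<^sup>2 \<le> 1" using sq by linarith+
    hence "\<alpha> = -1 \<or> \<alpha> = 0 \<or> \<alpha> = 1" "\<gamma> = -1 \<or> \<gamma> = 0 \<or> \<gamma> = 1"
      by (auto dest!: square_le_1_int)
    thus "M \<in> {(1, 0, 0, 1), (-1, 0, 0, -1), (0, -1, 1, 1), (0, 1, -1, -1),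
      (1, 1, -1, 0), (-1, -1, 1, 0)}"
      unfolding m using s d b by (elim disjE) auto
  qed (auto simp: transporter_def SL2_def bqf_act_def)
  thus ?thesis by simp
qed

text \<open>The stabilizer equations combine to (a tr M)^2 = 4 a^2 - n gamma^2. A reduced form has 3
  a^2 <= n, so gamma is 0 or +-1, and gamma = +-1 forces trace 0 with the form (a, 0, a), or trace
  +-1 with (a, +-a, a). The form (a, - a, a) is excluded by itself because it is only equivalent,
  not equal, to (a, a, a).\<close>

lemma stabilizer_reduced:
  assumes f: "(a, b, c) \<in> forms_of n" "reduced (a, b, c)"
    and ne: "(a, b, c) \<noteq> (a, 0, a)" "(a, b, c) \<noteq> (a, a, a)" "(a, b, c) \<noteq> (a, - a, a)"
  shows "card (transporter (a, b, c) (a, b, c)) = 2"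
proof -
  note d = reduced_disc_bound[OF f]
  have r: "\<bar>b\<bar> \<le> a" "a \<le> c" using f(2) by (auto simp: reduced_def)
  have "transporter (a, b, c) (a, b, c) = {(1, 0, 0, 1), (-1, 0, 0, -1)}"
  proof (intro equalityI subsetI)
    fix M assume M: "M \<in> transporter (a, b, c) (a, b, c)"
    obtain \<alpha> \<beta> \<gamma> \<delta> where m: "M = (\<alpha>, \<beta>, \<gamma>, \<delta>)" by (cases M)
    note e = stabilizer_eqs[OF M[unfolded m]]
    have "(a * (\<alpha> + \<delta>))\<^sup>2 = (a * (\<alpha> - \<delta>))\<^sup>2 + 4 * a\<^sup>2 * (\<alpha> * \<delta> - \<beta> * \<gamma>) + 4 * a * \<gamma> * (a * \<beta>)"
      by (simp add: power2_eq_square algebra_simps)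
    also have "\<dots> = (b * \<gamma>)\<^sup>2 + 4 * a\<^sup>2 - 4 * a * c * \<gamma>\<^sup>2"
      unfolding e by (simp add: power2_eq_square algebra_simps)
    also have "\<dots> = 4 * a\<^sup>2 - int n * \<gamma>\<^sup>2"
      unfolding d(2) by (simp add: power2_eq_square algebra_simps)
    finally have key: "(a * (\<alpha> + \<delta>))\<^sup>2 = 4 * a\<^sup>2 - int n * \<gamma>\<^sup>2" .
    have a2: "a\<^sup>2 > 0" using d(3) by simp
    have "3 * a\<^sup>2 * \<gamma>\<^sup>2 \<le> int n * \<gamma>\<^sup>2" using d(1) by (intro mult_right_mono) auto
    also have "\<dots> \<le> 4 * a\<^sup>2" using key zero_le_power2[of "a * (\<alpha> + \<delta>)"] by linarith
    finally have "a\<^sup>2 * (3 * \<gamma>\<^sup>2) \<le> a\<^sup>2 * 4" by (simp add: mult_ac)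
    hence "3 * \<gamma>\<^sup>2 \<le> 4" using a2 by (simp add: mult_le_cancel_left)
    hence g1: "\<gamma>\<^sup>2 \<le> 1" by linarith
    have "\<gamma> = 0"
    proof (rule ccontr)
      assume "\<gamma> \<noteq> 0"
      hence g: "\<gamma> = 1 \<or> \<gamma> = -1" using square_le_1_int[OF g1] by blast
      hence gg: "\<gamma>\<^sup>2 = 1" by auto
      define t where "t = \<alpha> + \<delta>"
      have nt: "int n = (4 - t\<^sup>2) * a\<^sup>2"
        using key unfolding gg t_def[symmetric] power_mult_distrib by (simp add: algebra_simps)
      hence "3 * a\<^sup>2 \<le> (4 - t\<^sup>2) * a\<^sup>2" using d(1) by simp
      hence "3 \<le> 4 - t\<^sup>2" using a2 by (simp add: mult_le_cancel_right)
      hence "t\<^sup>2 \<le> 1" by simp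
      hence "t = 0 \<or> t\<^sup>2 = 1" using square_le_1_int[of t] by auto
      thus False
      proof
        assume t: "t = 0"
        hence "\<delta> = - \<alpha>" by (simp add: t_def)
        hence "2 * a * \<alpha> = - (b * \<gamma>)" using e(1) by simp
        hence "\<bar>2 * a * \<alpha>\<bar> = \<bar>b\<bar>" using g by (elim disjE) auto
        moreover have "a * (2 * \<bar>\<alpha>\<bar>) = \<bar>2 * a * \<alpha>\<bar>" using d(3) by (simp add: abs_mult)
        ultimately have "a * (2 * \<bar>\<alpha>\<bar>) \<le> a * 1" using r(1) by linarith
        hence "2 * \<bar>\<alpha>\<bar> \<le> 1" by (rule mult_left_le_imp_le[OF _ d(3)])
        hence "\<alpha> = 0" by simp
        hence b0: "b = 0" using \<open>\<bar>2 * a * \<alpha>\<bar> = \<bar>b\<bar>\<close> by simp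
        have "4 * a * c = 4 * a * a" using d(2) nt t b0 by (simp add: power2_eq_square)
        hence "c = a" using d(3) by simp
        thus False using ne(1) b0 by simp
      next
        assume t: "t\<^sup>2 = 1"
        have eq: "4 * a * c = 3 * a\<^sup>2 + b\<^sup>2" using d(2) nt t by simp
        have "b\<^sup>2 \<le> a\<^sup>2" using r by (simp add: abs_le_square_iff[symmetric])
        hence "4 * a * c \<le> 4 * a * a" using eq by (simp add: power2_eq_square)
        hence "c \<le> a" using d(3) by (simp add: mult_le_cancel_left)
        hence ca: "c = a" using r by simp
        hence "b\<^sup>2 = a\<^sup>2" using eq by (simp add: power2_eq_square)
        hence "b = a \<or> b = - a" by (simp add: power2_eq_iff)
        thus False using ne(2,3) ca by blast
      qed
    qed
    moreover have "\<beta> = 0" using e(2) \<open>\<gamma> = 0\<close> d(3) by simp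
    moreover have "\<delta> = \<alpha>" using e(1) \<open>\<gamma> = 0\<close> d(3) by simp
    moreover have "\<alpha>\<^sup>2 = 1" using e(3) calculation by (simp add: power2_eq_square)
    hence "\<alpha> = 1 \<or> \<alpha> = - 1" by (simp add: power2_eq_1_iff)
    ultimately show "M \<in> {(1, 0, 0, 1), (-1, 0, 0, -1)}" unfolding m by auto
  qed (auto simp: transporter_def SL2_def bqf_act_def)
  thus ?thesis by simp
qed

text \<open>Translates the weights 1/2 and 1/3 into stabilizer orders 4 and 6, the generic order
  being 2 because of -1. As the product is nonzero, it also shows that stabilizers are
  finite.\<close>

lemma class_weight_stabilizer:
  assumes C: "C \<in> form_classes n" and f: "f \<in> C" and n: "n > 0"
  shows "class_weight C * real (card (transporter f f)) = 2"
proof -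
  obtain f0 where f0: "f0 \<in> forms_of n" "C = class_rel n `` {f0}"
    using C unfolding form_classes_def by (auto elim: quotientE)
  have mem: "g \<in> C \<longleftrightarrow> g \<in> forms_of n \<and> sl2_equiv f g" for g
    using f unfolding f0(2) using f0(1) sl2_equiv_sym sl2_equiv_trans by blast
  have st: "card (transporter f f) = card (transporter g g)" if "g \<in> C" for g
  proof -
    have "sl2_equiv f g" using mem[of g] that by simp
    then obtain M where "M \<in> SL2" "g = act M f" unfolding sl2_equiv_iff by blast
    hence "M \<in> transporter f g" by (simp add: transporter_def)
    thus ?thesis using card_transporter(1,2) by metis
  qed
  have pos: "k > 0" if "(k, b, c) \<in> C" for k b c
    using that mem by (auto simp: forms_of_def pos_def_def)
  consider k where "(k, 0, k) \<in> C"
    | k where "\<nexists>k. (k, 0, k) \<in> C" "(k, k, k) \<in> C"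
    | "\<nexists>k. (k, 0, k) \<in> C" "\<nexists>k. (k, k, k) \<in> C" by blast
  thus ?thesis
  proof cases
    case 1
    hence "class_weight C = 1 / 2" unfolding class_weight_def by auto
    thus ?thesis using st[OF 1] stabilizer_k0k[OF pos[OF 1]] by simp
  next
    case 2
    hence "class_weight C = 1 / 3" unfolding class_weight_def by auto
    thus ?thesis using st[OF 2(2)] stabilizer_kkk[OF pos[OF 2(2)]] by simp
  next
    case 3
    have w: "class_weight C = 1" using 3 unfolding class_weight_def by auto
    have fF: "f \<in> forms_of n" using f mem by blast
    obtain g where g: "g \<in> forms_of n" "sl2_equiv f g" "reduced g" using exists_reduced[OF fF n] .
    obtain a b c where abc: "g = (a, b, c)" by (cases g)
    have gC: "(a, b, c) \<in> C" using g mem abc by blast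
    \<comment> \<open>Translation by 1 would put (a, a, a) into the class, which is ruled out in
      this case.\<close>
    have "(a, b, c) \<noteq> (a, - a, a)"
    proof
      assume eq: "(a, b, c) = (a, - a, a)"
      have S: "(1, 1, 0, 1) \<in> SL2" by (simp add: SL2_def)
      have "act (1, 1, 0, 1) (a, - a, a) = (a, a, a)" by (simp add: bqf_act_def)
      hence "act (1, 1, 0, 1) g = (a, a, a)" using abc eq by simp
      hence "(a, a, a) \<in> C"
        using mem forms_of_act[OF g(1) S n] sl2_equiv_trans[OF g(2)] sl2_equiv_iff[of g] S by metis
      thus False using 3 by blast
    qed
    hence "card (transporter (a, b, c) (a, b, c)) = 2"
      using 3 gC g abc by (intro stabilizer_reduced[of a b c n]) auto
    thus ?thesis using w st[OF gC] by simp
  qed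
qed

lemma finite_bqf_reps:
  assumes "pos_def f"
  shows "finite {v. bqf_eval f v = k}"
proof -
  obtain a b c where f: "f = (a, b, c)" by (cases f)
  have a: "a > 0" "4 * a * c - b\<^sup>2 > 0" using assms by (auto simp: f pos_def_def)
  define N where "N = 4 * a * \<bar>k\<bar>"
  define X where "X = N + \<bar>b\<bar> * N"
  have "{v. bqf_eval f v = k} \<subseteq> {- X..X} \<times> {- N..N}"
  proof
    fix v assume v: "v \<in> {v. bqf_eval f v = k}"
    obtain x y where xy: "v = (x, y)" by (cases v)
    have eq: "4 * a * k = (2 * a * x + b * y)\<^sup>2 + (4 * a * c - b\<^sup>2) * y\<^sup>2"
      using bqf_eval_square[of a b c x y] v by (simp add: f xy)
    have kN: "4 * a * k \<le> N" using a by (simp add: N_def)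
    have sq: "\<bar>z\<bar> \<le> z\<^sup>2" for z :: int
    proof (cases "z = 0")
      case False
      hence "1 * \<bar>z\<bar> \<le> \<bar>z\<bar> * \<bar>z\<bar>" by (intro mult_right_mono) auto
      thus ?thesis by (simp add: power2_eq_square)
    qed simp
    have "1 * y\<^sup>2 \<le> (4 * a * c - b\<^sup>2) * y\<^sup>2" using a by (intro mult_right_mono) auto
    hence "y\<^sup>2 \<le> N" "(2 * a * x + b * y)\<^sup>2 \<le> N"
      using eq kN zero_le_power2[of "2 * a * x + b * y"] zero_le_power2[of y] by linarith+
    hence y: "\<bar>y\<bar> \<le> N" and z: "\<bar>2 * a * x + b * y\<bar> \<le> N" using sq order_trans by blast+
    have "\<bar>x\<bar> \<le> \<bar>2 * a * x\<bar>" using a mult_right_mono[of 1 "2 * a" "\<bar>x\<bar>"] by (simp add: abs_mult)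
    also have "\<dots> \<le> \<bar>2 * a * x + b * y\<bar> + \<bar>b * y\<bar>" by linarith
    also have "\<bar>b * y\<bar> \<le> \<bar>b\<bar> * N" using y by (simp add: abs_mult mult_left_mono)
    finally have "\<bar>x\<bar> \<le> X" using z by (simp add: X_def)
    thus "v \<in> {- X..X} \<times> {- N..N}" using y by (auto simp: xy)
  qed
  thus ?thesis by (rule finite_subset) simp
qed

section \<open>Counting representations\<close>

definition prim_reps :: "bqf \<Rightarrow> nat \<Rightarrow> (int \<times> int) set" where
  "prim_reps f k = {(x, y). coprime x y \<and> bqf_eval f (x, y) = int k}"

text \<open>Translating a form with leading coefficient k changes b by multiples of 2 k, so b is
  taken modulo 2 k although the congruence is modulo 4 k.\<close>

definition disc_residues :: "nat \<Rightarrow> nat \<Rightarrow> int set" where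
  "disc_residues n k = {b \<in> {0..<2 * int k}. 4 * int k dvd b\<^sup>2 + int n}"

definition residue_form :: "nat \<Rightarrow> nat \<Rightarrow> int \<Rightarrow> bqf" where
  "residue_form n k b = (int k, b, (b\<^sup>2 + int n) div (4 * int k))"

lemma residue_form_in_forms:
  assumes "b \<in> disc_residues n k" "k > 0" "n > 0"
  shows "residue_form n k b \<in> forms_of n"
proof -
  have "4 * int k dvd b\<^sup>2 + int n" using assms by (simp add: disc_residues_def)
  hence "4 * int k * ((b\<^sup>2 + int n) div (4 * int k)) = b\<^sup>2 + int n" by simp
  thus ?thesis using assms by (simp add: residue_form_def forms_of_def pos_def_def bqf_disc_def)
qed

lemma residue_formI:
  assumes "(int k, b, c) \<in> forms_of n" "k > 0" "0 \<le> b" "b < 2 * int k"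
  shows "b \<in> disc_residues n k" "(int k, b, c) = residue_form n k b"
proof -
  have "b\<^sup>2 + int n = 4 * int k * c" using assms(1) by (simp add: forms_of_def bqf_disc_def)
  thus "b \<in> disc_residues n k" "(int k, b, c) = residue_form n k b"
    using assms(2-) by (auto simp: disc_residues_def residue_form_def)
qed

lemma act_translate:
  "act (\<alpha>, \<beta> + j * \<alpha>, \<gamma>, \<delta> + j * \<gamma>) f = act (1, j, 0, 1) (act (\<alpha>, \<beta>, \<gamma>, \<delta>) f)"
  unfolding act_mul by (simp add: algebra_simps)

text \<open>A primitive representation (x, y) is the first column of matrices in SL2 that differ by
  right translations, and exactly one of these brings the middle coefficient into [0, 2 k). So
  primitive representations match pairs of a residue b and a matrix carrying f to
  \<open>residue_form n k b\<close>; for given b such matrices, if any, form a torsor under the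
  stabilizer.\<close>

lemma card_prim_reps:
  assumes C: "C \<in> form_classes n" and f: "f \<in> C" and n: "n > 0" and k: "k > 0"
  shows "card (prim_reps f k) =
    card (transporter f f) * card {b \<in> disc_residues n k. residue_form n k b \<in> C}"
proof -
  define T where "T = {b \<in> disc_residues n k. residue_form n k b \<in> C}"
  define X where "X = (\<Union>b\<in>T. transporter f (residue_form n k b))"
  obtain f0 where f0: "f0 \<in> forms_of n" "C = class_rel n `` {f0}"
    using C unfolding form_classes_def by (auto elim: quotientE)
  have mem: "g \<in> C \<longleftrightarrow> g \<in> forms_of n \<and> sl2_equiv f g" for g
    using f unfolding f0(2) using f0(1) sl2_equiv_sym sl2_equiv_trans by blast
  have fF: "f \<in> forms_of n" using f mem by blast
  \<comment> \<open>An infinite stabilizer would have \<open>card\<close> equal to 0, against the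
    product 2.\<close>
  have "finite (transporter f f)"
    using class_weight_stabilizer[OF C f n] by (intro card_ge_0_finite) (cases "card (transporter f f)", auto)
  have tr: "card (transporter f (residue_form n k b)) = card (transporter f f)"
    "finite (transporter f (residue_form n k b))" if "b \<in> T" for b
  proof -
    have "sl2_equiv f (residue_form n k b)" using that mem[of "residue_form n k b"] by (simp add: T_def)
    then obtain M where "M \<in> SL2" "residue_form n k b = act M f" unfolding sl2_equiv_iff by blast
    hence M: "M \<in> transporter f (residue_form n k b)" by (simp add: transporter_def)
    show "card (transporter f (residue_form n k b)) = card (transporter f f)"
      by (rule card_transporter(1)[OF M])
    show "finite (transporter f (residue_form n k b))"
      by (rule card_transporter(3)[OF M]) fact
  qed
  have finT: "finite T"
    by (rule finite_subset[of _ "{0..<2 * int k}"]) (auto simp: T_def disc_residues_def)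
  have "card X = (\<Sum>b\<in>T. card (transporter f (residue_form n k b)))"
    unfolding X_def
  proof (rule card_UN_disjoint[OF finT])
    show "\<forall>i\<in>T. finite (transporter f (residue_form n k i))" using tr by blast
    show "\<forall>i\<in>T. \<forall>j\<in>T. i \<noteq> j \<longrightarrow>
        transporter f (residue_form n k i) \<inter> transporter f (residue_form n k j) = {}"
      by (auto simp: transporter_def residue_form_def)
  qed
  also have "\<dots> = card (transporter f f) * card T" using tr by simp
  finally have cX: "card X = card (transporter f f) * card T" .
  have "bij_betw (\<lambda>(\<alpha>, \<beta>, \<gamma>, \<delta>). (\<alpha>, \<gamma>)) X (prim_reps f k)"
  proof (rule bij_betwI')
    fix M M' assume MX: "M \<in> X" "M' \<in> X"
    obtain \<alpha> \<beta> \<gamma> \<delta> where m: "M = (\<alpha>, \<beta>, \<gamma>, \<delta>)" by (cases M)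
    obtain \<alpha>' \<beta>' \<gamma>' \<delta>' where m': "M' = (\<alpha>', \<beta>', \<gamma>', \<delta>')" by (cases M')
    obtain b where b: "b \<in> T" "act M f = residue_form n k b" "\<alpha> * \<delta> - \<beta> * \<gamma> = 1"
      using MX by (auto simp: X_def transporter_def m SL2_def)
    obtain b' where b': "b' \<in> T" "act M' f = residue_form n k b'" "\<alpha>' * \<delta>' - \<beta>' * \<gamma>' = 1"
      using MX by (auto simp: X_def transporter_def m' SL2_def)
    show "((case M of (\<alpha>, \<beta>, \<gamma>, \<delta>) \<Rightarrow> (\<alpha>, \<gamma>)) = (case M' of (\<alpha>, \<beta>, \<gamma>, \<delta>) \<Rightarrow> (\<alpha>, \<gamma>))) = (M = M')"
    proof
      assume "(case M of (\<alpha>, \<beta>, \<gamma>, \<delta>) \<Rightarrow> (\<alpha>, \<gamma>)) = (case M' of (\<alpha>, \<beta>, \<gamma>, \<delta>) \<Rightarrow> (\<alpha>, \<gamma>))"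
      hence eq: "\<alpha>' = \<alpha>" "\<gamma>' = \<gamma>" by (auto simp: m m')
      have lin: "\<alpha> * (\<delta>' - \<delta>) = \<gamma> * (\<beta>' - \<beta>)" using b(3) b'(3) by (simp add: eq algebra_simps)
      \<comment> \<open>Two matrices with the same first column differ by a translation; its
        exponent j is recovered from the difference of the second columns by means of the
        determinant 1.\<close>
      define j where "j = (\<beta>' - \<beta>) * \<delta> - (\<delta>' - \<delta>) * \<beta>"
      have "j * \<alpha> = (\<beta>' - \<beta>) * (\<alpha> * \<delta>) - \<beta> * (\<alpha> * (\<delta>' - \<delta>))" by (simp add: j_def algebra_simps)
      also have "\<dots> = (\<beta>' - \<beta>) * (\<alpha> * \<delta> - \<beta> * \<gamma>)" unfolding lin by (simp add: algebra_simps)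
      finally have j1: "\<beta>' = \<beta> + j * \<alpha>" using b(3) by simp
      have "j * \<gamma> = \<delta> * (\<gamma> * (\<beta>' - \<beta>)) - (\<delta>' - \<delta>) * (\<beta> * \<gamma>)" by (simp add: j_def algebra_simps)
      also have "\<dots> = (\<delta>' - \<delta>) * (\<alpha> * \<delta> - \<beta> * \<gamma>)" unfolding lin[symmetric] by (simp add: algebra_simps)
      finally have j2: "\<delta>' = \<delta> + j * \<gamma>" using b(3) by simp
      have "residue_form n k b' = act (1, j, 0, 1) (residue_form n k b)"
        using b(2) b'(2) unfolding m m' eq j1 j2 act_translate by simp
      hence bj: "b' = b + 2 * int k * j" by (simp add: residue_form_def bqf_act_def)
      have "\<bar>b' - b\<bar> < 2 * int k" using b(1) b'(1) by (auto simp: T_def disc_residues_def)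
      hence "2 * int k * \<bar>j\<bar> < 2 * int k * 1" unfolding bj by (simp add: abs_mult)
      hence "j = 0" using k by simp
      thus "M = M'" using j1 j2 eq by (simp add: m m')
    qed auto
  next
    fix M assume MX: "M \<in> X"
    obtain \<alpha> \<beta> \<gamma> \<delta> where m: "M = (\<alpha>, \<beta>, \<gamma>, \<delta>)" by (cases M)
    obtain b where b: "b \<in> T" "act M f = residue_form n k b" "\<alpha> * \<delta> - \<beta> * \<gamma> = 1"
      using MX by (auto simp: X_def transporter_def m SL2_def)
    have "bqf_eval f (\<alpha>, \<gamma>) = int k"
      using act_fst[of \<alpha> \<beta> \<gamma> \<delta> f] b(2) unfolding m residue_form_def by metis
    moreover have "coprime \<alpha> \<gamma>"
    proof (rule coprimeI)
      fix d assume "d dvd \<alpha>" "d dvd \<gamma>"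
      hence "d dvd \<alpha> * \<delta> - \<beta> * \<gamma>" by (intro dvd_diff dvd_mult2 dvd_mult)
      thus "is_unit d" using b(3) by simp
    qed
    ultimately show "(case M of (\<alpha>, \<beta>, \<gamma>, \<delta>) \<Rightarrow> (\<alpha>, \<gamma>)) \<in> prim_reps f k"
      by (simp add: m prim_reps_def)
  next
    fix v assume v: "v \<in> prim_reps f k"
    obtain x y where xy: "v = (x, y)" by (cases v)
    have cop: "coprime x y" and ev: "bqf_eval f (x, y) = int k" using v by (auto simp: xy prim_reps_def)
    \<comment> \<open>A Bezout relation completes the column (x, y) to a matrix of determinant
      1.\<close>
    obtain r s where "r * x + s * y = gcd x y" using bezout_int by blast
    hence rs: "x * r - (- s) * y = 1" using cop by (simp add: algebra_simps)
    obtain a b c where g: "act (x, - s, y, r) f = (a, b, c)" by (cases "act (x, - s, y, r) f")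
    have a: "a = int k" using act_fst[OF g] ev by simp
    define j where "j = - (b div (2 * int k))"
    define M where "M = (x, - s + j * x, y, r + j * y)"
    have MS: "M \<in> SL2" using rs by (simp add: M_def SL2_def algebra_simps)
    have gF: "act M f \<in> forms_of n" by (rule forms_of_act[OF fF MS n])
    define b' where "b' = b + 2 * int k * j"
    obtain c' where aM: "act M f = (int k, b', c')"
      unfolding M_def act_translate g a b'_def by (simp add: bqf_act_def)
    have "b' = b mod (2 * int k)" by (simp add: b'_def j_def minus_mult_div_eq_mod[symmetric])
    hence b': "0 \<le> b'" "b' < 2 * int k" using k by simp_all
    have "b' \<in> disc_residues n k" "act M f = residue_form n k b'"
      using residue_formI[OF gF[unfolded aM] k b'] aM by simp_all
    moreover have "sl2_equiv f (act M f)" using MS unfolding sl2_equiv_iff by blast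
    hence "act M f \<in> C" using mem gF by blast
    hence "residue_form n k b' \<in> C" using calculation(2) by simp
    ultimately have "M \<in> X" using MS by (auto simp: X_def T_def transporter_def)
    moreover have "v = (case M of (\<alpha>, \<beta>, \<gamma>, \<delta>) \<Rightarrow> (\<alpha>, \<gamma>))" by (simp add: M_def xy)
    ultimately show "\<exists>M\<in>X. v = (case M of (\<alpha>, \<beta>, \<gamma>, \<delta>) \<Rightarrow> (\<alpha>, \<gamma>))" by blast
  qed
  from bij_betw_same_card[OF this] cX show ?thesis by (simp add: T_def)
qed

definition class_rep :: "bqf set \<Rightarrow> bqf" where
  "class_rep C = (SOME f. f \<in> C)"

lemma class_rep:
  assumes "C \<in> form_classes n"
  shows "class_rep C \<in> C" "class_rep C \<in> forms_of n"
proof -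
  obtain f where f: "f \<in> forms_of n" "C = class_rel n `` {f}"
    using assms unfolding form_classes_def by (auto elim: quotientE)
  have "f \<in> C" using f sl2_equiv_refl by blast
  thus "class_rep C \<in> C" unfolding class_rep_def by (rule someI)
  thus "class_rep C \<in> forms_of n" using f by blast
qed

text \<open>Half the class weight is the inverse of the stabilizer order and cancels it in
  \<open>card_prim_reps\<close>; each residue form lies in exactly one class, so the remaining
  counts add up to all residues.\<close>

lemma sum_prim_reps:
  assumes n: "n > 0" and k: "k > 0"
  shows "(\<Sum>C\<in>form_classes n. class_weight C / 2 * real (card (prim_reps (class_rep C) k)))
    = real (card (disc_residues n k))"
proof -
  let ?T = "\<lambda>C. {b \<in> disc_residues n k. residue_form n k b \<in> C}"
  have fin: "finite (disc_residues n k)"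
    by (rule finite_subset[of _ "{0..<2 * int k}"]) (auto simp: disc_residues_def)
  have "(\<Sum>C\<in>form_classes n. class_weight C / 2 * real (card (prim_reps (class_rep C) k)))
     = (\<Sum>C\<in>form_classes n. real (card (?T C)))"
  proof (rule sum.cong[OF refl])
    fix C assume C: "C \<in> form_classes n"
    show "class_weight C / 2 * real (card (prim_reps (class_rep C) k)) = real (card (?T C))"
      using card_prim_reps[OF C class_rep(1)[OF C] n k] class_weight_stabilizer[OF C class_rep(1)[OF C] n]
      by (simp add: mult.assoc[symmetric])
  qed
  also have "\<dots> = real (card (\<Union>C\<in>form_classes n. ?T C))"
  proof -
    have "card (\<Union>C\<in>form_classes n. ?T C) = (\<Sum>C\<in>form_classes n. card (?T C))"
    proof (rule card_UN_disjoint[OF finite_form_classes[OF n]])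
      show "\<forall>i\<in>form_classes n. finite (?T i)" using fin by simp
      show "\<forall>i\<in>form_classes n. \<forall>j\<in>form_classes n. i \<noteq> j \<longrightarrow> ?T i \<inter> ?T j = {}"
        using quotient_disj[OF equiv_class_rel[of n]] unfolding form_classes_def by blast
    qed
    thus ?thesis by simp
  qed
  also have "(\<Union>C\<in>form_classes n. ?T C) = disc_residues n k"
  proof -
    have "\<exists>C\<in>form_classes n. residue_form n k b \<in> C" if "b \<in> disc_residues n k" for b
      using residue_form_in_forms[OF that k n] Union_quotient[OF equiv_class_rel[of n]]
      unfolding form_classes_def by blast
    thus ?thesis by blast
  qed
  finally show ?thesis .
qed

text \<open>b has the parity of the discriminant, so b = 2 x + epsilon with x modulo k, and the
  congruence modulo 4 k can be divided by 4.\<close>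

lemma card_disc_residues:
  assumes k: "k > 0" and BC: "B\<^sup>2 - 4 * C = - int n"
  shows "card (disc_residues n k) = quad_roots B C k"
proof -
  define \<epsilon> where "\<epsilon> = B mod 2"
  have e01: "\<epsilon> = 0 \<or> \<epsilon> = 1" by (auto simp: \<epsilon>_def)
  define s where "s = B div 2"
  have B: "B = 2 * s + \<epsilon>" by (simp add: \<epsilon>_def s_def)
  define C' where "C' = C - s\<^sup>2 - \<epsilon> * s"
  have nC: "int n = 4 * C' - \<epsilon>\<^sup>2"
    using BC unfolding B C'_def by (simp add: power2_eq_square algebra_simps)
  have q: "quad_roots B C k = quad_roots \<epsilon> C' k"
    using BC nC k by (intro quad_roots_disc_eq) auto
  have sq: "(2 * x + \<epsilon>)\<^sup>2 + int n = 4 * (x\<^sup>2 + \<epsilon> * x + C')" for x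
    unfolding nC by (simp add: power2_eq_square algebra_simps)
  have "bij_betw (\<lambda>x. 2 * x + \<epsilon>) {x \<in> {0..<int k}. int k dvd x\<^sup>2 + \<epsilon> * x + C'} (disc_residues n k)"
  proof (rule bij_betwI')
    fix x assume "x \<in> {x \<in> {0..<int k}. int k dvd x\<^sup>2 + \<epsilon> * x + C'}"
    hence x: "0 \<le> x" "x < int k" "int k dvd x\<^sup>2 + \<epsilon> * x + C'" by auto
    moreover have "4 * int k dvd 4 * (x\<^sup>2 + \<epsilon> * x + C')" by (rule mult_dvd_mono[OF dvd_refl x(3)])
    ultimately show "2 * x + \<epsilon> \<in> disc_residues n k" using e01 unfolding disc_residues_def mem_Collect_eq sq by auto
  next
    fix b assume b: "b \<in> disc_residues n k"
    have "4 * int k dvd b\<^sup>2 + int n" using b by (simp add: disc_residues_def)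
    moreover have "(2::int) dvd 4 * int k" by simp
    ultimately have "even (b\<^sup>2 + int n)" by (rule dvd_trans[rotated])
    hence "even b \<longleftrightarrow> even \<epsilon>" unfolding nC by simp
    hence "even (b - \<epsilon>)" by simp
    then obtain x where x: "b - \<epsilon> = 2 * x" by (rule evenE)
    hence bx: "b = 2 * x + \<epsilon>" by simp
    have "0 \<le> x" "x < int k" using b e01 by (auto simp: bx disc_residues_def)
    moreover have "4 * int k dvd 4 * (x\<^sup>2 + \<epsilon> * x + C')"
      using b unfolding bx disc_residues_def mem_Collect_eq sq by blast
    hence "int k dvd x\<^sup>2 + \<epsilon> * x + C'" unfolding dvd_mult_cancel_left by simp
    ultimately show "\<exists>x\<in>{x \<in> {0..<int k}. int k dvd x\<^sup>2 + \<epsilon> * x + C'}. b = 2 * x + \<epsilon>" using bx by auto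
  qed auto
  from bij_betw_same_card[OF this] show ?thesis unfolding q by (simp add: quad_roots_def count_mod_def)
qed

definition reps :: "bqf \<Rightarrow> nat \<Rightarrow> (int \<times> int) set" where
  "reps f k = {v. bqf_eval f v = int k}"

lemma bqf_eval_scale: "bqf_eval f (g * x, g * y) = g\<^sup>2 * bqf_eval f (x, y)"
  by (cases f) (simp add: power2_eq_square algebra_simps)

lemma card_reps:
  assumes f: "pos_def f" and k: "k > 0"
  shows "card (reps f k) = (\<Sum>g | g\<^sup>2 dvd k. card (prim_reps f (k div g\<^sup>2)))"
proof -
  let ?G = "{g::nat. g\<^sup>2 dvd k}"
  let ?h = "\<lambda>g::nat. \<lambda>(x, y). (int g * x, int g * y)"
  have gp: "g > 0" if "g \<in> ?G" for g using that k by (cases "g = 0") auto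
  have U: "reps f k = (\<Union>g\<in>?G. ?h g ` prim_reps f (k div g\<^sup>2))"
  proof (intro equalityI subsetI)
    fix v assume v: "v \<in> reps f k"
    obtain x y where xy: "v = (x, y)" by (cases v)
    have ev: "bqf_eval f (x, y) = int k" using v by (simp add: reps_def xy)
    have "(x, y) \<noteq> (0, 0)"
    proof
      assume "(x, y) = (0, 0)"
      hence "bqf_eval f (x, y) = 0" by (cases f) simp
      thus False using ev k by simp
    qed
    hence g0: "gcd x y > 0" by auto
    obtain x' y' where x': "x = x' * gcd x y" "y = y' * gcd x y" "coprime x' y'"
      using gcd_coprime_exists[of x y] g0 by auto
    define g where "g = nat (gcd x y)"
    have ig: "int g = gcd x y" by (simp add: g_def)
    have xg: "x = int g * x'" "y = int g * y'" using x' by (simp_all add: ig mult.commute)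
    have e2: "int k = (int g)\<^sup>2 * bqf_eval f (x', y')" using ev unfolding xg bqf_eval_scale by simp
    hence "int (g\<^sup>2) dvd int k" by simp
    hence gd: "g\<^sup>2 dvd k" by (simp only: of_nat_dvd_iff)
    then obtain l where l: "k = g\<^sup>2 * l" by auto
    have "int g > 0" using g0 by (simp add: ig)
    hence "bqf_eval f (x', y') = int l" using e2 unfolding l by simp
    moreover have "k div g\<^sup>2 = l" using l \<open>int g > 0\<close> by simp
    ultimately have "(x', y') \<in> prim_reps f (k div g\<^sup>2)" using x'(3) by (simp add: prim_reps_def)
    thus "v \<in> (\<Union>g\<in>?G. ?h g ` prim_reps f (k div g\<^sup>2))" using gd xg xy by force
  next
    fix v assume "v \<in> (\<Union>g\<in>?G. ?h g ` prim_reps f (k div g\<^sup>2))"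
    then obtain g x y where g: "g\<^sup>2 dvd k" "v = (int g * x, int g * y)" "bqf_eval f (x, y) = int (k div g\<^sup>2)"
      by (auto simp: prim_reps_def)
    have "bqf_eval f v = int (g\<^sup>2 * (k div g\<^sup>2))" unfolding g(2) bqf_eval_scale g(3) by simp
    thus "v \<in> reps f k" using g(1) by (simp add: reps_def del: of_nat_mult)
  qed
  have fin: "finite (prim_reps f l)" for l
    by (rule finite_subset[OF _ finite_bqf_reps[OF f, of "int l"]]) (auto simp: prim_reps_def)
  have "card (reps f k) = (\<Sum>g\<in>?G. card (?h g ` prim_reps f (k div g\<^sup>2)))"
    unfolding U
  proof (rule card_UN_disjoint)
    show "finite ?G" using k by (rule finite_square_divisors)
    show "\<forall>i\<in>?G. finite (?h i ` prim_reps f (k div i\<^sup>2))" using fin by simp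
    show "\<forall>i\<in>?G. \<forall>j\<in>?G. i \<noteq> j \<longrightarrow> ?h i ` prim_reps f (k div i\<^sup>2) \<inter> ?h j ` prim_reps f (k div j\<^sup>2) = {}"
    proof (intro ballI impI)
      fix i j assume ij: "i \<in> ?G" "j \<in> ?G" "i \<noteq> j"
      have gcds: "gcd (int i * x) (int i * y) = int i" if "(x, y) \<in> prim_reps f (k div i\<^sup>2)" for i x y
      proof -
        have "gcd (int i * x) (int i * y) = \<bar>int i\<bar> * gcd x y" by (simp add: gcd_mult_left abs_mult)
        thus ?thesis using that by (simp add: prim_reps_def)
      qed
      show "?h i ` prim_reps f (k div i\<^sup>2) \<inter> ?h j ` prim_reps f (k div j\<^sup>2) = {}"
      proof (rule ccontr)
        assume "\<not> ?thesis"
        then obtain x y x' y' where "(x, y) \<in> prim_reps f (k div i\<^sup>2)" "(x', y') \<in> prim_reps f (k div j\<^sup>2)"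
          "int i * x = int j * x'" "int i * y = int j * y'" by fastforce
        hence "int i = int j" using gcds[of x y i] gcds[of x' y' j] by metis
        thus False using ij by simp
      qed
    qed
  qed
  also have "\<dots> = (\<Sum>g\<in>?G. card (prim_reps f (k div g\<^sup>2)))"
  proof (rule sum.cong[OF refl])
    fix g assume "g \<in> ?G"
    from gp[OF this] show "card (?h g ` prim_reps f (k div g\<^sup>2)) = card (prim_reps f (k div g\<^sup>2))"
      by (intro card_image) (auto simp: inj_on_def)
  qed
  finally show ?thesis .
qed

theorem weighted_rep_count:
  assumes n: "n > 0" and k: "k > 0" and BC: "B\<^sup>2 - 4 * C = - int n"
  shows "(\<Sum>c\<in>form_classes n. class_weight c / 2 * real (card (reps (class_rep c) k)))
    = real_of_int (rep_sum B C k)"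
proof -
  have "(\<Sum>c\<in>form_classes n. class_weight c / 2 * real (card (reps (class_rep c) k)))
     = (\<Sum>c\<in>form_classes n. \<Sum>g | g\<^sup>2 dvd k. class_weight c / 2 * real (card (prim_reps (class_rep c) (k div g\<^sup>2))))"
  proof (rule sum.cong[OF refl])
    fix c assume "c \<in> form_classes n"
    hence "pos_def (class_rep c)" using class_rep(2) by (auto simp: forms_of_def)
    thus "class_weight c / 2 * real (card (reps (class_rep c) k)) =
        (\<Sum>g | g\<^sup>2 dvd k. class_weight c / 2 * real (card (prim_reps (class_rep c) (k div g\<^sup>2))))"
      by (simp add: card_reps[OF _ k] sum_distrib_left)
  qed
  also have "\<dots> = (\<Sum>g | g\<^sup>2 dvd k. \<Sum>c\<in>form_classes n. class_weight c / 2 * real (card (prim_reps (class_rep c) (k div g\<^sup>2))))"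
    by (rule sum.swap)
  also have "\<dots> = (\<Sum>g | g\<^sup>2 dvd k. real_of_int (int (quad_roots B C (k div g\<^sup>2))))"
  proof (rule sum.cong[OF refl])
    fix g assume "g \<in> {g. g\<^sup>2 dvd k}"
    hence "k div g\<^sup>2 > 0" using k by (auto elim!: dvdE)
    thus "(\<Sum>c\<in>form_classes n. class_weight c / 2 * real (card (prim_reps (class_rep c) (k div g\<^sup>2))))
       = real_of_int (int (quad_roots B C (k div g\<^sup>2)))"
      using sum_prim_reps[OF n] card_disc_residues[OF _ BC] by simp
  qed
  also have "\<dots> = real_of_int (rep_sum B C k)" by (simp add: rep_sum_def)
  finally show ?thesis .
qed

section \<open>Theta series\<close>

lemma has_sum_fibres:
  fixes f :: "'a \<Rightarrow> real"
  assumes f: "(f has_sum S) A" and fin: "\<And>k. finite {x \<in> A. p x = k}"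
  shows "((\<lambda>k. \<Sum>x | x \<in> A \<and> p x = k. f x) has_sum S) UNIV"
proof (rule has_sum_SigmaD)
  have "bij_betw snd (SIGMA k:UNIV. {x \<in> A. p x = k}) A"
    by (rule bij_betwI[where g = "\<lambda>x. (p x, x)"]) auto
  thus "((\<lambda>x. f (snd x)) has_sum S) (SIGMA k:UNIV. {x \<in> A. p x = k})"
    using f by (simp add: has_sum_reindex_bij_betw)
qed (use fin in auto)

lemma has_sum_product_nonneg:
  fixes f g :: "_ \<Rightarrow> real"
  assumes f: "(f has_sum a) A" and g: "(g has_sum b) B"
    and nn: "\<And>x. f x \<ge> 0" "\<And>y. g y \<ge> 0"
  shows "((\<lambda>(x, y). f x * g y) has_sum (a * b)) (A \<times> B)"
proof (rule has_sum_SigmaI)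
  show "((\<lambda>y. case (x, y) of (x, y) \<Rightarrow> f x * g y) has_sum (f x * b)) B" for x
    using has_sum_cmult_right[OF g] by simp
  show "((\<lambda>x. f x * b) has_sum (a * b)) A" by (rule has_sum_cmult_left[OF f])
  have "Infinite_Sum.abs_summable_on (\<lambda>(x, y). f x * g y) (A \<times> B)"
    unfolding Infinite_Sum.abs_summable_on_Sigma_iff
  proof (intro conjI ballI)
    fix x
    have "(\<lambda>y. f x * g y) summable_on B" using has_sum_cmult_right[OF g] has_sum_imp_summable by blast
    thus "Infinite_Sum.abs_summable_on (\<lambda>y. case (x, y) of (x, y) \<Rightarrow> f x * g y) B"
      by (simp add: nn)
  next
    have i: "(\<Sum>\<^sub>\<infinity>y\<in>B. norm (case (x, y) of (x, y) \<Rightarrow> f x * g y)) = f x * b" for x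
      using has_sum_cmult_right[OF g, of "f x"] by (simp add: nn infsumI)
    have b: "b \<ge> 0" by (rule has_sum_nonneg[OF g]) (use nn in auto)
    have "(\<lambda>x. f x * b) summable_on A" using has_sum_cmult_left[OF f] has_sum_imp_summable by blast
    thus "Infinite_Sum.abs_summable_on (\<lambda>x. \<Sum>\<^sub>\<infinity>y\<in>B. norm (case (x, y) of (x, y) \<Rightarrow> f x * g y)) A"
      unfolding i by (simp add: nn b)
  qed
  thus "(\<lambda>(x, y). f x * g y) summable_on A \<times> B" by (rule abs_summable_summable)
qed

section \<open>Theta series of a form\<close>

definition form_theta :: "bqf \<Rightarrow> real \<Rightarrow> real" where
  "form_theta f t = (case f of (a, b, c) \<Rightarrow>
     \<Sum>r\<in>({0..<2 * a} :: int set). gauss_sum (sqrt (t * a)) (b * r / (2 * a))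
       * gauss_sum (sqrt (t * a * (4 * a * c - b\<^sup>2))) (r / (2 * a)))"

text \<open>Completing the square, 4 a (a x^2 + b x y + c y^2) = (2 a x + b y)^2 + n y^2; on each residue class
  of y modulo 2 a the lattice becomes a product of two shifted lattices.\<close>

lemma form_theta_has_sum:
  assumes f: "pos_def f" and t: "(t::real) > 0"
  shows "((\<lambda>v. exp (- t * bqf_eval f v)) has_sum form_theta f t) UNIV"
proof -
  obtain a b c where abc: "f = (a, b, c)" by (cases f)
  define n where "n = 4 * a * c - b\<^sup>2"
  have a: "a > 0" "n > 0" using f by (auto simp: abc pos_def_def n_def)
  define h1 where "h1 = sqrt (t * a)"
  define h2 where "h2 = sqrt (t * a * n)"
  have h: "h1 > 0" "h2 > 0" using a t by (simp_all add: h1_def h2_def)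
  let ?G = "\<lambda>r::int. \<lambda>(x, y). exp (- (h1 * (of_int x + b * r / (2 * a)))\<^sup>2) * exp (- (h2 * (of_int y + r / (2 * a)))\<^sup>2)"
  \<comment> \<open>The shear by b y is chosen so that 2 a u + b v = 2 a x + b r at the image point
    (u, v): the first square no longer involves y.\<close>
  let ?\<phi> = "\<lambda>(r, x, y). (x - b * y, 2 * a * y + r)"
  let ?e = "\<lambda>v. exp (- t * bqf_eval f v)"
  have bij: "bij_betw ?\<phi> ({0..<2 * a} \<times> UNIV \<times> UNIV) UNIV"
    by (rule bij_betwI[where g = "\<lambda>(u, v). (v mod (2 * a), u + b * (v div (2 * a)), v div (2 * a))"])
       (use a in \<open>auto simp: div_mult_self3\<close>)
  have ev: "?e (?\<phi> (r, x, y)) = ?G r (x, y)" for r x y :: int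
  proof -
    have "t * bqf_eval f (x - b * y, 2 * a * y + r)
        = t / (4 * a) * real_of_int (4 * a * bqf_eval (a, b, c) (x - b * y, 2 * a * y + r))"
      using a by (simp add: abc)
    also have "4 * a * bqf_eval (a, b, c) (x - b * y, 2 * a * y + r)
        = (2 * a * x + b * r)\<^sup>2 + n * (2 * a * y + r)\<^sup>2"
      unfolding bqf_eval_square n_def by (simp add: algebra_simps)
    also have "t / (4 * a) * real_of_int \<dots> = t * a * (x + b * r / (2 * a))\<^sup>2 + t * a * n * (y + r / (2 * a))\<^sup>2"
      using a by (simp add: power2_eq_square field_simps)
    also have "\<dots> = (h1 * (of_int x + b * r / (2 * a)))\<^sup>2 + (h2 * (of_int y + r / (2 * a)))\<^sup>2"
      using a t by (simp add: power_mult_distrib h1_def h2_def)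
    finally show ?thesis by (simp flip: exp_add)
  qed
  have G: "(?G r has_sum (gauss_sum h1 (b * r / (2 * a)) * gauss_sum h2 (r / (2 * a)))) (UNIV \<times> UNIV)" for r
    by (rule has_sum_product_nonneg[OF gauss_sum_has_sum[OF h(1)] gauss_sum_has_sum[OF h(2)]]) auto
  have "((\<lambda>(r, v). ?G r v) has_sum (\<Sum>r\<in>({0..<2 * a} :: int set). gauss_sum h1 (b * r / (2 * a)) * gauss_sum h2 (r / (2 * a))))
      ({0..<2 * a} \<times> UNIV)"
  proof (rule has_sum_SigmaI)
    show "((\<lambda>v. case (r, v) of (r, v) \<Rightarrow> ?G r v) has_sum (gauss_sum h1 (b * r / (2 * a)) * gauss_sum h2 (r / (2 * a)))) UNIV" for r
      using G[of r] by simp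
    show "((\<lambda>r. gauss_sum h1 (b * r / (2 * a)) * gauss_sum h2 (r / (2 * a))) has_sum
        (\<Sum>r\<in>({0..<2 * a} :: int set). gauss_sum h1 (b * r / (2 * a)) * gauss_sum h2 (r / (2 * a)))) {0..<2 * a}"
      by (rule has_sum_finite) simp
    have "Infinite_Sum.abs_summable_on (\<lambda>(r, v). ?G r v) ({0..<2 * a} \<times> UNIV)"
      unfolding Infinite_Sum.abs_summable_on_Sigma_iff
    proof (intro conjI ballI)
      fix r :: int
      have "?G r summable_on UNIV" using G[of r] has_sum_imp_summable by simp
      moreover have "(\<lambda>v. norm (case (r, v) of (r, v) \<Rightarrow> ?G r v)) = ?G r" by (auto simp: fun_eq_iff)
      ultimately show "Infinite_Sum.abs_summable_on (\<lambda>v. case (r, v) of (r, v) \<Rightarrow> ?G r v) UNIV" by simp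
    qed simp
    thus "(\<lambda>(r, v). ?G r v) summable_on {0..<2 * a} \<times> UNIV" by (rule abs_summable_summable)
  qed
  also have "(\<lambda>(r, v). ?G r v) = (\<lambda>z. ?e (?\<phi> z))" using ev by (auto simp: fun_eq_iff)
  also have "(\<Sum>r\<in>({0..<2 * a} :: int set). gauss_sum h1 (b * r / (2 * a)) * gauss_sum h2 (r / (2 * a))) = form_theta f t"
    by (simp add: form_theta_def abc h1_def h2_def n_def)
  finally have "((\<lambda>z. ?e (?\<phi> z)) has_sum form_theta f t) ({0..<2 * a} \<times> UNIV \<times> UNIV)" by simp
  thus ?thesis using has_sum_reindex_bij_betw[OF bij, of ?e "form_theta f t"] by blast
qed

text \<open>The subtracted 1 is the zero vector, the only representation of 0 by a definite form;
  grouping by values is possible because each value is taken finitely often.\<close>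

lemma form_theta_sums:
  assumes f: "pos_def f" and t: "(t::real) > 0"
  shows "(\<lambda>k. real (card (reps f (Suc k))) * exp (- t * Suc k)) sums (form_theta f t - 1)"
proof -
  let ?p = "\<lambda>v. nat (bqf_eval f v)"
  have nn: "bqf_eval f v \<ge> 0" for v
  proof (cases "v = (0, 0)")
    case True
    thus ?thesis by (cases f) simp
  next
    case False
    thus ?thesis using bqf_eval_pos[OF f, of "fst v" "snd v"] by simp
  qed
  have fib: "{v \<in> UNIV. ?p v = k} = reps f k" for k using nn by (auto simp: reps_def)
  have fin: "finite (reps f k)" for k using finite_bqf_reps[OF f, of "int k"] by (simp add: reps_def)
  have r0: "reps f 0 = {(0, 0)}"
  proof -
    have "bqf_eval f v = 0 \<longleftrightarrow> v = (0, 0)" for v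
    proof
      assume "bqf_eval f v = 0"
      thus "v = (0, 0)" using bqf_eval_pos[OF f, of "fst v" "snd v"] by (cases "v = (0, 0)") simp_all
    next
      assume "v = (0, 0)"
      thus "bqf_eval f v = 0" by (cases f) simp
    qed
    thus ?thesis by (simp add: reps_def)
  qed
  have "((\<lambda>k. \<Sum>v | v \<in> UNIV \<and> ?p v = k. exp (- t * bqf_eval f v)) has_sum form_theta f t) UNIV"
    by (rule has_sum_fibres[OF form_theta_has_sum[OF f t]]) (simp only: fib fin)
  hence "(\<lambda>k. \<Sum>v | v \<in> UNIV \<and> ?p v = k. exp (- t * bqf_eval f v)) sums form_theta f t"
    by (rule has_sum_imp_sums)
  moreover have "(\<Sum>v | v \<in> UNIV \<and> ?p v = k. exp (- t * bqf_eval f v)) = real (card (reps f k)) * exp (- t * k)" for k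
    unfolding fib by (simp add: reps_def)
  moreover define F where "F = (\<lambda>k. real (card (reps f k)) * exp (- t * k))"
  ultimately have "F sums form_theta f t" by (simp only:)
  hence "F sums ((form_theta f t - F 0) + F 0)" by (simp only: diff_add_cancel)
  hence "(\<lambda>k. F (Suc k)) sums (form_theta f t - F 0)" by (rule iffD2[OF sums_Suc_iff])
  moreover have "F 0 = 1" by (simp add: F_def r0)
  ultimately show ?thesis by (simp only: F_def)
qed

text \<open>In (g / h1 + E1) (g / h2 + E2), with h1 and h2 of order sqrt t and errors O(t), the
  mixed terms are O(sqrt t). The main term does not depend on the shifts, so the 2 a residue classes
  add up to a single c / t without constant term.\<close>

lemma form_theta_asymp:
  assumes f: "pos_def f"
  obtains c where "((\<lambda>t. form_theta f t - c / t) \<longlongrightarrow> 0) (at_right 0)"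
proof -
  obtain a b c where abc: "f = (a, b, c)" by (cases f)
  define n where "n = 4 * a * c - b\<^sup>2"
  have a: "a > 0" "n > 0" using f by (auto simp: abc pos_def_def n_def)
  obtain g M where gM: "\<And>h \<alpha>. 0 < h \<Longrightarrow> \<bar>gauss_sum h \<alpha> - g / h\<bar> \<le> M * h\<^sup>2" using gauss_sum_bound by blast
  define s where "s = sqrt (real_of_int a)"
  define u where "u = sqrt (real_of_int (a * n))"
  have su: "s > 0" "u > 0" using a by (simp_all add: s_def u_def)
  define d where "d = g\<^sup>2 / (s * u)"
  have prod: "((\<lambda>t::real. gauss_sum (sqrt (t * a)) \<alpha> * gauss_sum (sqrt (t * a * n)) \<beta> - d / t) \<longlongrightarrow> 0) (at_right 0)" for \<alpha> \<beta>
  proof (rule Lim_null_comparison)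
    let ?B = "\<lambda>t::real. \<bar>g\<bar> / (sqrt t * s) * (M * (sqrt t * u)\<^sup>2) + \<bar>g\<bar> / (sqrt t * u) * (M * (sqrt t * s)\<^sup>2)
        + (M * (sqrt t * s)\<^sup>2) * (M * (sqrt t * u)\<^sup>2)"
    show "eventually (\<lambda>t::real. norm (gauss_sum (sqrt (t * a)) \<alpha> * gauss_sum (sqrt (t * a * n)) \<beta> - d / t) \<le> ?B t) (at_right 0)"
      using eventually_at_right_less[of 0]
    proof eventually_elim
      case (elim t)
      define h1 where "h1 = sqrt t * s"
      define h2 where "h2 = sqrt t * u"
      have hs: "h1 = sqrt (t * a)" "h2 = sqrt (t * a * n)"
        by (simp_all add: h1_def h2_def s_def u_def real_sqrt_mult mult.assoc)
      have h: "h1 > 0" "h2 > 0" using elim su by (simp_all add: h1_def h2_def)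
      define E1 where "E1 = gauss_sum h1 \<alpha> - g / h1"
      define E2 where "E2 = gauss_sum h2 \<beta> - g / h2"
      have E: "\<bar>E1\<bar> \<le> M * h1\<^sup>2" "\<bar>E2\<bar> \<le> M * h2\<^sup>2" using gM h by (auto simp: E1_def E2_def)
      have "sqrt t * sqrt t = t" using elim by simp
      hence "h1 * h2 = t * (s * u)" by (simp add: h1_def h2_def mult_ac)
      hence dt: "d / t = (g / h1) * (g / h2)" by (simp add: d_def power2_eq_square mult.commute)
      have "gauss_sum h1 \<alpha> * gauss_sum h2 \<beta> - d / t = (g / h1) * E2 + (g / h2) * E1 + E1 * E2"
        unfolding dt E1_def E2_def by (simp add: algebra_simps)
      also have "\<bar>\<dots>\<bar> \<le> \<bar>(g / h1) * E2\<bar> + \<bar>(g / h2) * E1\<bar> + \<bar>E1 * E2\<bar>"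
        by (rule order_trans[OF abs_triangle_ineq add_mono[OF abs_triangle_ineq order_refl]])
      also have "\<dots> = \<bar>g\<bar> / h1 * \<bar>E2\<bar> + \<bar>g\<bar> / h2 * \<bar>E1\<bar> + \<bar>E1\<bar> * \<bar>E2\<bar>"
        using h by (simp add: abs_mult abs_divide)
      also have "\<dots> \<le> \<bar>g\<bar> / h1 * (M * h2\<^sup>2) + \<bar>g\<bar> / h2 * (M * h1\<^sup>2) + (M * h1\<^sup>2) * (M * h2\<^sup>2)"
        using E h by (intro add_mono mult_mono mult_left_mono) auto
      finally show ?case by (simp add: hs[symmetric] h1_def h2_def)
    qed
    show "(?B \<longlongrightarrow> 0) (at_right 0)" using su by real_asymp
  qed
  have "((\<lambda>t::real. \<Sum>r\<in>({0..<2 * a} :: int set). (gauss_sum (sqrt (t * a)) (b * r / (2 * a))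
       * gauss_sum (sqrt (t * a * n)) (r / (2 * a)) - d / t)) \<longlongrightarrow> (\<Sum>r\<in>({0..<2 * a} :: int set). 0)) (at_right 0)"
    by (intro tendsto_sum prod)
  moreover have "(\<Sum>r\<in>({0..<2 * a} :: int set). (gauss_sum (sqrt (t * a)) (b * r / (2 * a))
       * gauss_sum (sqrt (t * a * n)) (r / (2 * a)) - d / t)) = form_theta f t - (2 * a * d) / t" for t :: real
    using a by (simp add: form_theta_def abc n_def sum_subtractf)
  ultimately show ?thesis using that[of "2 * a * d"] by simp
qed

section \<open>The series of 1 * chi_D in powers of exp (- t)\<close>

lemma exp_ratio_deriv:
  fixes p m :: "real poly"
  assumes m: "\<And>q. q \<ge> 0 \<Longrightarrow> poly m q > 0"
  shows "((\<lambda>t. poly p (exp (- t)) / poly m (exp (- t))) has_real_derivative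
     poly (pCons 0 (p * pderiv m - pderiv p * m)) (exp (- t)) / poly (m ^ 2) (exp (- t))) (at t)"
proof -
  have e: "((\<lambda>t. exp (- t)) has_real_derivative - exp (- t)) (at t)"
    by (auto intro!: derivative_eq_intros)
  have d: "((\<lambda>t. poly r (exp (- t))) has_real_derivative poly (pderiv r) (exp (- t)) * (- exp (- t))) (at t)" for r :: "real poly"
    by (rule DERIV_chain2[OF poly_DERIV e])
  have nz: "poly m (exp (- t)) \<noteq> 0" using m[of "exp (- t)"] by simp
  from DERIV_divide[OF d d nz] show ?thesis
    by (rule DERIV_cong) (simp add: power2_eq_square algebra_simps)
qed

lemma exp_ratio_bound:
  fixes p m :: "real poly"
  assumes m: "\<And>q. q \<ge> 0 \<Longrightarrow> poly m q > 0" and p: "poly p 0 = 0"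
  obtains K where "\<And>t. 0 \<le> t \<Longrightarrow> \<bar>poly p (exp (- t)) / poly m (exp (- t))\<bar> \<le> K / (1 + t\<^sup>2)" "K \<ge> 0"
proof -
  obtain r where r: "p = pCons 0 r" using p by (cases p) auto
  have "continuous_on {0..1} (\<lambda>q. poly r q / poly m q)"
    using m by (intro continuous_intros) (auto simp: less_imp_neq[THEN not_sym])
  hence "compact ((\<lambda>q. poly r q / poly m q) ` {0..1})" by (rule compact_continuous_image) simp
  hence "bounded ((\<lambda>q. poly r q / poly m q) ` {0..1})" by (rule compact_imp_bounded)
  then obtain B where "\<forall>y\<in>(\<lambda>q. poly r q / poly m q) ` {0..1}. norm y \<le> B" unfolding bounded_iff by blast
  hence B: "\<bar>poly r q / poly m q\<bar> \<le> B" if "q \<in> {0..1}" for q using that by simp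
  have B0: "B \<ge> 0" by (rule order_trans[OF abs_ge_zero B[of 0]]) simp
  have "\<bar>poly p (exp (- t)) / poly m (exp (- t))\<bar> \<le> (2 * B) / (1 + t\<^sup>2)" if t: "0 \<le> t" for t
  proof -
    have "1 + t + t\<^sup>2 / 2 \<le> exp t" by (rule exp_lower_Taylor_quadratic[OF t])
    hence "(1 + t\<^sup>2) \<le> 2 * exp t" using t by linarith
    moreover have "1 + t\<^sup>2 > 0" by (simp add: add_pos_nonneg)
    ultimately have e: "exp (- t) \<le> 2 / (1 + t\<^sup>2)" by (simp add: exp_minus field_simps)
    have "\<bar>poly p (exp (- t)) / poly m (exp (- t))\<bar> = exp (- t) * \<bar>poly r (exp (- t)) / poly m (exp (- t))\<bar>"
      by (simp add: r abs_mult)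
    also have "\<dots> \<le> 2 / (1 + t\<^sup>2) * B" using t e by (intro mult_mono B) auto
    finally show ?thesis by (simp add: mult.commute)
  qed
  thus ?thesis using that[of "2 * B"] B0 by simp
qed

text \<open>Rational functions of exp (- t) with positive denominator and numerator vanishing at 0
  are closed under differentiation, since the chain rule supplies a factor exp (- t). One decay
  estimate for this family therefore covers all hypotheses of
  \<open>riemann_sum_half_line_asymp\<close>.\<close>

lemma exp_ratio_riemann_sum_asymp:
  fixes p m :: "real poly"
  assumes m: "\<And>q. q \<ge> 0 \<Longrightarrow> poly m q > 0" and p: "poly p 0 = 0"
    and S: "\<And>h. 0 < h \<Longrightarrow> (\<lambda>j. poly p (exp (- (real (Suc j) * h))) / poly m (exp (- (real (Suc j) * h)))) sums S h"
  obtains C where "((\<lambda>h. S h - C / h) \<longlongrightarrow> - (poly p 1 / poly m 1) / 2) (at_right 0)"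
proof -
  define nx where "nx = (\<lambda>(p :: real poly, m :: real poly). (pCons 0 (p * pderiv m - pderiv p * m), m ^ 2))"
  define g where "g = (\<lambda>(p, m) t. poly p (exp (- t)) / poly m (exp (- t)) :: real)"
  define good where "good = (\<lambda>(p :: real poly, m :: real poly). (\<forall>q\<ge>0. poly m q > 0) \<and> poly p 0 = 0)"
  have g_nx: "(g x has_real_derivative g (nx x) t) (at t)" "good (nx x)" if "good x" for x t
    using that exp_ratio_deriv[of "snd x" "fst x" t]
    by (auto simp: g_def nx_def good_def case_prod_unfold poly_power)
  have bd: "\<exists>K\<ge>0. \<forall>t\<ge>0. \<bar>g x t\<bar> \<le> K / (1 + t\<^sup>2)" if "good x" for x
  proof -
    obtain p m where x: "x = (p, m)" by (cases x)
    have pm: "\<And>q. q \<ge> 0 \<Longrightarrow> poly m q > 0" "poly p 0 = 0" using that by (simp_all add: good_def x)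
    obtain K where "\<And>t. 0 \<le> t \<Longrightarrow> \<bar>poly p (exp (- t)) / poly m (exp (- t))\<bar> \<le> K / (1 + t\<^sup>2)" "K \<ge> 0"
      using exp_ratio_bound[OF pm] by blast
    thus ?thesis by (auto simp only: g_def x split)
  qed
  have good0: "good (p, m)" using m p by (simp add: good_def)
  note good1 = g_nx(2)[OF good0] and good2 = g_nx(2)[OF g_nx(2)[OF good0]]
    and good3 = g_nx(2)[OF g_nx(2)[OF g_nx(2)[OF good0]]]
  obtain K0 K1 K3 where K: "K0 \<ge> 0" "\<And>t. t \<ge> 0 \<Longrightarrow> \<bar>g (p, m) t\<bar> \<le> K0 / (1 + t\<^sup>2)"
    "K1 \<ge> 0" "\<And>t. t \<ge> 0 \<Longrightarrow> \<bar>g (nx (p, m)) t\<bar> \<le> K1 / (1 + t\<^sup>2)"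
    "K3 \<ge> 0" "\<And>t. t \<ge> 0 \<Longrightarrow> \<bar>g (nx (nx (nx (p, m)))) t\<bar> \<le> K3 / (1 + t\<^sup>2)"
    using bd[OF good0] bd[OF good1] bd[OF good3] by metis
  define K where "K = K0 + K1 + K3"
  have le: "a / (1 + t\<^sup>2) \<le> K / (1 + t\<^sup>2)" if "a \<le> K" for a t :: real
    using that by (intro divide_right_mono) (auto simp: add_nonneg_nonneg)
  have S': "\<And>h. 0 < h \<Longrightarrow> (\<lambda>j. g (p, m) (real (Suc j) * h)) sums S h"
    using S by (simp add: g_def)
  obtain C where "((\<lambda>h. S h - C / h) \<longlongrightarrow> - g (p, m) 0 / 2) (at_right 0)"
  proof (rule riemann_sum_half_line_asymp[OF g_nx(1)[OF good0] g_nx(1)[OF good1] g_nx(1)[OF good2] _ _ _ S'])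
    fix t :: real assume t: "0 \<le> t"
    show "\<bar>g (p, m) t\<bar> \<le> K / (1 + t\<^sup>2)"
      by (rule order_trans[OF K(2)[OF t] le]) (use K in \<open>simp add: K_def\<close>)
    show "\<bar>g (nx (p, m)) t\<bar> \<le> K / (1 + t\<^sup>2)"
      by (rule order_trans[OF K(4)[OF t] le]) (use K in \<open>simp add: K_def\<close>)
    show "\<bar>g (nx (nx (nx (p, m)))) t\<bar> \<le> K / (1 + t\<^sup>2)"
      by (rule order_trans[OF K(6)[OF t] le]) (use K in \<open>simp add: K_def\<close>)
  qed
  thus ?thesis using that by (simp add: g_def)
qed

lemma summable_exp_Suc:
  assumes "h > 0"
  shows "summable (\<lambda>k. exp (- h * real (Suc k)))"
proof -
  have "summable (\<lambda>k. exp (- h) * exp (- h) ^ k)"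
    using assms by (intro summable_mult summable_geometric) simp
  moreover have "exp (- h * real (Suc k)) = exp (- h) * exp (- h) ^ k" for k
    by (simp flip: exp_of_nat_mult exp_add add: algebra_simps)
  ultimately show ?thesis by simp
qed

text \<open>Numerator of the generating function of chi_D once the factor 1 - q common to it and to
  1 - q^N has been cancelled. The quotient by \<open>geo_poly\<close> is regular at q = 1, where it
  equals the mean of the partial sums.\<close>

definition psum_poly :: "int \<Rightarrow> real poly" where
  "psum_poly D = (\<Sum>k<nat (- D). Polynomial.monom (\<Sum>j\<le>k. of_int (kronecker D (Suc j))) (Suc k))"

definition geo_poly :: "nat \<Rightarrow> real poly" where
  "geo_poly N = (\<Sum>k<N. Polynomial.monom 1 k)"

lemma poly_geo_poly: "poly (geo_poly N) q = (\<Sum>k<N. q ^ k)"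
  by (simp add: geo_poly_def poly_sum poly_monom)

lemma poly_geo_poly_pos: "N > 0 \<Longrightarrow> q \<ge> 0 \<Longrightarrow> poly (geo_poly N) q > 0"
proof -
  assume N: "N > 0" and q: "q \<ge> 0"
  have "(\<Sum>k\<in>{0}. q ^ k) \<le> (\<Sum>k<N. q ^ k)" by (rule sum_mono2) (use N q in auto)
  thus ?thesis by (simp add: poly_geo_poly)
qed

lemma poly_psum_poly: "poly (psum_poly D) q = (\<Sum>k<nat (- D). (\<Sum>j\<le>k. of_int (kronecker D (Suc j))) * q ^ Suc k)"
  by (simp add: psum_poly_def poly_sum poly_monom)

context
  fixes D :: int
  assumes fund: "fundamental_disc D" and neg: "D < 0"
begin

private abbreviation chi :: "nat \<Rightarrow> real" where "chi k \<equiv> of_int (kronecker D k)"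

private lemma chi_abs: "\<bar>chi k\<bar> \<le> 1"
  using kronecker_abs_le_1[of D k] by linarith

lemma L_at_0_psum: "L_at_0 D = poly (psum_poly D) 1 / poly (geo_poly (nat (- D))) 1"
proof -
  have "periodic_zero (nat (- D)) (\<lambda>k. of_int (kronecker D (Suc k)))"
    unfolding periodic_zero_def
  proof (intro conjI allI)
    show "0 < nat (- D)" using neg by simp
    show "of_int (kronecker D (Suc (k + nat (- D)))) = (of_int (kronecker D (Suc k)) :: complex)" for k
      by (simp only: kronecker_periodic[OF fund neg])
    show "(\<Sum>k<nat (- D). of_int (kronecker D (Suc k))) = (0 :: complex)"
      using kronecker_sum_period[OF fund neg] by (metis of_int_0 of_int_sum)
  qed
  from L_at_0_eq[OF this] show ?thesis by (simp add: poly_psum_poly poly_geo_poly)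
qed

text \<open>Periodicity gives (1 - q^N) S as a sum over one period; since chi_D sums to 0 over it,
  Abel summation extracts a factor 1 - q from that side as well.\<close>

lemma kronecker_exp_sums:
  assumes h: "h > 0"
  shows "(\<lambda>k. chi (Suc k) * exp (- h * real (Suc k))) sums
     (poly (psum_poly D) (exp (- h)) / poly (geo_poly (nat (- D))) (exp (- h)))"
proof -
  define N where "N = nat (- D)"
  define q where "q = exp (- h)"
  have q: "0 < q" "q < 1" using h by (simp_all add: q_def)
  have N: "N > 0" using neg by (simp add: N_def)
  have qp: "exp (- h * real k) = q ^ k" for k
    by (simp add: q_def mult.commute flip: exp_of_nat_mult)
  define a where "a = (\<lambda>k. chi (Suc k) * q ^ Suc k)"
  have sm: "summable a"
  proof (rule summable_comparison_test'[where N = 0])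
    show "summable (\<lambda>k. q ^ Suc k)" using q by (intro summable_mult summable_geometric | simp)+
    show "norm (a k) \<le> q ^ Suc k" for k
      using chi_abs[of "Suc k"] q by (simp add: a_def abs_mult mult_left_le_one_le)
  qed
  have "suminf a = (\<Sum>k. a (k + N)) + (\<Sum>k<N. a k)" by (rule suminf_split_initial_segment[OF sm])
  also have "(\<lambda>k. a (k + N)) = (\<lambda>k. q ^ N * a k)"
    using kronecker_periodic[OF fund neg] by (auto simp: a_def N_def power_add fun_eq_iff)
  also have "(\<Sum>k. q ^ N * a k) = q ^ N * suminf a" by (rule suminf_mult[OF sm])
  finally have 1: "(1 - q ^ N) * suminf a = (\<Sum>k<N. a k)"
    unfolding left_diff_distrib mult_1_left by linarith
  define T where "T = (\<lambda>n. \<Sum>j<n. chi (Suc j))"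
  have abel: "(\<Sum>k<n. a k) = (1 - q) * (\<Sum>k<n. T (Suc k) * q ^ Suc k) + T n * q ^ Suc n" for n
  proof (induction n)
    case (Suc n)
    have "T (Suc n) = T n + chi (Suc n)" by (simp add: T_def)
    thus ?case using Suc.IH by (simp add: a_def algebra_simps)
  qed (simp add: T_def)
  have "T N = real_of_int (\<Sum>k<N. kronecker D (Suc k))" by (simp add: T_def)
  hence TN: "T N = 0" using kronecker_sum_period[OF fund neg] by (simp add: N_def)
  have 2: "(\<Sum>k<N. a k) = (1 - q) * poly (psum_poly D) q"
    using abel[of N] TN by (simp add: poly_psum_poly N_def T_def lessThan_Suc_atMost)
  have 3: "1 - q ^ N = (1 - q) * poly (geo_poly N) q"
    unfolding poly_geo_poly by (rule one_diff_power_eq)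
  have "(1 - q) * (poly (geo_poly N) q * suminf a) = (1 - q) * poly (psum_poly D) q"
    using 1 2 3 by (simp add: mult.assoc)
  hence "poly (geo_poly N) q * suminf a = poly (psum_poly D) q" using q by simp
  hence "suminf a = poly (psum_poly D) q / poly (geo_poly N) q"
    using poly_geo_poly_pos[OF N, of q] q by (simp add: field_simps)
  hence "a sums (poly (psum_poly D) q / poly (geo_poly N) q)" using summable_sums[OF sm] by simp
  thus ?thesis unfolding a_def qp q_def[symmetric] N_def .
qed

text \<open>Writing k = i j turns the series into the sum over j of G(j h), where G is the rational
  function of exp (- t) given by the sum of chi_D(i) exp (- i t). This is a half-line Riemann sum,
  whose constant term is - G(0) / 2, and G(0) = L(0, chi_D).\<close>

lemma char_sum_theta_asymp:
  obtains \<Theta> C where "\<And>h. h > 0 \<Longrightarrow> (\<lambda>k. of_int (char_sum D 1 (Suc k)) * exp (- h * real (Suc k))) sums \<Theta> h"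
    "((\<lambda>h. \<Theta> h - C / h) \<longlongrightarrow> - L_at_0 D / 2) (at_right 0)"
proof -
  let ?F = "\<lambda>h (j, i). chi (Suc i) * exp (- h * (real (Suc j) * real (Suc i)))"
  define \<Theta> where "\<Theta> = (\<lambda>h. infsum (?F h) UNIV)"
  have sumF: "(?F h has_sum \<Theta> h) UNIV" if h: "h > 0" for h
  proof -
    have s: "((\<lambda>k. exp (- (h / 2) * real (Suc k))) has_sum (\<Sum>k. exp (- (h / 2) * real (Suc k)))) UNIV"
      using summable_exp_Suc[of "h / 2"] h by (intro norm_summable_imp_has_sum) (auto simp: summable_sums)
    have "(\<lambda>(j, i). exp (- (h / 2) * real (Suc j)) * exp (- (h / 2) * real (Suc i))) summable_on UNIV \<times> UNIV"
      using has_sum_product_nonneg[OF s s] has_sum_imp_summable by (metis (no_types, lifting) exp_ge_zero)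
    hence "(\<lambda>x. norm (?F h x)) summable_on UNIV \<times> UNIV"
    proof (rule summable_on_comparison_test)
      fix x :: "nat \<times> nat"
      obtain j i where x: "x = (j, i)" by (cases x)
      \<comment> \<open>From i + j <= 2 i j for positive i and j, the double series is dominated by
        a product of two geometric series.\<close>
      have "real (Suc j) + real (Suc i) \<le> 2 * (real (Suc j) * real (Suc i))"
        by (simp add: algebra_simps)
      hence "h / 2 * (real (Suc j) + real (Suc i)) \<le> h / 2 * (2 * (real (Suc j) * real (Suc i)))"
        using h by (intro mult_left_mono) auto
      hence "exp (- h * (real (Suc j) * real (Suc i))) \<le> exp (- (h / 2) * real (Suc j) + - (h / 2) * real (Suc i))"
        unfolding exp_le_cancel_iff by (simp del: of_nat_Suc add: field_simps)
      moreover have "\<bar>chi (Suc i)\<bar> * exp (- h * (real (Suc j) * real (Suc i))) \<le> 1 * exp (- h * (real (Suc j) * real (Suc i)))"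
        using chi_abs by (intro mult_right_mono) auto
      ultimately have "\<bar>chi (Suc i)\<bar> * exp (- h * (real (Suc j) * real (Suc i)))
          \<le> exp (- (h / 2) * real (Suc j)) * exp (- (h / 2) * real (Suc i))"
        unfolding mult_1_left exp_add by (rule order_trans[rotated])
      thus "norm (?F h x) \<le> (case x of (j, i) \<Rightarrow> exp (- (h / 2) * real (Suc j)) * exp (- (h / 2) * real (Suc i)))"
        unfolding x by (simp add: abs_mult del: of_nat_Suc)
    qed simp
    hence "?F h summable_on UNIV \<times> UNIV" by (rule abs_summable_summable)
    thus ?thesis unfolding \<Theta>_def by (simp add: has_sum_infsum)
  qed
  let ?p = "psum_poly D" and ?m = "geo_poly (nat (- D))"
  have S: "(\<lambda>j. poly ?p (exp (- (real (Suc j) * h))) / poly ?m (exp (- (real (Suc j) * h)))) sums \<Theta> h" if h: "h > 0" for h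
  proof -
    have "((\<lambda>j. poly ?p (exp (- (real (Suc j) * h))) / poly ?m (exp (- (real (Suc j) * h)))) has_sum \<Theta> h) UNIV"
    proof (rule has_sum_SigmaD[where B = "\<lambda>_. UNIV"])
      show "(?F h has_sum \<Theta> h) (UNIV \<times> UNIV)" using sumF[OF h] by simp
      fix j :: nat
      have jh: "real (Suc j) * h > 0" using h by simp
      have eq: "chi (Suc i) * exp (- (real (Suc j) * h) * real (Suc i)) = ?F h (j, i)" for i by (simp add: mult_ac)
      have "summable (\<lambda>i. norm (chi (Suc i) * exp (- (real (Suc j) * h) * real (Suc i))))"
      proof (rule summable_comparison_test'[OF summable_exp_Suc[OF jh], where N = 0])
        fix i
        have "\<bar>chi (Suc i)\<bar> * exp (- (real (Suc j) * h) * real (Suc i)) \<le> 1 * exp (- (real (Suc j) * h) * real (Suc i))"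
          by (intro mult_right_mono chi_abs) auto
        thus "norm (norm (chi (Suc i) * exp (- (real (Suc j) * h) * real (Suc i)))) \<le> exp (- (real (Suc j) * h) * real (Suc i))"
          by (simp add: abs_mult)
      qed
      from norm_summable_imp_has_sum[OF this kronecker_exp_sums[OF jh]]
      show "((\<lambda>i. ?F h (j, i)) has_sum (poly ?p (exp (- (real (Suc j) * h))) / poly ?m (exp (- (real (Suc j) * h))))) UNIV"
        unfolding eq .
    qed
    thus ?thesis by (rule has_sum_imp_sums)
  qed
  have R: "(\<lambda>k. of_int (char_sum D 1 (Suc k)) * exp (- h * real (Suc k))) sums \<Theta> h" if h: "h > 0" for h
  proof -
    let ?q = "\<lambda>(j, i). Suc j * Suc i"
    have fin: "finite {x \<in> UNIV. ?q x = k}" for k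
    proof (rule finite_subset)
      show "{x \<in> UNIV. ?q x = k} \<subseteq> {..k} \<times> {..k}" by auto
    qed simp
    define G where "G = (\<lambda>k. \<Sum>x | x \<in> UNIV \<and> ?q x = k. ?F h x)"
    have "(G has_sum \<Theta> h) UNIV" unfolding G_def by (rule has_sum_fibres[OF sumF[OF h] fin])
    hence "G sums \<Theta> h" by (rule has_sum_imp_sums)
    moreover have G0: "G 0 = 0"
    proof -
      have "{x :: nat \<times> nat. x \<in> UNIV \<and> ?q x = 0} = {}" by auto
      thus ?thesis unfolding G_def by (simp only: sum.empty)
    qed
    ultimately have "(\<lambda>k. G (Suc k)) sums \<Theta> h" by (intro iffD2[OF sums_Suc_iff]) simp
    moreover have "G k = of_int (char_sum D 1 k) * exp (- h * real k)" if k: "k > 0" for k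
    proof -
      \<comment> \<open>A pair (j, i) stands for the factorization k = (j + 1) (i + 1) with i + 1 =
        d.\<close>
      have bij: "bij_betw (\<lambda>d. (k div d - 1, d - 1)) {d. d dvd k} {x \<in> UNIV. ?q x = k}"
      proof (rule bij_betwI')
        fix d d' assume "d \<in> {d. d dvd k}" "d' \<in> {d. d dvd k}"
        hence "d > 0" "d' > 0" using k by (auto intro!: Nat.gr0I)
        thus "((k div d - 1, d - 1) = (k div d' - 1, d' - 1)) = (d = d')" by auto
      next
        fix d assume "d \<in> {d. d dvd k}"
        then obtain e where e: "k = d * e" by auto
        hence "d > 0" "e > 0" using k by auto
        thus "(k div d - 1, d - 1) \<in> {x \<in> UNIV. ?q x = k}" by (simp del: mult_Suc mult_Suc_right add: e)
      next
        fix x assume x: "x \<in> {x \<in> UNIV. ?q x = k}"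
        obtain j i where ji: "x = (j, i)" by (cases x)
        have k': "k = Suc i * Suc j" using x by (simp add: ji mult.commute del: mult_Suc mult_Suc_right)
        have "k div Suc i = Suc j" unfolding k' by (rule nonzero_mult_div_cancel_left) simp
        moreover have "Suc i dvd k" unfolding k' by (rule dvd_triv_left)
        ultimately show "\<exists>d\<in>{d. d dvd k}. x = (k div d - 1, d - 1)" by (intro bexI[of _ "Suc i"]) (auto simp: ji)
      qed
      have "G k = (\<Sum>d | d dvd k. ?F h (k div d - 1, d - 1))"
        unfolding G_def by (rule sum.reindex_bij_betw[OF bij, symmetric])
      also have "\<dots> = (\<Sum>d | d dvd k. chi d * exp (- h * real k))"
      proof (rule sum.cong[OF refl])
        fix d assume "d \<in> {d. d dvd k}"
        then obtain e where e: "k = d * e" by auto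
        hence "d > 0" "e > 0" using k by auto
        thus "?F h (k div d - 1, d - 1) = chi d * exp (- h * real k)" by (simp add: e mult.commute)
      qed
      also have "\<dots> = of_int (char_sum D 1 k) * exp (- h * real k)"
        by (simp add: char_sum_def sum_distrib_right)
      finally show ?thesis .
    qed
    ultimately show ?thesis by simp
  qed
  have p0: "poly ?p 0 = 0" by (simp add: poly_psum_poly)
  have "nat (- D) > 0" using neg by simp
  from exp_ratio_riemann_sum_asymp[OF poly_geo_poly_pos[OF this] p0 S]
  obtain C where "((\<lambda>h. \<Theta> h - C / h) \<longlongrightarrow> - (poly ?p 1 / poly ?m 1) / 2) (at_right 0)" by blast
  hence "((\<lambda>h. \<Theta> h - C / h) \<longlongrightarrow> - L_at_0 D / 2) (at_right 0)" by (simp only: L_at_0_psum)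
  thus ?thesis using that[of \<Theta> C] R by blast
qed

end

section \<open>The class number formula\<close>

lemma card_prime_factors_prime_mult:
  fixes p d :: nat
  assumes "prime p" "\<not> p dvd d" "d > 0"
  shows "card (prime_factors (p * d)) = Suc (card (prime_factors d))"
proof -
  have "prime_factors (p * d) = insert p (prime_factors d)"
    using assms by (subst prime_factors_product) (auto simp: prime_prime_factors prime_gt_0_nat)
  moreover have "p \<notin> prime_factors d" using assms(2) by auto
  ultimately show ?thesis by simp
qed

lemma moebius_prime_mult:
  fixes p d :: nat
  assumes p: "prime p" and d: "\<not> p dvd d" "d > 0"
  shows "moebius (p * d) = - moebius d"
proof -
  have "coprime p d" using p d by (simp add: prime_imp_coprime)
  hence "squarefree d \<Longrightarrow> squarefree (p * d)"
    using squarefree_prime[OF p] by (rule squarefree_mult_coprime)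
  hence "squarefree (p * d) \<longleftrightarrow> squarefree d" using squarefree_multD(2) by blast
  thus ?thesis using card_prime_factors_prime_mult[OF assms] by (simp add: moebius_def)
qed

lemma moebius_square_dvd:
  fixes p d :: nat
  assumes "prime p" "p\<^sup>2 dvd d"
  shows "moebius d = 0"
proof -
  have "\<not> squarefree d" using assms unfolding squarefree_def by (metis not_prime_unit)
  thus ?thesis by (simp add: moebius_def)
qed

lemma sum_moebius_divisors:
  assumes "g > 0"
  shows "(\<Sum>b | b dvd g. moebius b) = (if g = 1 then 1 else 0)"
proof (cases "g = 1")
  case True
  have "{b::nat. b dvd 1} = {1}" by auto
  thus ?thesis using True by (simp add: moebius_def)
next
  case False
  then obtain p where p: "prime p" "p dvd g" using prime_factor_nat by blast
  obtain j m where m: "g = p ^ j * m" "\<not> p dvd m"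
    using multiplicity_decompose'[of g p] p assms by (metis mult.commute neq0_conv not_prime_unit)
  have m0: "m > 0" using m assms by (cases m) auto
  have j: "j > 0" using p m by (cases j) auto
  have "(\<Sum>b | b dvd g. moebius b) = (\<Sum>x\<in>{..j} \<times> {d. d dvd m}. moebius (case x of (i, d) \<Rightarrow> p ^ i * d))"
    unfolding m(1) by (rule sum.reindex_bij_betw[OF bij_betw_divisors_prime_power[OF p(1) m0 m(2)], symmetric])
  also have "\<dots> = (\<Sum>(i, d)\<in>{..j} \<times> {d. d dvd m}. moebius (p ^ i * d))"
    by (rule sum.cong) auto
  also have "\<dots> = (\<Sum>i\<le>j. \<Sum>d | d dvd m. moebius (p ^ i * d))"
    by (rule sum.cartesian_product[symmetric])
  also have "\<dots> = (\<Sum>i\<in>{0, 1}. \<Sum>d | d dvd m. moebius (p ^ i * d))"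
  proof (rule sum.mono_neutral_right)
    show "\<forall>i\<in>{..j} - {0, 1}. (\<Sum>d | d dvd m. moebius (p ^ i * d)) = 0"
    proof (intro ballI sum.neutral)
      fix i d assume "i \<in> {..j} - {0, 1}"
      hence "p\<^sup>2 dvd p ^ i" by (intro le_imp_power_dvd) auto
      hence "p\<^sup>2 dvd p ^ i * d" by (rule dvd_mult2)
      thus "moebius (p ^ i * d) = 0" by (rule moebius_square_dvd[OF p(1)])
    qed
  qed (use j in auto)
  also have "\<dots> = (\<Sum>d | d dvd m. moebius d) + (\<Sum>d | d dvd m. moebius (p * d))" by simp
  also have "(\<Sum>d | d dvd m. moebius (p * d)) = (\<Sum>d | d dvd m. - moebius d)"
  proof (rule sum.cong[OF refl])
    fix d assume "d \<in> {d. d dvd m}"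
    hence "\<not> p dvd d" "d > 0" using m(2) m0 dvd_trans by (auto intro!: Nat.gr0I)
    thus "moebius (p * d) = - moebius d" by (rule moebius_prime_mult[OF p(1)])
  qed
  finally show ?thesis using False by (simp add: sum_negf)
qed

text \<open>Expanding the coprimality condition with the Moebius function leaves only dilates of the
  unrestricted sum, whose asymptotics are known.\<close>

lemma char_sum_moebius:
  assumes q: "q > 0" and k: "k > 0"
  shows "char_sum D q k =
    (\<Sum>b | b dvd q. moebius b * kronecker D b * (if b dvd k then char_sum D 1 (k div b) else 0))"
proof -
  have fin: "finite {d. d dvd k}" "finite {b. b dvd q}" using q k by simp_all
  have "char_sum D q k = (\<Sum>d | d dvd k. if coprime d q then kronecker D d else 0)"
    unfolding char_sum_def using fin by (simp add: sum.inter_filter[symmetric])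
  also have "\<dots> = (\<Sum>d | d dvd k. \<Sum>b | b dvd q. if b dvd d then moebius b * kronecker D d else 0)"
  proof (rule sum.cong[OF refl])
    fix d
    have g: "gcd d q > 0" using q by simp
    have "(\<Sum>b | b dvd q. if b dvd d then moebius b * kronecker D d else 0)
        = (\<Sum>b \<in> {b \<in> {b. b dvd q}. b dvd d}. moebius b * kronecker D d)"
      using fin(2) by (rule sum.inter_filter[symmetric])
    also have "{b \<in> {b. b dvd q}. b dvd d} = {b. b dvd gcd d q}" by auto
    also have "(\<Sum>b | b dvd gcd d q. moebius b * kronecker D d) = (if gcd d q = 1 then kronecker D d else 0)"
      using sum_moebius_divisors[OF g] by (simp add: sum_distrib_right[symmetric])
    finally show "(if coprime d q then kronecker D d else 0)
        = (\<Sum>b | b dvd q. if b dvd d then moebius b * kronecker D d else 0)"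
      unfolding coprime_iff_gcd_eq_1 by (rule sym)
  qed
  also have "\<dots> = (\<Sum>b | b dvd q. \<Sum>d | d dvd k. if b dvd d then moebius b * kronecker D d else 0)"
    by (rule sum.swap)
  also have "\<dots> = (\<Sum>b | b dvd q. moebius b * kronecker D b * (if b dvd k then char_sum D 1 (k div b) else 0))"
  proof (rule sum.cong[OF refl])
    fix b assume "b \<in> {b. b dvd q}"
    hence b0: "b > 0" using q by (auto intro!: Nat.gr0I)
    have "(\<Sum>d | d dvd k. if b dvd d then moebius b * kronecker D d else 0)
        = (\<Sum>d \<in> {d \<in> {d. d dvd k}. b dvd d}. moebius b * kronecker D d)"
      using fin(1) by (rule sum.inter_filter[symmetric])
    also have "\<dots> = moebius b * kronecker D b * (if b dvd k then char_sum D 1 (k div b) else 0)"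
    proof (cases "b dvd k")
      case True
      then obtain l where l: "k = b * l" by auto
      have l0: "l > 0" using l k by (cases l) auto
      have "bij_betw (\<lambda>e. b * e) {e. e dvd l} {d \<in> {d. d dvd k}. b dvd d}"
        by (rule bij_betwI[where g = "\<lambda>d. d div b"]) (use b0 in \<open>auto simp: l elim!: dvdE\<close>)
      from sum.reindex_bij_betw[OF this, of "\<lambda>d. moebius b * kronecker D d"]
      have "(\<Sum>d \<in> {d \<in> {d. d dvd k}. b dvd d}. moebius b * kronecker D d)
          = (\<Sum>e | e dvd l. moebius b * kronecker D (b * e))" by simp
      also have "\<dots> = (\<Sum>e | e dvd l. moebius b * kronecker D b * kronecker D e)"
      proof (rule sum.cong[OF refl])
        fix e assume "e \<in> {e. e dvd l}"
        hence "e \<noteq> 0" using l0 by auto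
        thus "moebius b * kronecker D (b * e) = moebius b * kronecker D b * kronecker D e"
          using b0 by (simp add: kronecker_mult)
      qed
      also have "\<dots> = moebius b * kronecker D b * char_sum D 1 (k div b)"
        using b0 by (simp add: l char_sum_def sum_distrib_left)
      finally show ?thesis using True by simp
    next
      case False
      hence "{d \<in> {d. d dvd k}. b dvd d} = {}" using dvd_trans by blast
      thus ?thesis using False by (simp only: sum.empty) simp
    qed
    finally show "(\<Sum>d | d dvd k. if b dvd d then moebius b * kronecker D d else 0)
        = moebius b * kronecker D b * (if b dvd k then char_sum D 1 (k div b) else 0)" .
  qed
  finally show ?thesis .
qed

text \<open>A finite combination of dilates k -> k / (b d^2) of 1 * chi_D: in terms of Dirichlet
  series, zeta(s) L(s, chi_D) times the sum of d mu(b) chi_D(b) (b d^2)^(-s).\<close>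

lemma order_sum_expand:
  assumes f: "f > 0" and k: "k > 0"
  shows "order_sum D f k = (\<Sum>d | d dvd f. \<Sum>b | b dvd f div d.
    int d * moebius b * kronecker D b * (if b * d\<^sup>2 dvd k then char_sum D 1 (k div (b * d\<^sup>2)) else 0))"
proof -
  have fin: "finite {d. d dvd f}" using f by simp
  have "order_sum D f k = (\<Sum>d | d dvd f. if d\<^sup>2 dvd k then int d * char_sum D (f div d) (k div d\<^sup>2) else 0)"
    unfolding order_sum_def using fin by (simp add: sum.inter_filter[symmetric])
  also have "\<dots> = (\<Sum>d | d dvd f. \<Sum>b | b dvd f div d.
    int d * moebius b * kronecker D b * (if b * d\<^sup>2 dvd k then char_sum D 1 (k div (b * d\<^sup>2)) else 0))"
  proof (rule sum.cong[OF refl])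
    fix d assume "d \<in> {d. d dvd f}"
    then obtain e where e: "f = d * e" by auto
    hence de: "d > 0" "e > 0" using f by auto
    show "(if d\<^sup>2 dvd k then int d * char_sum D (f div d) (k div d\<^sup>2) else 0) = (\<Sum>b | b dvd f div d.
      int d * moebius b * kronecker D b * (if b * d\<^sup>2 dvd k then char_sum D 1 (k div (b * d\<^sup>2)) else 0))"
    proof (cases "d\<^sup>2 dvd k")
      case True
      then obtain l where l: "k = d\<^sup>2 * l" by auto
      have l0: "l > 0" using l k by (cases l) auto
      have q: "b * d\<^sup>2 dvd k \<longleftrightarrow> b dvd l" "k div (b * d\<^sup>2) = l div b" for b
        using de by (simp_all add: l mult.commute[of b])
      have kd: "k div d\<^sup>2 = l" "f div d = e" using de by (simp_all add: l e)
      show ?thesis unfolding q kd using True char_sum_moebius[OF de(2) l0, of D]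
        by (simp add: sum_distrib_left mult.assoc)
    next
      case False
      hence "\<not> b * d\<^sup>2 dvd k" for b using dvd_mult_right by blast
      thus ?thesis using False by simp
    qed
  qed
  finally show ?thesis .
qed

section \<open>Comparison of constant terms\<close>

lemma sums_multiples:
  fixes r :: "nat \<Rightarrow> real"
  assumes a: "a > 0" and s: "(\<lambda>k. r (Suc k) * exp (- (real a * t) * real (Suc k))) sums S"
  shows "(\<lambda>k. (if a dvd Suc k then r (Suc k div a) else 0) * exp (- t * real (Suc k))) sums S"
proof -
  let ?G = "\<lambda>k. (if a dvd Suc k then r (Suc k div a) else 0) * exp (- t * real (Suc k))"
  \<comment> \<open>Indices are shifted by one: Suc (g k) runs through the positive multiples of
    a.\<close>
  define g where "g = (\<lambda>k. a * Suc k - 1)"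
  have Sg: "Suc (g k) = a * Suc k" for k using a by (simp add: g_def)
  have sm: "strict_mono g" unfolding strict_mono_Suc_iff
  proof
    fix k
    have "Suc (g k) < Suc (g (Suc k))" unfolding Sg using a by simp
    thus "g k < g (Suc k)" by simp
  qed
  have eq: "?G (g k) = r (Suc k) * exp (- (real a * t) * real (Suc k))" for k
    unfolding Sg using a by (simp del: mult_Suc_right add: mult_ac)
  have "(\<lambda>k. ?G (g k)) sums S" using s unfolding eq .
  moreover have "?G n = 0" if n: "n \<notin> range g" for n
  proof -
    have "\<not> a dvd Suc n"
    proof
      assume "a dvd Suc n"
      then obtain c where c: "Suc n = a * c" by auto
      hence "c \<noteq> 0" by (intro notI) simp
      then obtain c' where "c = Suc c'" by (cases c) auto
      hence "Suc n = Suc (g c')" using c Sg by simp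
      thus False using n by auto
    qed
    thus ?thesis by simp
  qed
  ultimately show ?thesis using sums_mono_reindex[OF sm, of ?G S] by simp
qed

text \<open>Multiplying the difference by t first forces a = b; so x and y can be compared without
  knowing either polar coefficient.\<close>

lemma limits_agree:
  fixes F :: "real \<Rightarrow> real"
  assumes 1: "((\<lambda>t. F t - a / t) \<longlongrightarrow> x) (at_right 0)" and 2: "((\<lambda>t. F t - b / t) \<longlongrightarrow> y) (at_right 0)"
  shows "x = y"
proof -
  have t0: "((\<lambda>t::real. t) \<longlongrightarrow> 0) (at_right 0)" by (rule tendsto_ident_at)
  have d: "((\<lambda>t. (F t - a / t) - (F t - b / t)) \<longlongrightarrow> x - y) (at_right 0)" by (rule tendsto_diff[OF 1 2])
  hence "((\<lambda>t. t * ((F t - a / t) - (F t - b / t))) \<longlongrightarrow> 0 * (x - y)) (at_right 0)"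
    by (rule tendsto_mult[OF t0])
  moreover have "eventually (\<lambda>t. t * ((F t - a / t) - (F t - b / t)) = b - a) (at_right 0)"
    using eventually_at_right_less[of 0] by eventually_elim (simp add: field_simps)
  ultimately have "((\<lambda>t::real. b - a) \<longlongrightarrow> 0) (at_right 0)"
    by (simp add: tendsto_cong)
  hence ab: "b - a = 0" by (simp add: tendsto_const_iff)
  hence "((\<lambda>t::real. 0) \<longlongrightarrow> x - y) (at_right (0::real))" using d by simp
  hence "x - y = 0" using tendsto_const_iff[of "at_right (0::real)" 0 "x - y"] by simp
  thus ?thesis by simp
qed

theorem hurwitz_class_number_formula:
  assumes fund: "fundamental_disc D" and neg: "D < 0" and f: "f > 0"
  shows "hurwitz (nat (- D) * f\<^sup>2) = L_at_0 D *
    (\<Sum>d | d dvd f. \<Sum>b | b dvd f div d. real d * of_int (moebius b) * of_int (kronecker D b))"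
proof -
  define n where "n = nat (- D) * f\<^sup>2"
  have n: "n > 0" using neg f by (simp add: n_def)
  obtain B C where BC: "B\<^sup>2 - 4 * C = D"
  proof -
    have "is_disc D" using fund by (simp add: fundamental_disc_def)
    hence "D mod 4 = 0 \<or> D mod 4 = 1" by (simp add: is_disc_def)
    thus ?thesis
    proof
      assume "D mod 4 = 0"
      hence "0\<^sup>2 - 4 * (- (D div 4)) = D" using mult_div_mod_eq[of 4 D] by simp
      thus ?thesis by (rule that)
    next
      assume "D mod 4 = 1"
      hence "1\<^sup>2 - 4 * (- (D div 4)) = D" using mult_div_mod_eq[of 4 D] by simp
      thus ?thesis by (rule that)
    qed
  qed
  have "(int f * B)\<^sup>2 - 4 * ((int f)\<^sup>2 * C) = (int f)\<^sup>2 * (B\<^sup>2 - 4 * C)" by (simp add: power_mult_distrib algebra_simps)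
  also have "\<dots> = - int n" using neg by (simp add: BC n_def)
  finally have disc: "(int f * B)\<^sup>2 - 4 * ((int f)\<^sup>2 * C) = - int n" .
  let ?w = "\<lambda>c. class_weight c / 2"
  let ?P = "\<lambda>t. \<Sum>c\<in>form_classes n. ?w c * (form_theta (class_rep c) t - 1)"
  let ?r = "\<lambda>k. real_of_int (order_sum D f k)"
  have pd: "pos_def (class_rep c)" if "c \<in> form_classes n" for c
    using class_rep(2)[OF that] by (simp add: forms_of_def)
  have L: "(\<lambda>k. ?r (Suc k) * exp (- t * real (Suc k))) sums ?P t" if t: "t > 0" for t
  proof -
    have "(\<lambda>k. \<Sum>c\<in>form_classes n. ?w c * (real (card (reps (class_rep c) (Suc k))) * exp (- t * real (Suc k))))
        sums ?P t"
      by (intro sums_sum sums_mult form_theta_sums pd t)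
    moreover have "(\<Sum>c\<in>form_classes n. ?w c * (real (card (reps (class_rep c) (Suc k))) * exp (- t * real (Suc k))))
       = ?r (Suc k) * exp (- t * real (Suc k))" for k
    proof -
      have "(\<Sum>c\<in>form_classes n. ?w c * real (card (reps (class_rep c) (Suc k)))) = ?r (Suc k)"
        using weighted_rep_count[OF n _ disc, of "Suc k"] rep_sum_eq_order_sum[of B C f "Suc k"] fund f BC by simp
      thus ?thesis by (metis (no_types, lifting) mult.assoc sum.cong sum_distrib_right)
    qed
    ultimately show ?thesis by simp
  qed
  have "\<forall>c\<in>form_classes n. \<exists>a. ((\<lambda>t. form_theta (class_rep c) t - a / t) \<longlongrightarrow> 0) (at_right 0)"
    using form_theta_asymp[OF pd] by blast
  from bchoice[OF this] obtain cc where "\<forall>c\<in>form_classes n.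
      ((\<lambda>t. form_theta (class_rep c) t - cc c / t) \<longlongrightarrow> 0) (at_right 0)" by blast
  hence cc: "((\<lambda>t. form_theta (class_rep c) t - cc c / t) \<longlongrightarrow> 0) (at_right 0)" if "c \<in> form_classes n" for c
    using that by blast
  define A where "A = (\<Sum>c\<in>form_classes n. ?w c * cc c)"
  have lim1: "((\<lambda>t. ?P t - A / t) \<longlongrightarrow> - hurwitz n / 2) (at_right 0)"
  proof -
    have "((\<lambda>t. \<Sum>c\<in>form_classes n. ?w c * ((form_theta (class_rep c) t - cc c / t) - 1)) \<longlongrightarrow>
        (\<Sum>c\<in>form_classes n. ?w c * (0 - 1))) (at_right 0)"
      by (intro tendsto_intros cc)
    moreover have "(\<Sum>c\<in>form_classes n. ?w c * ((form_theta (class_rep c) t - cc c / t) - 1)) = ?P t - A / t" for t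
      unfolding A_def sum_divide_distrib sum_subtractf[symmetric]
      by (intro sum.cong refl) (simp add: right_diff_distrib)
    moreover have "(\<Sum>c\<in>form_classes n. ?w c * (0 - 1)) = - hurwitz n / 2"
      using n by (simp add: hurwitz_def sum_negf sum_divide_distrib)
    ultimately show ?thesis by simp
  qed
  obtain \<Theta> K where \<Theta>: "\<And>h. h > 0 \<Longrightarrow> (\<lambda>k. of_int (char_sum D 1 (Suc k)) * exp (- h * real (Suc k))) sums \<Theta> h"
    "((\<lambda>h. \<Theta> h - K / h) \<longlongrightarrow> - L_at_0 D / 2) (at_right 0)"
    using char_sum_theta_asymp[OF fund neg] by blast
  let ?\<mu> = "\<lambda>d b. real d * of_int (moebius b) * of_int (kronecker D b)"
  let ?Q = "\<lambda>t. \<Sum>d | d dvd f. \<Sum>b | b dvd f div d. ?\<mu> d b * \<Theta> (real (b * d\<^sup>2) * t)"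
  have pos: "b * d\<^sup>2 > 0" if d: "d \<in> {d. d dvd f}" and b: "b \<in> {b. b dvd f div d}" for d b
  proof -
    obtain e where e: "f = d * e" using d by auto
    hence "d > 0" "e > 0" using f by auto
    thus ?thesis using b e by (auto intro!: Nat.gr0I)
  qed
  have R: "(\<lambda>k. ?r (Suc k) * exp (- t * real (Suc k))) sums ?Q t" if t: "t > 0" for t
  proof -
    have "(\<lambda>k. \<Sum>d | d dvd f. \<Sum>b | b dvd f div d. ?\<mu> d b *
        ((if b * d\<^sup>2 dvd Suc k then real_of_int (char_sum D 1 (Suc k div (b * d\<^sup>2))) else 0) * exp (- t * real (Suc k)))) sums ?Q t"
    proof (intro sums_sum sums_mult)
      fix d b assume db: "d \<in> {d. d dvd f}" "b \<in> {b. b dvd f div d}"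
      show "(\<lambda>k. (if b * d\<^sup>2 dvd Suc k then real_of_int (char_sum D 1 (Suc k div (b * d\<^sup>2))) else 0) * exp (- t * real (Suc k)))
        sums \<Theta> (real (b * d\<^sup>2) * t)"
        by (rule sums_multiples[OF pos[OF db], where r = "\<lambda>k. real_of_int (char_sum D 1 k)"])
           (rule \<Theta>(1), use pos[OF db] t in simp)
    qed
    moreover have "(\<Sum>d | d dvd f. \<Sum>b | b dvd f div d. ?\<mu> d b *
        ((if b * d\<^sup>2 dvd Suc k then real_of_int (char_sum D 1 (Suc k div (b * d\<^sup>2))) else 0) * exp (- t * real (Suc k))))
       = ?r (Suc k) * exp (- t * real (Suc k))" for k
    proof -
      have "?r (Suc k) = (\<Sum>d | d dvd f. \<Sum>b | b dvd f div d. ?\<mu> d b *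
        (if b * d\<^sup>2 dvd Suc k then real_of_int (char_sum D 1 (Suc k div (b * d\<^sup>2))) else 0))"
        unfolding order_sum_expand[OF f zero_less_Suc] of_int_sum by (intro sum.cong refl) simp
      thus ?thesis by (simp add: sum_distrib_right mult.assoc)
    qed
    ultimately show ?thesis by simp
  qed
  \<comment> \<open>A dilation by b d^2 divides the polar coefficient by b d^2, whereas the constant
    terms add up with unchanged weights to \<open>?G\<close>.\<close>
  define A' where "A' = (\<Sum>d | d dvd f. \<Sum>b | b dvd f div d. ?\<mu> d b * (K / real (b * d\<^sup>2)))"
  let ?G = "\<Sum>d | d dvd f. \<Sum>b | b dvd f div d. ?\<mu> d b"
  have lim2: "((\<lambda>t. ?Q t - A' / t) \<longlongrightarrow> - (L_at_0 D * ?G) / 2) (at_right 0)"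
  proof -
    have "((\<lambda>t. \<Sum>d | d dvd f. \<Sum>b | b dvd f div d. ?\<mu> d b *
        (\<Theta> (real (b * d\<^sup>2) * t) - K / (real (b * d\<^sup>2) * t))) \<longlongrightarrow>
        (\<Sum>d | d dvd f. \<Sum>b | b dvd f div d. ?\<mu> d b * (- L_at_0 D / 2))) (at_right 0)"
    proof (intro tendsto_sum tendsto_mult tendsto_const)
      fix d b assume db: "d \<in> {d. d dvd f}" "b \<in> {b. b dvd f div d}"
      have a: "real (b * d\<^sup>2) > 0" using pos[OF db] by simp
      have "filterlim (\<lambda>t. real (b * d\<^sup>2) * t) (at_right 0) (at_right 0)"
        using a by real_asymp
      from filterlim_compose[OF \<Theta>(2) this]
      show "((\<lambda>t. \<Theta> (real (b * d\<^sup>2) * t) - K / (real (b * d\<^sup>2) * t)) \<longlongrightarrow> - L_at_0 D / 2) (at_right 0)" .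
    qed
    moreover have "(\<Sum>d | d dvd f. \<Sum>b | b dvd f div d. ?\<mu> d b *
        (\<Theta> (real (b * d\<^sup>2) * t) - K / (real (b * d\<^sup>2) * t))) = ?Q t - A' / t" for t
      unfolding A'_def sum_divide_distrib sum_subtractf[symmetric] right_diff_distrib
      by (intro sum.cong refl) simp
    moreover have "(\<Sum>d | d dvd f. \<Sum>b | b dvd f div d. ?\<mu> d b * (- L_at_0 D / 2)) = - (L_at_0 D * ?G) / 2"
      by (simp flip: sum_distrib_right add: sum_negf sum_divide_distrib[symmetric])
    ultimately show ?thesis by simp
  qed
  have "eventually (\<lambda>t. ?Q t - A' / t = ?P t - A' / t) (at_right 0)"
    using eventually_at_right_less[of 0] by eventually_elim (use L R sums_unique2 in force)
  from tendsto_cong[OF this] lim2 have "((\<lambda>t. ?P t - A' / t) \<longlongrightarrow> - (L_at_0 D * ?G) / 2) (at_right 0)" by blast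
  from limits_agree[OF lim1 this] show ?thesis by (simp add: n_def)
qed

section \<open>Conductors and local factors\<close>

lemma is_disc_square_mult:
  assumes "is_disc D"
  shows "is_disc (D * x\<^sup>2)"
proof (cases "even x")
  case True
  then obtain y where "x = 2 * y" by auto
  hence "D * x\<^sup>2 = 4 * (D * y\<^sup>2)" by (simp add: power2_eq_square)
  hence "(D * x\<^sup>2) mod 4 = 0" by (metis mod_mult_self1_is_0)
  thus ?thesis unfolding is_disc_def by blast
next
  case False
  thus ?thesis using is_disc_odd_square_mult assms by blast
qed

lemma fundamental_disc_no_square:
  assumes "fundamental_disc (D * x\<^sup>2)" "is_disc D" "x > 0"
  shows "x = 1"
  using assms unfolding fundamental_disc_def by (metis less_le not_less zless_imp_add1_zle add_0)

text \<open>After division by the gcd, D = M v^2 and E = M u^2 with u and v coprime. One of u, v is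
  odd, so M is itself a discriminant, and fundamentality forces u = v = 1.\<close>

lemma fundamental_disc_square_eq:
  fixes a b :: nat
  assumes D: "fundamental_disc D" and E: "fundamental_disc E" and pos: "a > 0" "b > 0"
    and eq: "D * (int a)\<^sup>2 = E * (int b)\<^sup>2"
  shows "a = b" "D = E"
proof -
  define g where "g = gcd a b"
  obtain u v where uv: "a = u * g" "b = v * g" "coprime u v"
    using gcd_coprime_exists[of a b] pos unfolding g_def by auto
  have p: "u > 0" "v > 0" "g > 0" using uv pos by (auto intro!: Nat.gr0I)
  have "(int g)\<^sup>2 * (D * (int u)\<^sup>2) = (int g)\<^sup>2 * (E * (int v)\<^sup>2)"
    using eq by (simp add: uv power_mult_distrib mult_ac)
  hence eq': "D * (int u)\<^sup>2 = E * (int v)\<^sup>2" using p by simp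
  have cop: "coprime ((int u)\<^sup>2) ((int v)\<^sup>2)" using uv(3) by simp
  have "(int v)\<^sup>2 dvd D * (int u)\<^sup>2" unfolding eq' by simp
  hence "(int v)\<^sup>2 dvd D" using cop by (simp add: coprime_commute coprime_dvd_mult_left_iff)
  then obtain M where "D = (int v)\<^sup>2 * M" by (rule dvdE)
  hence M: "D = M * (int v)\<^sup>2" by (simp only: mult.commute)
  have "(int v)\<^sup>2 * (M * (int u)\<^sup>2) = (int v)\<^sup>2 * E" using eq' by (simp add: M mult_ac)
  hence M': "E = M * (int u)\<^sup>2" using p by simp
  have disc: "is_disc D" "is_disc E" using D E by (auto simp: fundamental_disc_def)
  have "u = 1 \<and> v = 1"
  proof (cases "odd u")
    case True
    hence "is_disc M" using is_disc_odd_square_mult[of "int u" M] disc M' by simp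
    thus ?thesis using fundamental_disc_no_square[of M "int u"] fundamental_disc_no_square[of M "int v"] D E M M' p by simp
  next
    case False
    hence "odd v" using uv(3) coprime_common_divisor[of u v 2] by auto
    hence "is_disc M" using is_disc_odd_square_mult[of "int v" M] disc M by simp
    thus ?thesis using fundamental_disc_no_square[of M "int u"] fundamental_disc_no_square[of M "int v"] D E M M' p by simp
  qed
  thus "a = b" "D = E" using uv M M' by simp_all
qed

text \<open>Take the largest F for which - n / F^2 is a discriminant; a further square factor would
  enlarge it.\<close>

lemma fundamental_decomposition_exists:
  assumes n: "n > 0" and d: "is_disc (- int n)"
  obtains D F where "fundamental_disc D" "D < 0" "F > 0" "n = nat (- D) * F\<^sup>2"
proof -
  let ?P = "\<lambda>f. f > 0 \<and> f\<^sup>2 dvd n \<and> is_disc (- int (n div f\<^sup>2))"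
  have fin: "finite {f. ?P f}" by (rule finite_subset[OF _ finite_square_divisors[OF n]]) auto
  have ne: "{f. ?P f} \<noteq> {}" using d by (auto intro!: exI[of _ 1])
  define F where "F = Max {f. ?P f}"
  have F: "?P F" using Max_in[OF fin ne] by (simp add: F_def)
  define D where "D = - int (n div F\<^sup>2)"
  have nF: "n = nat (- D) * F\<^sup>2" using F by (simp add: D_def)
  have D0: "D < 0" using nF n by (cases "D < 0") auto
  have "fundamental_disc D"
    unfolding fundamental_disc_def
  proof (intro conjI notI)
    show "is_disc D" using F by (simp add: D_def)
    assume "\<exists>D' f. is_disc D' \<and> 1 < f \<and> D = D' * f\<^sup>2"
    then obtain D' f where f: "is_disc D'" "f > 1" "D = D' * f\<^sup>2" by blast
    define g where "g = nat f"
    have g: "f = int g" "g > 1" using f(2) by (simp_all add: g_def)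
    have D'0: "D' < 0" using D0 f by (simp add: mult_less_0_iff)
    have "nat (- D) = nat (- D') * g\<^sup>2"
      unfolding f(3) g(1) using D'0 by (simp flip: mult_minus_left add: nat_mult_distrib nat_power_eq)
    hence n2: "n = nat (- D') * (g * F)\<^sup>2" using nF by (simp add: power_mult_distrib)
    have "(g * F)\<^sup>2 > 0" using g F by simp
    hence "n div (g * F)\<^sup>2 = nat (- D')" unfolding n2 by simp
    hence "?P (g * F)" using g F f(1) D'0 n2 by simp
    hence "g * F \<le> F" unfolding F_def using fin by (intro Max_ge) auto
    thus False using g F by simp
  qed
  thus ?thesis using that D0 F nF by blast
qed

lemma cond_f_eqI:
  assumes D: "fundamental_disc D" "D < 0" and F: "F > 0" and n: "n = nat (- D) * F\<^sup>2"
  shows "cond_f n = F" "fund_D n = D"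
proof -
  have q: "n div F\<^sup>2 = nat (- D)" using F by (simp add: n)
  show c: "cond_f n = F"
    unfolding cond_f_def
  proof (rule the_equality)
    show "F > 0 \<and> F\<^sup>2 dvd n \<and> fundamental_disc (- int (n div F\<^sup>2))"
      using F D by (simp add: q) (simp add: n)
    fix f assume f: "f > 0 \<and> f\<^sup>2 dvd n \<and> fundamental_disc (- int (n div f\<^sup>2))"
    have "int n = int (n div f\<^sup>2) * (int f)\<^sup>2" using f by (metis dvd_div_mult_self of_nat_mult of_nat_power)
    moreover have "int n = - D * (int F)\<^sup>2" using D by (simp add: n)
    ultimately have "- int (n div f\<^sup>2) * (int f)\<^sup>2 = D * (int F)\<^sup>2" by simp
    from fundamental_disc_square_eq(1)[OF _ D(1) _ F this] f show "f = F" by blast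
  qed
  show "fund_D n = D" using D by (simp add: fund_D_def c q)
qed

section \<open>The part of the conductor supported on N\<close>

lemma coprime_prime_factors_subset:
  fixes a b x :: nat
  assumes "prime_factors a \<subseteq> prime_factors b" "coprime x b" "a > 0"
  shows "coprime x a"
proof (rule ccontr)
  assume "\<not> coprime x a"
  hence "gcd x a \<noteq> 1" by (simp only: coprime_iff_gcd_eq_1 not_False_eq_True)
  then obtain p where p: "prime p" "p dvd gcd x a" using prime_factor_nat by blast
  hence "p \<in> prime_factors a" using assms(3) by (intro prime_factorsI) auto
  hence "p dvd b" using assms(1) by auto
  moreover have "p dvd x" using p by auto
  ultimately have "is_unit p" using assms(2) coprime_common_divisor by blast
  thus False using p not_prime_unit by blast
qed

definition smooth_part :: "nat set \<Rightarrow> nat \<Rightarrow> nat" where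
  "smooth_part P F = (\<Prod>p\<in>P. p ^ multiplicity p F)"

lemma smooth_part_decomp:
  assumes F: "F > 0" and N: "N > 0"
  obtains R where "F = smooth_part (prime_factors N) F * R" "coprime R N" "R > 0"
    "prime_factors (smooth_part (prime_factors N) F) \<subseteq> prime_factors N"
    "prime_factors R = prime_factors F - prime_factors N"
    "smooth_part (prime_factors N) F > 0"
proof -
  let ?P = "prime_factors N" and ?Q = "prime_factors F - prime_factors N"
  define R where "R = (\<Prod>p\<in>?Q. p ^ multiplicity p F)"
  have pp: "p > 0" if "p \<in> prime_factors k" for p k :: nat
    using that prime_gt_0_nat in_prime_factors_imp_prime by blast
  have pos: "smooth_part ?P F > 0" "R > 0"
    unfolding smooth_part_def R_def by (auto intro!: prod_pos dest: pp)
  have "F = (\<Prod>p\<in>prime_factors F. p ^ multiplicity p F)" by (rule prime_factorization_nat[OF F])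
  also have "\<dots> = (\<Prod>p\<in>?P \<union> ?Q. p ^ multiplicity p F)"
  proof (rule prod.mono_neutral_left)
    show "\<forall>i\<in>?P \<union> ?Q - prime_factors F. i ^ multiplicity i F = 1"
      by (auto simp: prime_factors_multiplicity)
  qed auto
  also have "\<dots> = smooth_part ?P F * R"
    unfolding smooth_part_def R_def by (rule prod.union_disjoint) auto
  finally have FR: "F = smooth_part ?P F * R" .
  have s: "prime_factors (smooth_part ?P F) \<subseteq> ?P"
  proof
    fix p assume p: "p \<in> prime_factors (smooth_part ?P F)"
    hence "prime p" "p dvd smooth_part ?P F" by auto
    then obtain q where q: "q \<in> ?P" "p dvd q ^ multiplicity q F"
      unfolding smooth_part_def using prime_dvd_prod_iff[of ?P p] by auto
    hence "p dvd q" using \<open>prime p\<close> prime_dvd_power by blast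
    hence "p = q" using \<open>prime p\<close> q(1) primes_dvd_imp_eq by blast
    thus "p \<in> ?P" using q by simp
  qed
  have r: "prime_factors R = ?Q"
  proof
    show "prime_factors R \<subseteq> ?Q"
    proof
      fix p assume p: "p \<in> prime_factors R"
      hence "prime p" "p dvd R" by auto
      then obtain q where q: "q \<in> ?Q" "p dvd q ^ multiplicity q F"
        unfolding R_def using prime_dvd_prod_iff[of ?Q p] by auto
      hence "p dvd q" using \<open>prime p\<close> prime_dvd_power by blast
      hence "p = q" using \<open>prime p\<close> q(1) primes_dvd_imp_eq by blast
      thus "p \<in> ?Q" using q by simp
    qed
    show "?Q \<subseteq> prime_factors R"
    proof
      fix p assume p: "p \<in> ?Q"
      hence "prime p" "p dvd smooth_part ?P F * R" using FR by auto
      moreover have "\<not> p dvd smooth_part ?P F"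
        using s p pos \<open>prime p\<close> by (auto simp: in_prime_factors_iff)
      ultimately show "p \<in> prime_factors R" using pos by (auto simp: prime_dvd_mult_iff in_prime_factors_iff)
    qed
  qed
  have "coprime R N"
  proof (rule ccontr)
    assume "\<not> coprime R N"
    hence "gcd R N \<noteq> 1" by (simp only: coprime_iff_gcd_eq_1 not_False_eq_True)
    then obtain p where p: "prime p" "p dvd gcd R N" using prime_factor_nat by blast
    hence "p \<in> prime_factors R" "p \<in> prime_factors N" using pos N by (auto simp: in_prime_factors_iff)
    thus False using r by blast
  qed
  thus ?thesis using that FR pos s r by blast
qed

lemma multiplicity_smooth_part:
  assumes "F > 0" "N > 0" "p \<in> prime_factors N"
  shows "multiplicity p (smooth_part (prime_factors N) F) = multiplicity p F"
proof -
  obtain R where R: "F = smooth_part (prime_factors N) F * R" "coprime R N" "R > 0"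
    "smooth_part (prime_factors N) F > 0" using smooth_part_decomp[OF assms(1,2)] by metis
  have p: "prime p" "p dvd N" using assms(3) by auto
  have "\<not> p dvd R" using R(2) p coprime_common_divisor not_prime_unit by blast
  hence "multiplicity p R = 0" by (rule not_dvd_imp_multiplicity_0)
  moreover have "multiplicity p (smooth_part (prime_factors N) F * R)
      = multiplicity p (smooth_part (prime_factors N) F) + multiplicity p R"
    using R p by (intro prime_elem_multiplicity_mult_distrib) auto
  ultimately show ?thesis using R(1) by simp
qed

text \<open>For any admissible y, - n / y^2 is again a discriminant, so uniqueness of the conductor
  gives F = G y; having only primes of N, y divides the N-part of F.\<close>

lemma f_LSZ_eq:
  assumes D: "fundamental_disc D" "D < 0" and F: "F > 0" and n: "n = nat (- D) * F\<^sup>2"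
    and N: "N1 * N2 = N" "N > 0"
  shows "f_LSZ N1 N2 n = smooth_part (prime_factors N) F"
proof -
  let ?S = "smooth_part (prime_factors N) F"
  obtain R where R: "F = ?S * R" "coprime R N" "R > 0"
    "prime_factors ?S \<subseteq> prime_factors N" "?S > 0"
    using smooth_part_decomp[OF F N(2)] by metis
  have nS: "n = nat (- D) * R\<^sup>2 * ?S\<^sup>2" unfolding n by (subst R(1)) (simp add: power_mult_distrib mult_ac)
  show ?thesis
    unfolding f_LSZ_def N(1)
  proof (rule Greatest_equality)
    have "n div ?S\<^sup>2 = nat (- D) * R\<^sup>2" using R(5) by (subst nS) simp
    hence "- int (n div ?S\<^sup>2) = D * (int R)\<^sup>2" using D by simp
    hence "is_disc (- int (n div ?S\<^sup>2))"
      using is_disc_square_mult[of D "int R"] D by (simp add: fundamental_disc_def)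
    moreover have "?S\<^sup>2 dvd n" using nS by simp
    ultimately show "?S > 0 \<and> prime_factors ?S \<subseteq> prime_factors N \<and> ?S\<^sup>2 dvd n \<and> is_disc (- int (n div ?S\<^sup>2))"
      using R by blast
  next
    fix y assume y: "y > 0 \<and> prime_factors y \<subseteq> prime_factors N \<and> y\<^sup>2 dvd n \<and> is_disc (- int (n div y\<^sup>2))"
    define n' where "n' = n div y\<^sup>2"
    have ny: "n = n' * y\<^sup>2" using y by (simp add: n'_def)
    have n0: "n > 0" using D F by (simp add: n)
    hence n'0: "n' > 0" using ny by (cases n') auto
    obtain E G where E: "fundamental_disc E" "E < 0" "G > 0" "n' = nat (- E) * G\<^sup>2"
      using fundamental_decomposition_exists[OF n'0] y unfolding n'_def by blast
    have "n = nat (- E) * (G * y)\<^sup>2" using ny E(4) by (simp add: power_mult_distrib)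
    from cond_f_eqI(1)[OF E(1,2) _ this] E y have "cond_f n = G * y" by simp
    hence "F = G * y" using cond_f_eqI(1)[OF D F n] by simp
    hence "y dvd ?S * R" using R(1) by simp
    moreover have "coprime R y" using coprime_prime_factors_subset[of y N R] y R(2) by blast
    hence "coprime y R" by (simp add: coprime_commute)
    ultimately have "y dvd ?S" by (simp add: coprime_dvd_mult_left_iff)
    thus "y \<le> ?S" using R(5) by (intro dvd_imp_le)
  qed
qed

text \<open>\<open>H_LSZ\<close> evaluates symbols of D R^2 and \<open>H_PW\<close> symbols of D;
  this identifies them at the primes of N, which do not divide R.\<close>

lemma kronecker_square_mult:
  assumes "prime p" "odd p" "\<not> p dvd x"
  shows "kronecker (D * (int x)\<^sup>2) p = kronecker D p"
proof -
  have p2: "2 < p" using odd_prime_gt_2 assms by blast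
  have "Legendre (int x) (int p) \<noteq> 0" using assms(3) by (simp add: Legendre_def cong_0_iff)
  hence "Legendre (int x) (int p) * Legendre (int x) (int p) = 1"
    using Legendre_values[of "int x" "int p"] by auto
  moreover have "p \<noteq> 2" using p2 by simp
  ultimately show ?thesis
    unfolding kronecker_prime[OF assms(1)] kron_prime_def power2_eq_square
    by (simp add: Legendre_mult[OF assms(1) p2])
qed

lemma squarefree_divisor_quotient:
  fixes N m :: nat
  assumes "squarefree N" "m dvd N" "N > 0"
  shows "coprime m (N div m)" "prime_factors (N div m) = prime_factors N - prime_factors m"
    "m > 0" "N div m > 0" "squarefree m" "squarefree (N div m)"
proof -
  obtain M where M: "N = m * M" using assms(2) by auto
  have pos: "m > 0" "M > 0" using M assms(3) by auto
  have MM: "N div m = M" using M pos by simp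
  have "squarefree (m * M)" using assms(1) M by simp
  thus "squarefree m" "squarefree (N div m)" unfolding MM by (rule squarefree_multD)+
  show "m > 0" "N div m > 0" using pos MM by auto
  show cop: "coprime m (N div m)"
  proof (rule coprimeI)
    fix d assume "d dvd m" "d dvd N div m"
    hence "d * d dvd m * M" unfolding MM by (rule mult_dvd_mono)
    hence "d\<^sup>2 dvd N" by (simp only: power2_eq_square M)
    thus "is_unit d" using assms(1) squarefreeD by blast
  qed
  have "prime_factors N = prime_factors m \<union> prime_factors M" unfolding M using pos by (simp add: prime_factors_product)
  moreover have "prime_factors m \<inter> prime_factors M = {}"
  proof (rule equals0I)
    fix p assume "p \<in> prime_factors m \<inter> prime_factors M"
    hence "prime p" "p dvd m" "p dvd M" by auto
    thus False using cop unfolding MM by (metis coprime_common_divisor not_prime_unit)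
  qed
  ultimately show "prime_factors (N div m) = prime_factors N - prime_factors m" unfolding MM by blast
qed

lemma squarefree_eq_prod_prime_factors:
  fixes g :: nat
  assumes "squarefree g"
  shows "g = \<Prod>(prime_factors g)"
proof -
  have g: "g \<noteq> 0" using assms by (intro notI) simp
  have "g = (\<Prod>p\<in>prime_factors g. p ^ multiplicity p g)" using g by (intro prime_factorization_nat) simp
  also have "\<dots> = (\<Prod>p\<in>prime_factors g. p)"
    using assms squarefree_factorial_semiring'[OF g] by (intro prod.cong) auto
  finally show ?thesis .
qed

text \<open>Divisors of a square-free number are the subsets of its set of primes; in this form the
  sum over g becomes an expanded product.\<close>

lemma sum_squarefree_divisors:
  fixes M :: nat and \<Phi> :: "nat set \<Rightarrow> nat set \<Rightarrow> real"
  assumes M: "squarefree M" "M > 0"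
  shows "(\<Sum>g | g dvd M. \<Phi> (prime_factors g) (prime_factors (M div g))) =
    (\<Sum>X\<in>Pow (prime_factors M). \<Phi> X (prime_factors M - X))"
proof -
  have "bij_betw prime_factors {g. g dvd M} (Pow (prime_factors M))"
  proof (rule bij_betwI')
    fix x y assume "x \<in> {g. g dvd M}" "y \<in> {g. g dvd M}"
    hence "squarefree x" "squarefree y" using M squarefree_mono by blast+
    thus "(prime_factors x = prime_factors y) = (x = y)" using squarefree_eq_prod_prime_factors by metis
  next
    fix x assume "x \<in> {g. g dvd M}"
    thus "prime_factors x \<in> Pow (prime_factors M)" using M by (auto intro: dvd_prime_factors[THEN subsetD])
  next
    fix X assume X: "X \<in> Pow (prime_factors M)"
    hence fin: "finite X" using finite_subset by blast
    have pr: "prime p" if "p \<in> X" for p using that X by auto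
    have "\<Prod>X dvd \<Prod>(prime_factors M)" using X by (intro prod_dvd_prod_subset) auto
    hence "\<Prod>X dvd M" using squarefree_eq_prod_prime_factors[OF M(1)] by simp
    moreover have "prime_factors (\<Prod>X) = X"
    proof -
      have "\<Prod>X \<noteq> 0"
      proof
        assume "\<Prod>X = 0"
        hence "0 \<in> X" using fin by (simp add: prod_zero_iff)
        thus False using pr[of 0] by simp
      qed
      hence "p \<in> prime_factors (\<Prod>X) \<longleftrightarrow> p \<in> X" for p
        using fin pr prime_dvd_prod_iff[OF fin, of p "\<lambda>x. x"] primes_dvd_imp_eq
        by (auto simp: in_prime_factors_iff)
      thus ?thesis by blast
    qed
    ultimately show "\<exists>x\<in>{g. g dvd M}. X = prime_factors x" by blast
  qed
  from sum.reindex_bij_betw[OF this, of "\<lambda>X. \<Phi> X (prime_factors M - X)", symmetric]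
  show ?thesis using squarefree_divisor_quotient(2)[OF M(1) _ M(2)] by simp
qed

text \<open>Coprimality of d to m keeps the m-part out of d, coprimality of the codivisor to N / m
  forces the whole part supported on N / m into d, and the rest of d is a free divisor of r.\<close>

lemma sigma_mN1_eq:
  assumes N: "squarefree N" "N > 0" "m dvd N" and F: "F > 0" and r: "r > 0" "coprime r N"
  shows "sigma_mN1 m N (smooth_part (prime_factors N) F * r)
    = smooth_part (prime_factors (N div m)) F * (\<Sum>d | d dvd r. d)"
proof -
  define M where "M = N div m"
  note q = squarefree_divisor_quotient[OF N(1,3,2), folded M_def]
  define a where "a = smooth_part (prime_factors m) F"
  define b where "b = smooth_part (prime_factors M) F"
  have ab: "smooth_part (prime_factors N) F = a * b"
  proof -
    have "prime_factors N = prime_factors m \<union> prime_factors M"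
    proof -
      have "prime_factors m \<subseteq> prime_factors N" using N by (intro dvd_prime_factors) auto
      thus ?thesis using q(2) by blast
    qed
    moreover have "prime_factors m \<inter> prime_factors M = {}" using q(2) by auto
    ultimately show ?thesis unfolding smooth_part_def a_def b_def by (simp add: prod.union_disjoint)
  qed
  have a: "a > 0" "prime_factors a \<subseteq> prime_factors m"
    using smooth_part_decomp[OF F q(3)] unfolding a_def by metis+
  have b: "b > 0" "prime_factors b \<subseteq> prime_factors M"
    using smooth_part_decomp[OF F q(4)] unfolding b_def by metis+
  have Nm: "N = m * M" using N(3) by (simp add: M_def)
  have rm: "coprime r m" "coprime r M" using r(2) unfolding Nm by simp_all
  have aM: "coprime a M"
    using coprime_prime_factors_subset[OF a(2) _ a(1), of M] q(1) by (simp add: coprime_commute)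
  have bm: "coprime b m"
    using coprime_prime_factors_subset[OF b(2) _ b(1), of m] q(1) by (simp add: coprime_commute)
  have "bij_betw (\<lambda>d. b * d) {d. d dvd r}
      {d. d dvd a * b * r \<and> coprime d m \<and> coprime (a * b * r div d) M}"
  proof (rule bij_betwI')
    fix x y show "(b * x = b * y) = (x = y)" using b by simp
  next
    fix d assume "d \<in> {d. d dvd r}"
    then obtain e where e: "r = d * e" by auto
    have d0: "d > 0" using e r by (auto intro!: Nat.gr0I)
    have "a * b * r div (b * d) = a * e" using b d0 by (simp add: e mult_ac)
    moreover have "coprime (a * e) M" using aM rm(2) by (simp add: e)
    moreover have "coprime (b * d) m" using bm rm(1) by (simp add: e)
    ultimately show "b * d \<in> {d. d dvd a * b * r \<and> coprime d m \<and> coprime (a * b * r div d) M}"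
      by (simp add: e)
  next
    fix d assume "d \<in> {d. d dvd a * b * r \<and> coprime d m \<and> coprime (a * b * r div d) M}"
    hence d: "d dvd a * b * r" "coprime d m" "coprime (a * b * r div d) M" by auto
    obtain e where e: "a * b * r = d * e" using d(1) by auto
    have "d > 0" using e a b r by (auto intro!: Nat.gr0I)
    hence eM: "coprime e M" using d(3) by (simp add: e)
    have "coprime e b" by (rule coprime_prime_factors_subset[OF b(2) eM b(1)])
    moreover have "b dvd d * e" using e by (metis dvd_mult dvd_mult2 dvd_refl)
    ultimately have "b dvd d" by (simp add: coprime_commute coprime_dvd_mult_left_iff)
    then obtain c where c: "d = b * c" by auto
    have "coprime d a" by (rule coprime_prime_factors_subset[OF a(2) d(2) a(1)])
    moreover have "d dvd a * (b * r)" using d(1) by (simp add: mult.assoc)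
    ultimately have "d dvd b * r" by (simp add: coprime_dvd_mult_right_iff)
    hence "c dvd r" using b unfolding c by simp
    thus "\<exists>x\<in>{d. d dvd r}. d = b * x" using c by blast
  qed
  from sum.reindex_bij_betw[OF this, of "\<lambda>d. d"] show ?thesis
    unfolding sigma_mN1_def ab M_def[symmetric] b_def[symmetric] by (simp add: sum_distrib_left)
qed

section \<open>Both sides in terms of one class number\<close>

lemma H_PW_via_hurwitz:
  assumes D: "fundamental_disc D" "D < 0" and F: "F > 0" and n: "n = nat (- D) * F\<^sup>2"
    and N: "squarefree N" "N > 0" "m dvd N"
    and R: "F = smooth_part (prime_factors N) F * R" "coprime R N" "R > 0"
    and mod: "n mod 4 \<noteq> 1" "n mod 4 \<noteq> 2"
  shows "H_PW m N n = hurwitz (nat (- D) * R\<^sup>2) * (\<Prod>p\<in>prime_factors m. 1 - of_int (kronecker D p))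
    * (\<Prod>p\<in>prime_factors (N div m). (1 - of_int (kronecker D p) / real p) / (1 - 1 / (real p)^2)
        * real (p ^ multiplicity p F))"
proof -
  let ?S = "smooth_part (prime_factors N) F"
  let ?c = "smooth_part (prime_factors (N div m)) F"
  have S0: "?S > 0" using R(1) F by (metis mult_0 neq0_conv)
  have n0: "n \<noteq> 0" using D F by (simp add: n)
  have set: "{a. a dvd F \<and> coprime a N} = {a. a dvd R}"
  proof -
    have sub: "prime_factors ?S \<subseteq> prime_factors N" using smooth_part_decomp[OF F N(2)] by metis
    have "a dvd F \<and> coprime a N \<longleftrightarrow> a dvd R" for a
    proof
      assume a: "a dvd F \<and> coprime a N"
      hence "coprime a ?S" using coprime_prime_factors_subset[OF sub _ S0] by blast
      moreover have "a dvd ?S * R" using a R(1) by simp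
      ultimately show "a dvd R" by (simp add: coprime_dvd_mult_right_iff)
    next
      assume a: "a dvd R"
      hence "a dvd ?S * R" by (rule dvd_mult)
      moreover have "coprime a N" using a R(2) by (metis coprime_mult_left_iff dvd_def)
      ultimately show "a dvd F \<and> coprime a N" using R(1) by simp
    qed
    thus ?thesis by blast
  qed
  have "(\<Sum>a | a dvd F \<and> coprime a N. real_of_int (moebius a) * of_int (kronecker D a) * real (sigma_mN1 m N (F div a)))
     = (\<Sum>a | a dvd R. real ?c * (of_int (moebius a) * of_int (kronecker D a) * (\<Sum>d | d dvd R div a. real d)))"
    unfolding set
  proof (rule sum.cong[OF refl])
    fix a assume "a \<in> {a. a dvd R}"
    then obtain r where r: "R = a * r" by auto
    have ar: "a > 0" "r > 0" using r R(3) by (auto intro!: Nat.gr0I)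
    have "coprime r N" using R(2) by (simp add: r)
    hence s: "sigma_mN1 m N (?S * r) = ?c * (\<Sum>d | d dvd r. d)" by (rule sigma_mN1_eq[OF N F ar(2)])
    have "F div a = ?S * r" using ar by (subst R(1)) (simp add: r)
    moreover have "R div a = r" using ar by (simp add: r)
    ultimately show "real_of_int (moebius a) * of_int (kronecker D a) * real (sigma_mN1 m N (F div a))
      = real ?c * (of_int (moebius a) * of_int (kronecker D a) * (\<Sum>d | d dvd R div a. real d))"
      by (simp add: s)
  qed
  also have "\<dots> = real ?c * (\<Sum>a | a dvd R. \<Sum>d | d dvd R div a. real d * of_int (moebius a) * of_int (kronecker D a))"
    by (simp add: sum_distrib_left mult_ac)
  \<comment> \<open>Both double sums run over the pairs with a d dividing R; the order is exchanged
    to match the class number formula.\<close>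
  also have "(\<Sum>a | a dvd R. \<Sum>d | d dvd R div a. real d * of_int (moebius a) * of_int (kronecker D a))
     = (\<Sum>d | d dvd R. \<Sum>a | a dvd R div d. real d * of_int (moebius a) * of_int (kronecker D a))"
  proof -
    have iff: "a dvd R \<and> d dvd R div a \<longleftrightarrow> d dvd R \<and> a dvd R div d" for a d
    proof -
      have *: "a * d dvd R" if ad: "a dvd R" "d dvd R div a" for a d
      proof -
        have "a * d dvd a * (R div a)" using ad(2) by (rule mult_dvd_mono[OF dvd_refl])
        thus ?thesis using ad(1) by simp
      qed
      have **: "a dvd R \<and> d dvd R div a" if ad: "a * d dvd R" for a d
      proof -
        obtain c where c: "R = a * d * c" using ad by auto
        have "a > 0" using c R(3) by (auto intro!: Nat.gr0I)
        thus ?thesis by (simp add: c mult.assoc)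
      qed
      have eq: "a dvd R \<and> d dvd R div a \<longleftrightarrow> a * d dvd R" for a d using * ** by blast
      show ?thesis unfolding eq[of a d] eq[of d a] by (simp only: mult.commute)
    qed
    have fin: "finite {a. a dvd R}" using R(3) by simp
    have fil: "(\<Sum>d | d dvd R div a. g d) = (\<Sum>d\<in>{d \<in> {d. d dvd R}. d dvd R div a}. g d)"
      if "a dvd R" for a and g :: "nat \<Rightarrow> real"
    proof (rule sum.cong[OF _ refl])
      show "{d. d dvd R div a} = {d \<in> {d. d dvd R}. d dvd R div a}" using iff[of a] that by blast
    qed
    have "(\<Sum>a | a dvd R. \<Sum>d | d dvd R div a. real d * of_int (moebius a) * of_int (kronecker D a))
      = (\<Sum>a | a dvd R. \<Sum>d\<in>{d \<in> {d. d dvd R}. d dvd R div a}. real d * of_int (moebius a) * of_int (kronecker D a))"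
      by (rule sum.cong[OF refl], rule fil) simp
    also have "\<dots> = (\<Sum>d | d dvd R. \<Sum>a\<in>{a \<in> {a. a dvd R}. d dvd R div a}. real d * of_int (moebius a) * of_int (kronecker D a))"
      by (rule sum.swap_restrict[OF fin fin])
    also have "\<dots> = (\<Sum>d | d dvd R. \<Sum>a | a dvd R div d. real d * of_int (moebius a) * of_int (kronecker D a))"
    proof (rule sum.cong[OF refl], rule sum.cong[OF _ refl])
      fix d assume "d \<in> {d. d dvd R}"
      thus "{a \<in> {a. a dvd R}. d dvd R div a} = {a. a dvd R div d}" using iff[of _ d] by blast
    qed
    finally show ?thesis .
  qed
  finally have sum: "L_at_0 D * (\<Sum>a | a dvd F \<and> coprime a N. real_of_int (moebius a) * of_int (kronecker D a)
      * real (sigma_mN1 m N (F div a))) = real ?c * hurwitz (nat (- D) * R\<^sup>2)"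
    unfolding hurwitz_class_number_formula[OF D R(3)] by simp
  have c: "real ?c = (\<Prod>p\<in>prime_factors (N div m). real (p ^ multiplicity p F))"
    by (simp add: smooth_part_def)
  have "H_PW m N n = Lm_at_0 m D
       * (\<Prod>p\<in>prime_factors (N div m). (1 - of_int (kronecker D p) / real p) / (1 - 1 / (real p)^2))
       * (\<Sum>a | a dvd F \<and> coprime a N. of_int (moebius a) * of_int (kronecker D a) * real (sigma_mN1 m N (F div a)))"
    using n0 mod by (simp add: H_PW_def Let_def cond_f_eqI[OF D F n])
  also have "\<dots> = (L_at_0 D * (\<Sum>a | a dvd F \<and> coprime a N. of_int (moebius a) * of_int (kronecker D a) * real (sigma_mN1 m N (F div a))))
      * (\<Prod>p\<in>prime_factors m. 1 - of_int (kronecker D p))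
      * (\<Prod>p\<in>prime_factors (N div m). (1 - of_int (kronecker D p) / real p) / (1 - 1 / (real p)^2))"
    unfolding Lm_at_0_def by (simp only: mult_ac)
  finally show ?thesis unfolding sum c prod.distrib by (simp only: mult_ac)
qed

text \<open>\<open>f_LSZ\<close> strips exactly the N-part of the conductor, so the class number is
  the one in \<open>H_PW_via_hurwitz\<close>. It does not depend on how N is split into N1 and N2
  and hence factors out of the sum over g.\<close>

lemma H_LSZ_via_hurwitz:
  assumes D: "fundamental_disc D" "D < 0" and F: "F > 0" and n: "n = nat (- D) * F\<^sup>2"
    and N: "odd N" "N1 * N2 = N" "N > 0"
    and R: "F = smooth_part (prime_factors N) F * R" "coprime R N" "R > 0"
    and mod: "n mod 4 \<noteq> 1" "n mod 4 \<noteq> 2"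
  shows "H_LSZ N1 N2 n = hurwitz (nat (- D) * R\<^sup>2) * (\<Prod>p\<in>prime_factors N1. 1 - of_int (kronecker D p))
    * (\<Prod>p\<in>prime_factors N2.
           (2 * real p * real (p ^ multiplicity p F) - real p - 1
            - of_int (kronecker D p) * (2 * real (p ^ multiplicity p F) - real p - 1))
           / (real p - 1))"
proof -
  let ?S = "smooth_part (prime_factors N) F"
  have n0: "n \<noteq> 0" using D F by (simp add: n)
  have S0: "?S > 0" using R(1) F by (metis mult_0 neq0_conv)
  have nS: "n = nat (- D) * R\<^sup>2 * ?S\<^sup>2" unfolding n by (subst R(1)) (simp add: power_mult_distrib mult_ac)
  have q: "n div ?S\<^sup>2 = nat (- D) * R\<^sup>2" using S0 by (subst nS) simp
  have iq: "- int (nat (- D) * R\<^sup>2) = D * (int R)\<^sup>2" using D by simp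
  have pf: "prime_factors N1 \<subseteq> prime_factors N" "prime_factors N2 \<subseteq> prime_factors N"
    using N by (auto simp: prime_factors_product)
  have kr: "kronecker (D * (int R)\<^sup>2) p = kronecker D p" if "p \<in> prime_factors N" for p
  proof (rule kronecker_square_mult)
    have pN: "prime p" "p dvd N" using that by auto
    thus "prime p" "odd p" using N(1) dvd_trans by auto
    show "\<not> p dvd R" using pN R(2) coprime_common_divisor not_prime_unit by blast
  qed
  have H: "H_LSZ N1 N2 n = hurwitz (nat (- D) * R\<^sup>2)
       * (\<Prod>p\<in>prime_factors N1. 1 - of_int (kronecker (D * (int R)\<^sup>2) p))
       * (\<Prod>p\<in>prime_factors N2.
           (2 * real p * real (p ^ multiplicity p ?S) - real p - 1
            - of_int (kronecker (D * (int R)\<^sup>2) p) * (2 * real (p ^ multiplicity p ?S) - real p - 1))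
           / (real p - 1))"
    unfolding H_LSZ_def Let_def f_LSZ_eq[OF D F n N(2,3)] q iq using n0 mod by simp
  have 1: "(\<Prod>p\<in>prime_factors N1. 1 - real_of_int (kronecker (D * (int R)\<^sup>2) p))
     = (\<Prod>p\<in>prime_factors N1. 1 - of_int (kronecker D p))"
    by (rule prod.cong[OF refl]) (use kr pf in auto)
  have 2: "(\<Prod>p\<in>prime_factors N2.
           (2 * real p * real (p ^ multiplicity p ?S) - real p - 1
            - of_int (kronecker (D * (int R)\<^sup>2) p) * (2 * real (p ^ multiplicity p ?S) - real p - 1))
           / (real p - 1))
     = (\<Prod>p\<in>prime_factors N2.
           (2 * real p * real (p ^ multiplicity p F) - real p - 1
            - of_int (kronecker D p) * (2 * real (p ^ multiplicity p F) - real p - 1))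
           / (real p - 1))"
  proof (rule prod.cong[OF refl])
    fix p assume "p \<in> prime_factors N2"
    hence p: "p \<in> prime_factors N" using pf by blast
    show "(2 * real p * real (p ^ multiplicity p ?S) - real p - 1
            - of_int (kronecker (D * (int R)\<^sup>2) p) * (2 * real (p ^ multiplicity p ?S) - real p - 1))
           / (real p - 1) = (2 * real p * real (p ^ multiplicity p F) - real p - 1
            - of_int (kronecker D p) * (2 * real (p ^ multiplicity p F) - real p - 1))
           / (real p - 1)"
      unfolding kr[OF p] multiplicity_smooth_part[OF F N(3) p] ..
  qed
  show ?thesis unfolding H 1 2 ..
qed

text \<open>Over the common denominator (p - 1) (p + 1) the terms free of x cancel on the right and
  2 x (p - c) remains. Here x is the p-part of the conductor and c the value of chi_D at p.\<close>

lemma local_factor_identity: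
  fixes p x c :: real
  assumes "p > 1"
  shows "2 / p * ((1 - c / p) / (1 - 1 / p^2) * x)
    = (1 / (p - 1)) * (1 - c) + (1 / (p + 1)) * ((2 * p * x - p - 1 - c * (2 * x - p - 1)) / (p - 1))"
proof -
  have nz: "p \<noteq> 0" "p - 1 \<noteq> 0" "p + 1 \<noteq> 0" using assms by auto
  have p2: "1 - 1 / p^2 = (p - 1) * (p + 1) / p^2" using nz by (simp add: field_simps power2_eq_square)
  have "2 / p * ((1 - c / p) / (1 - 1 / p^2) * x) = 2 * x * (p - c) / ((p - 1) * (p + 1))"
  proof -
    have "1 - c / p = (p - c) / p" using nz by (simp add: diff_divide_distrib)
    moreover have "2 / p * ((b / p) / (a / p^2) * x) = 2 * x * b / a" for a b
      using nz by (simp add: power2_eq_square)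
    ultimately show ?thesis unfolding p2 by simp
  qed
  also have "\<dots> = ((1 - c) * (p + 1) + (2 * p * x - p - 1 - c * (2 * x - p - 1))) / ((p - 1) * (p + 1))"
    by (rule arg_cong[where f = "\<lambda>z. z / ((p - 1) * (p + 1))"]) (simp add: algebra_simps)
  also have "\<dots> = (1 / (p - 1)) * (1 - c) + (1 / (p + 1)) * ((2 * p * x - p - 1 - c * (2 * x - p - 1)) / (p - 1))"
  proof -
    have "(a + b) / ((p - 1) * (p + 1)) = (1 / (p - 1)) * (a / (p + 1)) + (1 / (p + 1)) * (b / (p - 1))" for a b
      using nz by (simp add: add_divide_distrib mult.commute)
    thus ?thesis using nz by simp
  qed
  finally show ?thesis .
qed

text \<open>Expanding the product over the primes of M, g collects the primes at which the first
  summand is chosen.\<close>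

lemma sum_divisors_local:
  fixes a b u v :: "nat \<Rightarrow> real"
  assumes M: "squarefree M" "M > 0"
  shows "(\<Sum>g | g dvd M. (\<Prod>p\<in>prime_factors g. a p) * (\<Prod>p\<in>prime_factors (M div g). b p)
      * (K * (\<Prod>p\<in>prime_factors g. u p) * (\<Prod>p\<in>prime_factors (M div g). v p)))
    = K * (\<Prod>p\<in>prime_factors M. a p * u p + b p * v p)"
proof -
  have "(\<Sum>g | g dvd M. (\<Prod>p\<in>prime_factors g. a p) * (\<Prod>p\<in>prime_factors (M div g). b p)
      * (K * (\<Prod>p\<in>prime_factors g. u p) * (\<Prod>p\<in>prime_factors (M div g). v p)))
    = (\<Sum>g | g dvd M. K * ((\<Prod>p\<in>prime_factors g. a p * u p) * (\<Prod>p\<in>prime_factors (M div g). b p * v p)))"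
    by (simp add: prod.distrib mult_ac)
  also have "\<dots> = (\<Sum>X\<in>Pow (prime_factors M). K * ((\<Prod>p\<in>X. a p * u p) * (\<Prod>p\<in>prime_factors M - X. b p * v p)))"
    by (rule sum_squarefree_divisors[OF M, where \<Phi> = "\<lambda>X Y. K * ((\<Prod>p\<in>X. a p * u p) * (\<Prod>p\<in>Y. b p * v p))"])
  also have "\<dots> = K * (\<Prod>p\<in>prime_factors M. a p * u p + b p * v p)"
    by (subst prod_add) (simp_all add: sum_distrib_left)
  finally show ?thesis .
qed

lemma H_PW_eq_sum_H_LSZ:
  fixes N m n :: nat
  assumes N: "N > 0" "odd N" "squarefree N" "m dvd N"
  shows "2 ^ omega (N div m) * real m / real N * H_PW m N n
            = (\<Sum>g | g dvd N div m.
                 (\<Prod>p\<in>prime_factors g. 1 / (real p - 1))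
                 * (\<Prod>p\<in>prime_factors (N div (m * g)). 1 / (real p + 1))
                 * H_LSZ (m * g) (N div (m * g)) n)"
proof -
  define M where "M = N div m"
  note q = squarefree_divisor_quotient[OF N(3,4,1), folded M_def]
  have Nm: "N = m * M" using N(4) by (simp add: M_def)
  have Ng: "N div (m * g) = M div g" for g by (simp add: M_def div_mult2_eq)
  have pg: "prime_factors (m * g) = prime_factors m \<union> prime_factors g"
    "prime_factors m \<inter> prime_factors g = {}" "m * g * (M div g) = N" if "g dvd M" for g
  proof -
    have "g > 0" using that q(4) by (auto intro!: Nat.gr0I)
    thus "prime_factors (m * g) = prime_factors m \<union> prime_factors g"
      using q(3) by (simp add: prime_factors_product)
    have "prime_factors g \<subseteq> prime_factors M" using that q(4) by (intro dvd_prime_factors) auto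
    thus "prime_factors m \<inter> prime_factors g = {}" using q(2) by auto
    show "m * g * (M div g) = N" using that by (simp add: Nm mult.assoc)
  qed
  have prodmg: "(\<Prod>p\<in>prime_factors (m * g). h p) = (\<Prod>p\<in>prime_factors m. h p) * (\<Prod>p\<in>prime_factors g. h p)"
    if "g dvd M" for g and h :: "nat \<Rightarrow> real"
    unfolding pg(1)[OF that] by (rule prod.union_disjoint) (use pg(2)[OF that] in auto)
  have p1: "real p > 1" if "p \<in> prime_factors M" for p
    using that prime_gt_1_nat[of p] by (auto simp: in_prime_factors_iff)
  have lead: "2 ^ omega M * real m / real N = (\<Prod>p\<in>prime_factors M. 2 / real p)"
  proof -
    have "real M = (\<Prod>p\<in>prime_factors M. real p)"
      using arg_cong[OF squarefree_eq_prod_prime_factors[OF q(6)], of real] by simp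
    hence "(\<Prod>p\<in>prime_factors M. 2 / real p) = 2 ^ omega M / real M"
      by (simp add: prod_dividef omega_def)
    thus ?thesis using q(3) by (simp add: Nm)
  qed
  consider (zero) "n = 0" | (trivial) "n > 0" "n mod 4 = 1 \<or> n mod 4 = 2"
    | (disc) "n > 0" "n mod 4 = 0 \<or> n mod 4 = 3" by fastforce
  thus ?thesis unfolding Ng M_def[symmetric]
  proof cases
    case zero
    have "(\<Sum>g | g dvd M. (\<Prod>p\<in>prime_factors g. 1 / (real p - 1))
                 * (\<Prod>p\<in>prime_factors (M div g). 1 / (real p + 1)) * H_LSZ (m * g) (M div g) n)
       = (\<Sum>g | g dvd M. (\<Prod>p\<in>prime_factors g. 1 / (real p - 1)) * (\<Prod>p\<in>prime_factors (M div g). 1 / (real p + 1))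
          * ((-1/12 * (\<Prod>p\<in>prime_factors m. 1 - real p)) * (\<Prod>p\<in>prime_factors g. 1 - real p)
          * (\<Prod>p\<in>prime_factors (M div g). real p + 1)))"
      by (rule sum.cong[OF refl]) (simp add: H_LSZ_def zero prodmg)
    also have "\<dots> = (-1/12 * (\<Prod>p\<in>prime_factors m. 1 - real p))
        * (\<Prod>p\<in>prime_factors M. 1 / (real p - 1) * (1 - real p) + 1 / (real p + 1) * (real p + 1))"
      by (rule sum_divisors_local[OF q(6,4)])
    \<comment> \<open>At n = 0 each local factor is - 1 + 1 = 0, so the sum vanishes unless M = 1;
      this reproduces the case distinction in \<open>H_PW\<close> at 0.\<close>
    also have "(\<Prod>p\<in>prime_factors M. 1 / (real p - 1) * (1 - real p) + 1 / (real p + 1) * (real p + 1))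
        = (\<Prod>p\<in>prime_factors M. 0)"
    proof (rule prod.cong[OF refl])
      fix p assume "p \<in> prime_factors M"
      thus "1 / (real p - 1) * (1 - real p) + 1 / (real p + 1) * (real p + 1) = 0"
        using p1[of p] by (simp add: field_simps)
    qed
    also have "(-1/12 * (\<Prod>p\<in>prime_factors m. 1 - real p)) * (\<Prod>p\<in>prime_factors M. 0)
        = 2 ^ omega M * real m / real N * H_PW m N n"
    proof (cases "M = 1")
      case True
      hence "m = N" using Nm by simp
      thus ?thesis using True N(1) by (simp add: zero H_PW_def omega_def)
    next
      case False
      hence "prime_factors M \<noteq> {}" using q(4) by (simp add: prime_factorization_empty_iff)
      hence "(\<Prod>p\<in>prime_factors M. 0) = (0::real)" by (intro prod_zero) auto
      moreover have "m \<noteq> N" using False Nm q(3) by auto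
      ultimately show ?thesis by (simp only: zero H_PW_def simp_thms if_True if_False mult_zero_right)
    qed
    finally show "2 ^ omega M * real m / real N * H_PW m N n = (\<Sum>g | g dvd M.
        (\<Prod>p\<in>prime_factors g. 1 / (real p - 1)) * (\<Prod>p\<in>prime_factors (M div g). 1 / (real p + 1))
        * H_LSZ (m * g) (M div g) n)" by (rule sym)
  next
    case trivial
    thus "2 ^ omega M * real m / real N * H_PW m N n = (\<Sum>g | g dvd M.
        (\<Prod>p\<in>prime_factors g. 1 / (real p - 1)) * (\<Prod>p\<in>prime_factors (M div g). 1 / (real p + 1))
        * H_LSZ (m * g) (M div g) n)" by (simp add: H_PW_def H_LSZ_def)
  next
    case disc
    have "is_disc (- int n)" unfolding is_disc_def using disc(2) by presburger
    then obtain D F where D: "fundamental_disc D" "D < 0" and F: "F > 0" and n: "n = nat (- D) * F\<^sup>2"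
      using fundamental_decomposition_exists[OF disc(1)] by blast
    obtain R where R: "F = smooth_part (prime_factors N) F * R" "coprime R N" "R > 0"
      using smooth_part_decomp[OF F N(1)] by metis
    have mod: "n mod 4 \<noteq> 1" "n mod 4 \<noteq> 2" using disc(2) by auto
    let ?h = "hurwitz (nat (- D) * R\<^sup>2)"
    let ?k = "\<lambda>p. real_of_int (kronecker D p)"
    let ?x = "\<lambda>p. real (p ^ multiplicity p F)"
    let ?E = "\<lambda>p. (2 * real p * ?x p - real p - 1 - ?k p * (2 * ?x p - real p - 1)) / (real p - 1)"
    let ?K = "?h * (\<Prod>p\<in>prime_factors m. 1 - ?k p)"
    have "(\<Sum>g | g dvd M. (\<Prod>p\<in>prime_factors g. 1 / (real p - 1))
                 * (\<Prod>p\<in>prime_factors (M div g). 1 / (real p + 1)) * H_LSZ (m * g) (M div g) n)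
       = (\<Sum>g | g dvd M. (\<Prod>p\<in>prime_factors g. 1 / (real p - 1)) * (\<Prod>p\<in>prime_factors (M div g). 1 / (real p + 1))
          * (?K * (\<Prod>p\<in>prime_factors g. 1 - ?k p) * (\<Prod>p\<in>prime_factors (M div g). ?E p)))"
    proof (rule sum.cong[OF refl])
      fix g assume "g \<in> {g. g dvd M}"
      hence g: "g dvd M" by simp
      show "(\<Prod>p\<in>prime_factors g. 1 / (real p - 1)) * (\<Prod>p\<in>prime_factors (M div g). 1 / (real p + 1)) * H_LSZ (m * g) (M div g) n
        = (\<Prod>p\<in>prime_factors g. 1 / (real p - 1)) * (\<Prod>p\<in>prime_factors (M div g). 1 / (real p + 1))
          * (?K * (\<Prod>p\<in>prime_factors g. 1 - ?k p) * (\<Prod>p\<in>prime_factors (M div g). ?E p))"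
        unfolding H_LSZ_via_hurwitz[OF D F n N(2) pg(3)[OF g] N(1) R mod] prodmg[OF g] by (simp only: mult.assoc)
    qed
    also have "\<dots> = ?K * (\<Prod>p\<in>prime_factors M. 1 / (real p - 1) * (1 - ?k p) + 1 / (real p + 1) * ?E p)"
      by (rule sum_divisors_local[OF q(6,4)])
    also have "(\<Prod>p\<in>prime_factors M. 1 / (real p - 1) * (1 - ?k p) + 1 / (real p + 1) * ?E p)
       = (\<Prod>p\<in>prime_factors M. 2 / real p * ((1 - ?k p / real p) / (1 - 1 / (real p)^2) * ?x p))"
      by (intro prod.cong refl local_factor_identity[symmetric] p1)
    also have "?K * \<dots> = 2 ^ omega M * real m / real N * H_PW m N n"
      unfolding H_PW_via_hurwitz[OF D F n N(3,1,4) R mod] lead M_def[symmetric] prod.distrib[of "\<lambda>p. 2 / real p"]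
      by (simp only: mult_ac)
    finally show "2 ^ omega M * real m / real N * H_PW m N n = (\<Sum>g | g dvd M.
        (\<Prod>p\<in>prime_factors g. 1 / (real p - 1)) * (\<Prod>p\<in>prime_factors (M div g). 1 / (real p + 1))
        * H_LSZ (m * g) (M div g) n)" by (rule sym)
  qed
qed

theorem theorem1p4:
  fixes N m :: nat
  assumes "N > 1" and "odd N" and "squarefree N" and "m dvd N"
  shows "(\<forall>n::nat. 2 ^ omega (N div m) * real m / real N * H_PW m N n
            = (\<Sum>g | g dvd N div m.
                 (\<Prod>p\<in>prime_factors g. 1 / (real p - 1))
                 * (\<Prod>p\<in>prime_factors (N div (m * g)). 1 / (real p + 1))
                 * H_LSZ (m * g) (N div (m * g)) n))
         \<and> (\<forall>n::nat. H_PW N N n = H_LSZ N 1 n)"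
proof (intro conjI allI)
  have N: "N > 0" using assms(1) by simp
  show "2 ^ omega (N div m) * real m / real N * H_PW m N n
            = (\<Sum>g | g dvd N div m.
                 (\<Prod>p\<in>prime_factors g. 1 / (real p - 1))
                 * (\<Prod>p\<in>prime_factors (N div (m * g)). 1 / (real p + 1))
                 * H_LSZ (m * g) (N div (m * g)) n)" for n
    by (rule H_PW_eq_sum_H_LSZ[OF N assms(2-4)])
  \<comment> \<open>For m = N only g = 1 occurs, and both weights as well as the leading factor are
    1.\<close>
  have "{g::nat. g dvd 1} = {1}" by auto
  thus "H_PW N N n = H_LSZ N 1 n" for n
    using H_PW_eq_sum_H_LSZ[OF N assms(2,3) dvd_refl, of n] N by (simp add: omega_def)
qed

end
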